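(* Let $0<a<b$. For every $\lambda\ge 0$ there exists an optimal set, i.e. a minimizer of $J_\lambda(\Omega)=\lambda|\Omega|-P(\Omega)$ over $\mathscr{C}_{a,b}$. Moreover, if $\Omega_\lambda$ denotes an optimal set for the parameter $\lambda$, then: (i) if $0\le\lambda\le \frac{1}{2b}$, then $\Omega_\lambda=D_b$; (ii) if $\frac{1}{2b}<\lambda<\frac{2}{a}$, then $\Omega_\lambda$ is a polygon; (iii) if $\lambda>\frac{2}{a}$, then $\Omega_\lambda=D_a$.
   Context: $D_r$ is the closed disc in $\mathbb{R}^2$ of radius $r$ centered at the origin. $|\Omega|$ is the area and $P(\Omega)$ the perimeter of $\Omega$. $\mathscr{C}_{a,b}$ is the class of (compact) convex sets $K\subseteq\mathbb{R}^2$ with $D_a\subseteq K\subseteq D_b$. *)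

theory Defs
  imports "HOL-Analysis.Analysis"
begin

text \<open>One-dimensional Hausdorff measure (with the normalisation under which a segment has its
  length as measure).  Boundedness of the covering sets is explicit because \<^const>\<open>diameter\<close>
  has no meaningful value on unbounded sets.\<close>

definition hausdorff1_pre :: "real \<Rightarrow> 'a::metric_space set \<Rightarrow> ennreal" where
  "hausdorff1_pre \<delta> S =
    (INF A\<in>{A :: nat \<Rightarrow> 'a set. S \<subseteq> (\<Union>i. A i) \<and> (\<forall>i. bounded (A i) \<and> diameter (A i) \<le> \<delta>)}.
      (\<Sum>i. ennreal (diameter (A i))))"

definition hausdorff1 :: "'a::metric_space set \<Rightarrow> ennreal" where
  "hausdorff1 S = (SUP \<delta>\<in>{0<..}. hausdorff1_pre \<delta> S)"

text \<open>The perimeter is the length of the topological boundary; it is used only for compact convex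
  sets with nonempty interior, whose boundary has finite length, so \<^const>\<open>enn2real\<close> loses
  nothing.\<close>

definition perimeter :: "(real^2) set \<Rightarrow> real" where
  "perimeter K = enn2real (hausdorff1 (frontier K))"

definition area :: "(real^2) set \<Rightarrow> real" where
  "area K = measure lebesgue K"

definition convex_class :: "real \<Rightarrow> real \<Rightarrow> (real^2) set set" where
  "convex_class a b = {K. compact K \<and> convex K \<and> cball 0 a \<subseteq> K \<and> K \<subseteq> cball 0 b}"

definition J :: "real \<Rightarrow> (real^2) set \<Rightarrow> real" where
  "J lam K = lam * area K - perimeter K"

definition optimal :: "real \<Rightarrow> real \<Rightarrow> real \<Rightarrow> (real^2) set \<Rightarrow> bool" where
  "optimal a b lam \<Omega> \<longleftrightarrow> is_arg_min (J lam) (\<lambda>K. K \<in> convex_class a b) \<Omega>"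

text \<open>A convex polygon, as a filled two-dimensional set: the convex hull of finitely many points,
  not contained in a line.\<close>

definition convex_polygon :: "(real^2) set \<Rightarrow> bool" where
  "convex_polygon S \<longleftrightarrow> polytope S \<and> aff_dim S = 2"

end

theory Submission
  imports Defs "HOL-Complex_Analysis.Great_Picard"
begin

text \<open>
  A convex body between the two discs is represented by a curve \<open>x\<close> that selects, for every normal angle \<open>t\<close>,
  a boundary point on the supporting line with outer normal \<open>nrm t = (cos t, sin t)\<close>.  Write \<open>p\<close> and \<open>m\<close>
  for the normal and the tangential coordinate of \<open>x t\<close>.  Then \<open>p\<close> is the support function, \<open>m\<close> is its derivative
  almost everywhere, and

    \<open>perimeter = \<integral> p\<close>,  \<open>area = 1/2 \<integral> (p\<^sup>2 - m\<^sup>2)\<close>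

  over a period (\<open>perimeter_body\<close>, \<open>area_body\<close>).  The functional becomes the integral of
  \<open>lam/2 (p\<^sup>2 - m\<^sup>2) - p\<close> and the constraint becomes \<open>a \<le> p \<le> b\<close>.

  Small \<open>lam\<close>: points of the body have norm at most \<open>b\<close>, so \<open>m\<^sup>2 \<le> b\<^sup>2 - p\<^sup>2\<close>, and the integrand exceeds its value for the
  large disc by at least \<open>(b - p) (1 - lam (b + p)) \<ge> 0\<close>.  Large \<open>lam\<close>: all supporting lines have distance at least \<open>a\<close>
  from the origin, so the area is at least \<open>a/2\<close> times the perimeter (\<open>sweep_ge_length\<close>), and the
  functional is at least \<open>(lam a/2 - 1) \<integral> p\<close>, which is least for the small disc.

  Intermediate \<open>lam\<close>: the functional is strictly concave along perturbations of \<open>p\<close> supported in a short interval of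
  angles, by a Poincare inequality.  Where \<open>a < p < b\<close>, three consecutive nondegenerate boundary arcs can be dilated by
  slightly different factors without moving the rest of the boundary, because three planar chord vectors
  are linearly dependent; doing this in both directions contradicts minimality (\<open>no_three_arcs\<close>).  So vertices
  cannot accumulate at an end of a free arc.  They cannot accumulate at contacts with the circles either: between two close contacts
  with the outer circle the chord is at least as good as the arc if \<open>1/(2b) < lam\<close> (\<open>contact_outer\<close>), and between two close contacts with
  the inner circle the corner of the two tangents is at least as good if \<open>lam < 2/a\<close> (\<open>contact_inner\<close>), with
  equality only when the arc already has that form.  Hence on either side of every angle the body has a single vertex,
  and finitely many vertices suffice by compactness.

  Existence follows from the Arzela-Ascoli theorem for the gauges of a minimizing sequence, since perimeter and area are monotone and
  homogeneous, hence continuous under convergence up to dilations.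

  The two integral formulas come from an equidistant mesh of normals.  Consecutive supporting lines meet in corners, which are longer than
  the boundary and enclose it; chords are shorter.  For the Hausdorff measure, the metric projection, which is
  1-Lipschitz, maps the corners onto the boundary, and central projection of the chords produces disjoint arcs that
  project onto intervals almost as long as the chords.
\<close>

section \<open>Directions in the plane\<close>

definition nrm :: "real \<Rightarrow> real^2" where "nrm t = vector [cos t, sin t]"

definition tng :: "real \<Rightarrow> real^2" where "tng t = vector [- sin t, cos t]"

lemma inner_nrm: "y \<bullet> nrm t = y$1 * cos t + y$2 * sin t"
  by (simp add: nrm_def inner_vec_def sum_2)

lemma inner_tng: "y \<bullet> tng t = y$2 * cos t - y$1 * sin t"
  by (simp add: tng_def inner_vec_def sum_2)

lemma nrm_inner_nrm: "nrm s \<bullet> nrm t = cos (t - s)"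
  by (simp add: inner_nrm) (simp add: nrm_def cos_diff)

lemma tng_inner_nrm: "tng s \<bullet> nrm t = sin (t - s)"
  by (simp add: inner_nrm) (simp add: tng_def sin_diff)

lemma nrm_inner_tng: "nrm s \<bullet> tng t = sin (s - t)"
  by (simp add: inner_tng) (simp add: nrm_def sin_diff)

lemma tng_inner_tng: "tng s \<bullet> tng t = cos (t - s)"
  by (simp add: inner_tng) (simp add: tng_def cos_diff)

lemma nrm_periodic [simp]: "nrm (t + 2 * pi) = nrm t"
  by (simp add: nrm_def)

lemma tng_periodic [simp]: "tng (t + 2 * pi) = tng t"
  by (simp add: tng_def)

lemma norm_nrm [simp]: "norm (nrm t) = 1"
  by (simp add: norm_eq_sqrt_inner nrm_inner_nrm)

lemma norm_tng [simp]: "norm (tng t) = 1"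
  by (simp add: norm_eq_sqrt_inner tng_inner_tng)

lemma frame_decomp: "y = (y \<bullet> nrm t) *\<^sub>R nrm t + (y \<bullet> tng t) *\<^sub>R tng t"
proof -
  have "(cos t)\<^sup>2 * y$k + (sin t)\<^sup>2 * y$k = y$k" for k
    by (metis cos_squared_eq add.commute distrib_right mult_1 sin_cos_squared_add)
  then show ?thesis
    unfolding vec_eq_iff forall_2
    by (simp add: inner_nrm inner_tng) (simp add: nrm_def tng_def algebra_simps power2_eq_square)
qed

lemma inner_nrm_rotate: "y \<bullet> nrm t' = (y \<bullet> nrm t) * cos (t' - t) + (y \<bullet> tng t) * sin (t' - t)"
  by (subst frame_decomp[of y t]) (simp add: inner_add_left nrm_inner_nrm tng_inner_nrm)

lemma inner_tng_rotate: "y \<bullet> tng t' = (y \<bullet> tng t) * cos (t' - t) - (y \<bullet> nrm t) * sin (t' - t)"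
proof -
  have "sin (t - t') = - sin (t' - t)"
    by (metis minus_diff_eq sin_minus)
  then show ?thesis
    by (subst frame_decomp[of y t]) (simp add: inner_add_left nrm_inner_tng tng_inner_tng)
qed

lemma norm_frame: "(norm y)\<^sup>2 = (y \<bullet> nrm t)\<^sup>2 + (y \<bullet> tng t)\<^sup>2"
proof -
  have "(norm y)\<^sup>2 = y \<bullet> ((y \<bullet> nrm t) *\<^sub>R nrm t + (y \<bullet> tng t) *\<^sub>R tng t)"
    using frame_decomp[of y t] by (simp add: dot_square_norm)
  then show ?thesis
    by (simp add: inner_add_right power2_eq_square)
qed

lemma abs_inner_nrm_le: "\<bar>y \<bullet> nrm t\<bar> \<le> norm y" and abs_inner_tng_le: "\<bar>y \<bullet> tng t\<bar> \<le> norm y"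
  using Cauchy_Schwarz_ineq2[of y "nrm t"] Cauchy_Schwarz_ineq2[of y "tng t"] by auto

lemma inner_nrm_three:
  "sin (\<beta> - \<alpha>) * (y \<bullet> nrm t) = sin (\<beta> - t) * (y \<bullet> nrm \<alpha>) + sin (t - \<alpha>) * (y \<bullet> nrm \<beta>)"
proof -
  have 1: "y \<bullet> nrm \<alpha> = (y \<bullet> nrm t) * cos (t - \<alpha>) - (y \<bullet> tng t) * sin (t - \<alpha>)"
    using inner_nrm_rotate[of y \<alpha> t] cos_minus[of "t - \<alpha>"] sin_minus[of "t - \<alpha>"] by simp
  have 2: "y \<bullet> nrm \<beta> = (y \<bullet> nrm t) * cos (\<beta> - t) + (y \<bullet> tng t) * sin (\<beta> - t)"
    by (rule inner_nrm_rotate)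
  have 3: "sin (\<beta> - \<alpha>) = sin (\<beta> - t) * cos (t - \<alpha>) + cos (\<beta> - t) * sin (t - \<alpha>)"
    using sin_add[of "\<beta> - t" "t - \<alpha>"] by simp
  show ?thesis
    unfolding 1 2 3 by (simp add: algebra_simps)
qed

lemma polar_form:
  obtains t where "c \<le> t" "t < c + 2 * pi" "y = norm y *\<^sub>R nrm t"
proof -
  obtain s where s: "0 \<le> s" "s < 2 * pi" and y: "y = norm y *\<^sub>R nrm s"
  proof (cases "y = 0")
    case False
    have "(y$1)\<^sup>2 + (y$2)\<^sup>2 = (norm y)\<^sup>2"
      by (simp add: power2_norm_eq_inner inner_vec_def sum_2) (simp add: power2_eq_square)
    then have "(y$1 / norm y)\<^sup>2 + (y$2 / norm y)\<^sup>2 = 1"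
      using False by (simp add: power_divide flip: add_divide_distrib)
    then obtain s where s: "0 \<le> s" "s < 2 * pi" "y$1 / norm y = cos s" "y$2 / norm y = sin s"
      using sincos_total_2pi by metis
    have "y = norm y *\<^sub>R nrm s"
      unfolding vec_eq_iff forall_2 using s False by (simp add: nrm_def field_simps)
    with s show ?thesis using that by blast
  qed (use that[of 0] in auto)
  define k where "k = \<lfloor>(s - c) / (2 * pi)\<rfloor>"
  have k: "of_int k \<le> (s - c) / (2 * pi)" "(s - c) / (2 * pi) < of_int k + 1"
    unfolding k_def by linarith+
  have "nrm (s - 2 * pi * of_int k) = nrm s"
    using sin_int_2pin[of k] cos_int_2pin[of k] by (simp add: nrm_def cos_diff sin_diff)
  moreover have "c \<le> s - 2 * pi * of_int k" "s - 2 * pi * of_int k < c + 2 * pi"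
    using k by (simp_all add: field_simps)
  ultimately show ?thesis
    using that[of "s - 2 * pi * of_int k"] y by metis
qed

lemma norm_nrm_diff: "norm (nrm s - nrm t) \<le> \<bar>s - t\<bar>"
proof -
  have "(norm (nrm s - nrm t))\<^sup>2 = 2 - 2 * cos (t - s)"
    by (simp add: power2_norm_eq_inner inner_diff_left inner_diff_right nrm_inner_nrm)
       (metis cos_minus minus_diff_eq mult_2)
  also have "\<dots> = 4 * (sin ((t - s) / 2))\<^sup>2"
    using cos_double_sin[of "(t - s) / 2"] by (simp add: diff_divide_distrib)
  also have "\<dots> \<le> 4 * ((t - s) / 2)\<^sup>2"
    using iffD1[OF abs_le_square_iff abs_sin_x_le_abs_x[of "(t - s) / 2"]] by simp
  also have "\<dots> = \<bar>s - t\<bar>\<^sup>2"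
    by (simp add: power_divide power2_commute)
  finally show ?thesis
    by (rule power2_le_imp_le) simp
qed

section \<open>Error estimates over an equidistant mesh\<close>

lemma one_minus_cos_le: "1 - cos h \<le> h\<^sup>2 / 2" for h :: real
proof -
  have "1 - cos h = 2 * (sin (h / 2))\<^sup>2"
    using cos_double_sin[of "h / 2"] by simp
  also have "\<dots> \<le> 2 * (h / 2)\<^sup>2"
    using iffD1[OF abs_le_square_iff abs_sin_x_le_abs_x[of "h / 2"]] by simp
  finally show ?thesis by (simp add: power_divide)
qed

lemma sin_ge: "h - h\<^sup>2 / 2 \<le> sin h" if "0 \<le> h" "h \<le> 1" for h :: real
proof -
  have "(\<lambda>t. sin t - (t - t\<^sup>2 / 2)) 0 \<le> (\<lambda>t. sin t - (t - t\<^sup>2 / 2)) h"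
  proof (rule DERIV_nonneg_imp_nondecreasing[OF that(1)])
    fix t assume t: "0 \<le> t" "t \<le> h"
    have "((\<lambda>t. sin t - (t - t\<^sup>2 / 2)) has_real_derivative cos t - (1 - t)) (at t)"
      by (auto intro!: derivative_eq_intros)
    moreover have "t * t \<le> t * 1"
      using t that by (intro mult_left_mono) auto
    then have "0 \<le> cos t - (1 - t)"
      using one_minus_cos_le[of t] t by (simp add: power2_eq_square)
    ultimately show "\<exists>y. ((\<lambda>t. sin t - (t - t\<^sup>2 / 2)) has_real_derivative y) (at t) \<and> 0 \<le> y"
      by blast
  qed
  then show ?thesis by simp
qed

lemma integral_le_const:
  fixes f :: "real \<Rightarrow> real"
  assumes "f integrable_on {s..t}" "s \<le> t" "\<And>r. s \<le> r \<Longrightarrow> r \<le> t \<Longrightarrow> f r \<le> B"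
  shows "integral {s..t} f \<le> B * (t - s)"
proof -
  have "integral {s..t} f \<le> integral {s..t} (\<lambda>_. B)"
    using assms by (intro integral_le) auto
  then show ?thesis using assms by (simp add: mult.commute)
qed

lemma integral_ge_const:
  fixes f :: "real \<Rightarrow> real"
  assumes "f integrable_on {s..t}" "s \<le> t" "\<And>r. s \<le> r \<Longrightarrow> r \<le> t \<Longrightarrow> B \<le> f r"
  shows "B * (t - s) \<le> integral {s..t} f"
proof -
  have "integral {s..t} (\<lambda>_. B) \<le> integral {s..t} f"
    using assms by (intro integral_le) auto
  then show ?thesis using assms by (simp add: mult.commute)
qed

lemma integrable_bounded_borel:
  fixes f :: "real \<Rightarrow> real"
  assumes "f \<in> borel_measurable borel" "\<And>t. \<bar>f t\<bar> \<le> C"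
  shows "f integrable_on {s..t}"
proof (rule measurable_bounded_by_integrable_imp_integrable)
  show "f \<in> borel_measurable (lebesgue_on {s..t})"
    using assms(1) by (simp add: borel_measurable_if_I measurable_completion measurable_restrict_space1)
  show "(\<lambda>_. C) integrable_on {s..t}" by (rule integrable_const_ivl)
qed (use assms in auto)

definition mesh :: "real \<Rightarrow> real \<Rightarrow> nat \<Rightarrow> nat \<Rightarrow> real" where
  "mesh l r n k = l + real k * ((r - l) / real n)"

lemma mesh_0 [simp]: "mesh l r n 0 = l"
  by (simp add: mesh_def)

lemma mesh_n [simp]: "0 < n \<Longrightarrow> mesh l r n n = r"
  by (simp add: mesh_def)

lemma mesh_Suc: "mesh l r n (Suc k) = mesh l r n k + (r - l) / real n"
  unfolding mesh_def of_nat_Suc distrib_right by simp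

lemma mesh_in:
  assumes "l \<le> r" "k \<le> n"
  shows "l \<le> mesh l r n k" "mesh l r n k \<le> r"
proof -
  show "l \<le> mesh l r n k" using assms by (simp add: mesh_def)
  show "mesh l r n k \<le> r"
  proof (cases "n = 0")
    case False
    have "real k * ((r - l) / real n) \<le> real n * ((r - l) / real n)"
      using assms by (intro mult_right_mono) auto
    then show ?thesis using False by (simp add: mesh_def)
  qed (use assms in \<open>simp add: mesh_def\<close>)
qed

text \<open>The increments of \<open>g\<close> telescope, so the \<open>n\<close> errors add up to \<open>O(1/n)\<close>.  All limit passages from polygons to
  general convex bodies below are instances of this, with \<open>g\<close> constant or a monotone function that controls the
  oscillation of the tangential coordinate.\<close>

lemma mesh_sum_le:
  fixes \<Phi> g :: "real \<Rightarrow> real"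
  assumes lr: "l \<le> r" and n: "0 < n" "(r - l) / real n \<le> \<eta>"
    and inc: "\<And>s t. l \<le> s \<Longrightarrow> s \<le> t \<Longrightarrow> t \<le> r \<Longrightarrow> t \<le> s + \<eta> \<Longrightarrow>
      A s t \<le> \<Phi> t - \<Phi> s + C * ((t - s) * ((t - s) + (g t - g s)))"
  shows "(\<Sum>k<n. A (mesh l r n k) (mesh l r n (Suc k)))
    \<le> \<Phi> r - \<Phi> l + C * (r - l) * ((r - l) + (g r - g l)) / real n"
proof -
  let ?m = "mesh l r n"
  define h where "h = (r - l) / real n"
  have h0: "0 \<le> h" using lr by (simp add: h_def)
  have "(\<Sum>k<n. A (?m k) (?m (Suc k)))
    \<le> (\<Sum>k<n. (\<Phi> (?m (Suc k)) - \<Phi> (?m k)) + C * (h * (h + (g (?m (Suc k)) - g (?m k)))))"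
  proof (rule sum_mono)
    fix k assume k: "k \<in> {..<n}"
    have "?m (Suc k) - ?m k = h" by (simp add: mesh_Suc h_def)
    moreover have "l \<le> ?m k" "?m (Suc k) \<le> r" using mesh_in[OF lr] k by auto
    ultimately show "A (?m k) (?m (Suc k))
      \<le> (\<Phi> (?m (Suc k)) - \<Phi> (?m k)) + C * (h * (h + (g (?m (Suc k)) - g (?m k))))"
      using inc[of "?m k" "?m (Suc k)"] h0 n by (simp add: h_def)
  qed
  also have "\<dots> = (\<Sum>k<n. \<Phi> (?m (Suc k)) - \<Phi> (?m k)) + C * (h * (\<Sum>k<n. h + (g (?m (Suc k)) - g (?m k))))"
    by (subst sum.distrib) (simp only: sum_distrib_left)
  also have "(\<Sum>k<n. h + (g (?m (Suc k)) - g (?m k))) = (r - l) + (g r - g l)"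
  proof -
    have "(\<Sum>k<n. h) = r - l" using n by (simp add: h_def)
    moreover have "(\<Sum>k<n. g (?m (Suc k)) - g (?m k)) = g r - g l"
      using n by (subst sum_lessThan_telescope) simp
    ultimately show ?thesis by (simp only: sum.distrib)
  qed
  also have "(\<Sum>k<n. \<Phi> (?m (Suc k)) - \<Phi> (?m k)) = \<Phi> r - \<Phi> l"
    using n by (subst sum_lessThan_telescope) simp
  finally show ?thesis by (simp add: h_def mult.assoc)
qed

lemma ge_of_ge_minus_inverse:
  fixes A B C :: real
  assumes "\<And>n. n \<ge> N \<Longrightarrow> A - C / real n \<le> B"
  shows "A \<le> B"
proof -
  have "(\<lambda>n. A - C / real n) \<longlonglongrightarrow> A - 0"
    by (intro tendsto_intros lim_const_over_n)
  then show ?thesis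
    using assms by (intro LIMSEQ_le_const2[of _ "A - 0" B, simplified]) auto
qed

lemma increment_ge:
  fixes F g :: "real \<Rightarrow> real"
  assumes lr: "l \<le> r" and \<eta>: "0 < \<eta>"
    and inc: "\<And>s t. l \<le> s \<Longrightarrow> s \<le> t \<Longrightarrow> t \<le> r \<Longrightarrow> t \<le> s + \<eta> \<Longrightarrow>
      - C * ((t - s) * ((t - s) + (g t - g s))) \<le> F t - F s"
  shows "F l \<le> F r"
proof -
  obtain N :: nat where N: "(r - l) / \<eta> < real N" using reals_Archimedean2 by blast
  have "0 - (C * (r - l) * ((r - l) + (g r - g l))) / real n \<le> F r - F l" if n: "n \<ge> Suc N" for n
  proof -
    have "(r - l) / \<eta> \<le> real n" using N n by linarith
    then have "(r - l) / real n \<le> \<eta>" using n \<eta> by (simp add: field_simps)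
    then have "(\<Sum>k<n. 0) \<le> F r - F l + C * (r - l) * ((r - l) + (g r - g l)) / real n"
    proof (intro mesh_sum_le[OF lr, where A = "\<lambda>_ _. 0" and \<Phi> = F and \<eta> = \<eta>])
      fix s t assume "l \<le> s" "s \<le> t" "t \<le> r" "t \<le> s + \<eta>"
      from inc[OF this] show "0 \<le> F t - F s + C * ((t - s) * ((t - s) + (g t - g s)))"
        unfolding mult_minus_left by linarith
    qed (use n in auto)
    then show ?thesis by simp
  qed
  from ge_of_ge_minus_inverse[OF this] show ?thesis by simp
qed

lemma mesh_cover:
  assumes "l \<le> t" "t \<le> r" "0 < n"
  obtains k where "k < n" "mesh l r n k \<le> t" "t \<le> mesh l r n (Suc k)"
proof -
  define P where "P k \<longleftrightarrow> t \<le> mesh l r n (Suc k)" for k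
  have "P (n - 1)" using assms by (simp add: P_def)
  define k where "k = (LEAST k. P k)"
  have k: "P k" "k \<le> n - 1" unfolding k_def using \<open>P (n - 1)\<close> by (auto intro: LeastI Least_le)
  have "mesh l r n k \<le> t"
  proof (cases k)
    case (Suc j)
    then have "j < (LEAST k. P k)" by (simp add: k_def)
    then have "\<not> P j" by (rule not_less_Least)
    then show ?thesis using Suc by (simp add: P_def)
  qed (use assms in simp)
  moreover have "k < n" using k(2) assms(3) by linarith
  ultimately show ?thesis using that k(1) unfolding P_def by blast
qed

lemma shrink_interval:
  fixes F :: "real \<Rightarrow> real"
  assumes cont: "continuous_on {0..1} F" and "F 0 < F 1" "0 < \<eta>"
  obtains e where "0 < e" "e < 1 / 2" "F e \<le> F (1 - e)" "F 1 - F 0 - \<eta> \<le> F (1 - e) - F e"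
proof -
  define \<delta> where "\<delta> = min \<eta> (F 1 - F 0) / 2"
  have \<delta>: "0 < \<delta>" "2 * \<delta> \<le> \<eta>" "2 * \<delta> \<le> F 1 - F 0" using assms by (auto simp: \<delta>_def)
  obtain d0 where d0: "0 < d0" "\<And>r. r \<in> {0..1} \<Longrightarrow> dist r 0 < d0 \<Longrightarrow> dist (F r) (F 0) < \<delta>"
    using cont \<delta>(1) unfolding continuous_on_iff by (metis atLeastAtMost_iff order_refl zero_le_one)
  obtain d1 where d1: "0 < d1" "\<And>r. r \<in> {0..1} \<Longrightarrow> dist r 1 < d1 \<Longrightarrow> dist (F r) (F 1) < \<delta>"
    using cont \<delta>(1) unfolding continuous_on_iff by (metis atLeastAtMost_iff order_refl zero_le_one)
  define e where "e = min (1 / 2) (min d0 d1) / 2"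
  have e: "0 < e" "e < 1 / 2" "e < d0" "e < d1" using d0(1) d1(1) by (auto simp: e_def min_def)
  have "\<bar>F e - F 0\<bar> < \<delta>" "\<bar>F (1 - e) - F 1\<bar> < \<delta>"
    using d0(2)[of e] d1(2)[of "1 - e"] e by (auto simp: dist_real_def)
  then have "F e \<le> F (1 - e)" "F 1 - F 0 - \<eta> \<le> F (1 - e) - F e"
    using \<delta> by linarith+
  then show ?thesis using that e by blast
qed

section \<open>Estimates for the one-dimensional Hausdorff measure\<close>

lemma hausdorff1_pre_le_finite:
  fixes A :: "'i \<Rightarrow> 'a::metric_space set"
  assumes "finite F" "S \<subseteq> (\<Union>i\<in>F. A i)" "\<And>i. i \<in> F \<Longrightarrow> bounded (A i) \<and> diameter (A i) \<le> \<delta>" "0 \<le> \<delta>"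
  shows "hausdorff1_pre \<delta> S \<le> (\<Sum>i\<in>F. ennreal (diameter (A i)))"
proof -
  obtain f where f: "bij_betw f {0..<card F} F"
    using ex_bij_betw_nat_finite[OF assms(1)] by blast
  define B where "B n = (if n < card F then A (f n) else {})" for n
  have fF: "f n \<in> F" if "n < card F" for n using f that by (auto simp: bij_betw_def)
  have "S \<subseteq> (\<Union>n. B n)"
  proof
    fix y assume "y \<in> S"
    then obtain i where i: "i \<in> F" "y \<in> A i" using assms(2) by blast
    then have "i \<in> f ` {0..<card F}" using f by (simp add: bij_betw_def)
    then obtain n where "n < card F" "f n = i" by auto
    then show "y \<in> (\<Union>n. B n)" using i by (auto simp: B_def)
  qed
  moreover have "bounded (B n) \<and> diameter (B n) \<le> \<delta>" for n
    using assms(3)[OF fF] assms(4) by (auto simp: B_def)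
  ultimately have "hausdorff1_pre \<delta> S \<le> (\<Sum>n. ennreal (diameter (B n)))"
    unfolding hausdorff1_pre_def by (intro INF_lower) auto
  also have "\<dots> = (\<Sum>n\<in>{0..<card F}. ennreal (diameter (B n)))"
    by (rule suminf_finite) (auto simp: B_def)
  also have "\<dots> = (\<Sum>n\<in>{0..<card F}. ennreal (diameter (A (f n))))"
    by (rule sum.cong) (auto simp: B_def)
  also have "\<dots> = (\<Sum>i\<in>F. ennreal (diameter (A i)))"
    by (rule sum.reindex_bij_betw[OF f])
  finally show ?thesis .
qed

text \<open>Cutting every parameter interval into many equal pieces covers the set by sets of small diameter whose
  diameters add up to at most the total length.\<close>

lemma hausdorff1_le_lipschitz_cover:
  fixes f :: "'i \<Rightarrow> real \<Rightarrow> 'a::real_normed_vector"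
  assumes fin: "finite F" and cover: "S \<subseteq> (\<Union>i\<in>F. f i ` {0..len i})"
    and len: "\<And>i. i \<in> F \<Longrightarrow> 0 \<le> len i"
    and lip: "\<And>i s t. i \<in> F \<Longrightarrow> dist (f i s) (f i t) \<le> \<bar>s - t\<bar>"
  shows "hausdorff1 S \<le> ennreal (\<Sum>i\<in>F. len i)"
  unfolding hausdorff1_def
proof (rule SUP_least)
  fix \<delta> :: real assume "\<delta> \<in> {0<..}"
  then have \<delta>: "0 < \<delta>" by simp
  obtain N0 :: nat where N0: "(\<Sum>i\<in>F. len i) / \<delta> < real N0" using reals_Archimedean2 by blast
  define N where "N = Suc N0"
  have N: "0 < N" by (simp add: N_def)
  have small: "len i / real N \<le> \<delta>" if "i \<in> F" for i
  proof -
    have "len i \<le> (\<Sum>i\<in>F. len i)" using fin len that by (intro member_le_sum) auto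
    then have "len i / \<delta> \<le> real N" using N0 \<delta> by (smt (verit) N_def divide_right_mono of_nat_Suc)
    then show ?thesis using N \<delta> by (simp add: field_simps)
  qed
  define A where "A = (\<lambda>(i, k). f i ` {mesh 0 (len i) N k .. mesh 0 (len i) N (Suc k)})"
  have A: "bounded (A (i, k)) \<and> diameter (A (i, k)) \<le> len i / real N" if "i \<in> F" for i k
  proof -
    have d: "dist u v \<le> len i / real N" if "u \<in> A (i, k)" "v \<in> A (i, k)" for u v
    proof -
      from that obtain s t where "u = f i s" "v = f i t" "s \<in> {mesh 0 (len i) N k .. mesh 0 (len i) N (Suc k)}"
        "t \<in> {mesh 0 (len i) N k .. mesh 0 (len i) N (Suc k)}" unfolding A_def by auto
      then show ?thesis using lip[OF \<open>i \<in> F\<close>, of s t] by (auto simp: mesh_Suc)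
    qed
    have "diameter (A (i, k)) \<le> len i / real N"
      by (rule diameter_le) (use d len[OF that] N in \<open>auto simp: dist_norm\<close>)
    moreover have "bounded (A (i, k))"
      unfolding bounded_two_points using d by blast
    ultimately show ?thesis by blast
  qed
  have "S \<subseteq> (\<Union>q\<in>F \<times> {..<N}. A q)"
  proof
    fix y assume "y \<in> S"
    then obtain i t where it: "i \<in> F" "t \<in> {0..len i}" "y = f i t" using cover by auto
    then obtain k where "k < N" "mesh 0 (len i) N k \<le> t" "t \<le> mesh 0 (len i) N (Suc k)"
      using mesh_cover[of 0 t "len i" N] N by auto
    then show "y \<in> (\<Union>q\<in>F \<times> {..<N}. A q)" using it unfolding A_def by force
  qed
  moreover have "bounded (A q) \<and> diameter (A q) \<le> \<delta>" if qF: "q \<in> F \<times> {..<N}" for q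
  proof -
    obtain i k where q: "q = (i, k)" "i \<in> F" using qF by (cases q) auto
    show ?thesis using A[OF q(2), of k] small[OF q(2)] unfolding q(1) by linarith
  qed
  ultimately have "hausdorff1_pre \<delta> S \<le> (\<Sum>q\<in>F \<times> {..<N}. ennreal (diameter (A q)))"
    using \<delta> fin by (intro hausdorff1_pre_le_finite) auto
  also have "\<dots> \<le> (\<Sum>q\<in>F \<times> {..<N}. ennreal (len (fst q) / real N))"
    using A by (intro sum_mono ennreal_leI) auto
  also have "\<dots> = ennreal (\<Sum>q\<in>F \<times> {..<N}. len (fst q) / real N)"
    using len by (intro sum_ennreal) auto
  also have "(\<Sum>q\<in>F \<times> {..<N}. len (fst q) / real N) = (\<Sum>i\<in>F. \<Sum>k<N. len i / real N)"
    using sum.cartesian_product[of "\<lambda>i k. len i / real N" "{..<N}" F] by (simp add: case_prod_unfold)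
  also have "\<dots> = (\<Sum>i\<in>F. len i)" using N by simp
  finally show "hausdorff1_pre \<delta> S \<le> ennreal (\<Sum>i\<in>F. len i)" .
qed

lemma uniformly_separated:
  fixes C :: "'i \<Rightarrow> 'a::heine_borel set"
  assumes "finite I" "\<And>i. i \<in> I \<Longrightarrow> compact (C i)" "\<And>i j. i \<in> I \<Longrightarrow> j \<in> I \<Longrightarrow> i \<noteq> j \<Longrightarrow> C i \<inter> C j = {}"
  obtains \<delta> where "0 < \<delta>" "\<And>i j u v. i \<in> I \<Longrightarrow> j \<in> I \<Longrightarrow> i \<noteq> j \<Longrightarrow> u \<in> C i \<Longrightarrow> v \<in> C j \<Longrightarrow> \<delta> \<le> dist u v"
proof -
  have "\<exists>d>0. \<forall>u\<in>C i. \<forall>v\<in>C j. d \<le> dist u v" if "i \<in> I" "j \<in> I" "i \<noteq> j" for i j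
    using separate_compact_closed[of "C i" "C j"] assms that compact_imp_closed by metis
  then obtain d where d: "\<And>i j. i \<in> I \<Longrightarrow> j \<in> I \<Longrightarrow> i \<noteq> j \<Longrightarrow> 0 < d i j \<and> (\<forall>u\<in>C i. \<forall>v\<in>C j. d i j \<le> dist u v)"
    by metis
  define Q where "Q = insert 1 ((\<lambda>(i, j). d i j) ` {(i, j). i \<in> I \<and> j \<in> I \<and> i \<noteq> j})"
  have "finite {(i, j). i \<in> I \<and> j \<in> I \<and> i \<noteq> j}"
    by (rule finite_subset[of _ "I \<times> I"]) (use assms in auto)
  then have fin: "finite Q" by (simp add: Q_def)
  have "0 < Min Q" using fin d by (subst Min_gr_iff) (auto simp: Q_def)
  moreover have "Min Q \<le> dist u v" if "i \<in> I" "j \<in> I" "i \<noteq> j" "u \<in> C i" "v \<in> C j" for i j u v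
  proof -
    have "Min Q \<le> d i j" using fin that by (intro Min_le) (auto simp: Q_def)
    then show ?thesis using d[OF that(1-3)] that(4,5) by force
  qed
  ultimately show ?thesis using that by blast
qed

text \<open>Covering sets finer than the distance between the compact pieces meet at most one piece each, and a
  covering of a piece projects to a covering of an interval.\<close>

lemma hausdorff1_ge_separated:
  fixes C :: "'i \<Rightarrow> 'a::heine_borel set" and f :: "'i \<Rightarrow> 'a \<Rightarrow> real"
  assumes fin: "finite I" and C: "\<And>i. i \<in> I \<Longrightarrow> compact (C i)" "\<And>i. i \<in> I \<Longrightarrow> C i \<subseteq> S"
    and disj: "\<And>i j. i \<in> I \<Longrightarrow> j \<in> I \<Longrightarrow> i \<noteq> j \<Longrightarrow> C i \<inter> C j = {}"
    and lip: "\<And>i u v. i \<in> I \<Longrightarrow> \<bar>f i u - f i v\<bar> \<le> dist u v"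
    and img: "\<And>i. i \<in> I \<Longrightarrow> {lo i..hi i} \<subseteq> f i ` C i" and le: "\<And>i. i \<in> I \<Longrightarrow> lo i \<le> hi i"
  shows "ennreal (\<Sum>i\<in>I. hi i - lo i) \<le> hausdorff1 S"
proof -
  obtain \<delta> where \<delta>: "0 < \<delta>"
    and sep: "\<And>i j u v. i \<in> I \<Longrightarrow> j \<in> I \<Longrightarrow> i \<noteq> j \<Longrightarrow> u \<in> C i \<Longrightarrow> v \<in> C j \<Longrightarrow> \<delta> \<le> dist u v"
    by (rule uniformly_separated[of I C, OF fin C(1) disj]) blast+
  \<comment> \<open>Two points of a covering set have distance at most \<open>\<delta> / 2\<close>, so they cannot lie in different pieces.\<close>
  have "ennreal (\<Sum>i\<in>I. hi i - lo i) \<le> hausdorff1_pre (\<delta> / 2) S"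
    unfolding hausdorff1_pre_def
  proof (rule INF_greatest)
    fix A :: "nat \<Rightarrow> 'a set"
    assume "A \<in> {A. S \<subseteq> (\<Union>n. A n) \<and> (\<forall>n. bounded (A n) \<and> diameter (A n) \<le> \<delta> / 2)}"
    then have A: "S \<subseteq> (\<Union>n. A n)" "\<And>n. bounded (A n)" "\<And>n. diameter (A n) \<le> \<delta> / 2" by auto
    define e where "e i n = (if A n \<inter> C i = {} then 0 else ennreal (diameter (A n)))" for i n
    define L where "L i n = Inf (f i ` (A n \<inter> C i))" for i n
    define V where "V i n = (if A n \<inter> C i = {} then {} else {L i n .. L i n + diameter (A n)})" for i n
    have V: "f i u \<in> V i n" if "i \<in> I" "u \<in> A n \<inter> C i" for i n u
    proof -
      have ge: "f i u - diameter (A n) \<le> f i v" if "v \<in> A n \<inter> C i" for v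
        using lip[OF \<open>i \<in> I\<close>, of u v] diameter_bounded_bound[OF A(2), of u n v] that \<open>u \<in> A n \<inter> C i\<close>
        by auto
      have "L i n \<le> f i u" unfolding L_def
      proof (rule cInf_lower)
        show "bdd_below (f i ` (A n \<inter> C i))" using ge by (intro bdd_belowI2)
      qed (use that in auto)
      moreover have "f i u - diameter (A n) \<le> L i n"
        unfolding L_def using ge that by (intro cInf_greatest) auto
      ultimately show ?thesis using that by (auto simp: V_def)
    qed
    have piece: "ennreal (hi i - lo i) \<le> (\<Sum>n. e i n)" if i: "i \<in> I" for i
    proof -
      have "{lo i..hi i} \<subseteq> (\<Union>n. V i n)"
      proof
        fix r assume "r \<in> {lo i..hi i}"
        then obtain u where u: "u \<in> C i" "r = f i u" using img[OF i] by blast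
        then obtain n where "u \<in> A n" using A(1) C(2)[OF i] by blast
        then show "r \<in> (\<Union>n. V i n)" using V[OF i, of u n] u by auto
      qed
      then have "emeasure lborel {lo i..hi i} \<le> emeasure lborel (\<Union>n. V i n)"
        by (intro emeasure_mono) (auto simp: V_def)
      also have "\<dots> \<le> (\<Sum>n. emeasure lborel (V i n))"
        by (rule emeasure_subadditive_countably) (auto simp: V_def)
      also have "\<dots> = (\<Sum>n. e i n)"
        by (intro suminf_cong) (auto simp: V_def e_def diameter_ge_0[OF A(2)])
      finally show ?thesis using le[OF i] by simp
    qed
    have one: "(\<Sum>i\<in>I. e i n) \<le> ennreal (diameter (A n))" for n
    proof (cases "\<exists>i\<in>I. A n \<inter> C i \<noteq> {}")
      case True
      then obtain i u where i: "i \<in> I" "u \<in> A n" "u \<in> C i" by blast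
      have "e j n = 0" if "j \<in> I" "j \<noteq> i" for j
      proof -
        have "A n \<inter> C j = {}"
        proof (rule ccontr)
          assume "A n \<inter> C j \<noteq> {}"
          then obtain v where v: "v \<in> A n" "v \<in> C j" by blast
          then have "dist u v \<le> \<delta> / 2"
            using diameter_bounded_bound[OF A(2) i(2), of v] A(3)[of n] by auto
          then show False using sep[of i j u v] i v that \<delta> by auto
        qed
        then show ?thesis by (simp add: e_def)
      qed
      then have "(\<Sum>i\<in>I. e i n) = (\<Sum>j\<in>{i}. e j n)"
        using fin i by (intro sum.mono_neutral_right) auto
      then show ?thesis by (simp add: e_def)
    next
      case False
      then have "(\<Sum>i\<in>I. e i n) = 0" by (intro sum.neutral) (auto simp: e_def)
      then show ?thesis by simp
    qed
    have "ennreal (\<Sum>i\<in>I. hi i - lo i) = (\<Sum>i\<in>I. ennreal (hi i - lo i))"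
      using le by (intro sum_ennreal[symmetric]) auto
    also have "\<dots> \<le> (\<Sum>i\<in>I. \<Sum>n. e i n)" by (intro sum_mono piece)
    also have "\<dots> = (\<Sum>n. \<Sum>i\<in>I. e i n)" by (rule suminf_sum[symmetric]) simp
    also have "\<dots> \<le> (\<Sum>n. ennreal (diameter (A n)))" by (intro suminf_le one) auto
    finally show "ennreal (\<Sum>i\<in>I. hi i - lo i) \<le> (\<Sum>n. ennreal (diameter (A n)))" .
  qed
  also have "\<dots> \<le> hausdorff1 S"
    unfolding hausdorff1_def using \<delta> by (intro SUP_upper) auto
  finally show ?thesis .
qed

section \<open>Triangles\<close>

definition cross2 :: "real^2 \<Rightarrow> real^2 \<Rightarrow> real" where
  "cross2 y z = y$1 * z$2 - y$2 * z$1"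

lemma cross2_frame: "cross2 y z = (y \<bullet> nrm t) * (z \<bullet> tng t) - (y \<bullet> tng t) * (z \<bullet> nrm t)"
proof -
  have "(y$1 * c + y$2 * s) * (z$2 * c - z$1 * s) - (y$2 * c - y$1 * s) * (z$1 * c + z$2 * s)
      = (y$1 * z$2 - y$2 * z$1) * (s\<^sup>2 + c\<^sup>2)" for c s
    by (simp only: power2_eq_square) (simp add: algebra_simps)
  from this[of "cos t" "sin t"] show ?thesis
    by (simp add: cross2_def inner_nrm inner_tng)
qed

lemma cross2_simps:
  "cross2 (y + y') z = cross2 y z + cross2 y' z" "cross2 y (z + z') = cross2 y z + cross2 y z'"
  "cross2 (y - y') z = cross2 y z - cross2 y' z" "cross2 y (z - z') = cross2 y z - cross2 y z'"
  "cross2 (r *\<^sub>R y) z = r * cross2 y z" "cross2 y (r *\<^sub>R z) = r * cross2 y z" "cross2 y y = 0"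
  by (simp_all add: cross2_def algebra_simps)

lemma cross2_nrm: "cross2 (r *\<^sub>R nrm s) (q *\<^sub>R nrm t) = r * q * sin (t - s)"
  unfolding cross2_simps by (simp add: cross2_def nrm_def sin_diff)

lemma cross2_tng: "cross2 y (tng t) = y \<bullet> nrm t" "cross2 (tng t) y = - (y \<bullet> nrm t)"
  by (simp_all add: cross2_def inner_nrm tng_def)

definition tri :: "real^2 \<Rightarrow> real^2 \<Rightarrow> (real^2) set" where
  "tri y z = {u *\<^sub>R y + v *\<^sub>R z | u v. 0 \<le> u \<and> 0 \<le> v \<and> u + v \<le> 1}"

definition otri :: "real^2 \<Rightarrow> real^2 \<Rightarrow> (real^2) set" where
  "otri y z = {u *\<^sub>R y + v *\<^sub>R z | u v. 0 < u \<and> 0 < v \<and> u + v < 1}"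

lemma Basis_plane: "(Basis :: (real^2) set) = {axis 1 1, axis 2 1}"
  by (auto simp: Basis_vec_def) (metis exhaust_2)

lemma std_simplex_plane:
  "convex hull (insert 0 Basis) = {v :: real^2. 0 \<le> v$1 \<and> 0 \<le> v$2 \<and> v$1 + v$2 \<le> 1}"
  "interior (convex hull (insert 0 Basis)) = {v :: real^2. 0 < v$1 \<and> 0 < v$2 \<and> v$1 + v$2 < 1}"
proof -
  have ne: "axis 1 1 \<noteq> (axis 2 1 :: real^2)" by (simp add: axis_eq_axis)
  show "convex hull (insert 0 Basis) = {v :: real^2. 0 \<le> v$1 \<and> 0 \<le> v$2 \<and> v$1 + v$2 \<le> 1}"
    unfolding std_simplex using ne by (simp add: Basis_plane inner_axis)
  show "interior (convex hull (insert 0 Basis)) = {v :: real^2. 0 < v$1 \<and> 0 < v$2 \<and> v$1 + v$2 < 1}"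
    unfolding interior_std_simplex using ne by (simp add: Basis_plane inner_axis)
qed

lemma tri_measure:
  shows "tri y z \<in> lmeasurable" "measure lebesgue (tri y z) = \<bar>cross2 y z\<bar> / 2"
    "otri y z \<in> lmeasurable" "measure lebesgue (otri y z) = \<bar>cross2 y z\<bar> / 2"
proof -
  let ?S = "convex hull (insert 0 Basis) :: (real^2) set"
  define L where "L v = v$1 *\<^sub>R y + v$2 *\<^sub>R z" for v :: "real^2"
  have lin: "linear L" by (rule linearI) (auto simp: L_def algebra_simps)
  have det: "det (matrix L) = cross2 y z"
    by (simp add: det_2 matrix_def L_def cross2_def axis_def)
  have S: "?S \<in> lmeasurable" "measure lebesgue ?S = 1 / 2"
  proof -
    have "bounded ?S" by (intro bounded_convex_hull finite_imp_bounded) simp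
    then show "?S \<in> lmeasurable" by (intro measurable_convex) auto
    have "compact ?S" by (rule compact_convex_hull, rule finite_imp_compact) simp
    then have "measure lebesgue ?S = measure lborel ?S"
      by (intro measure_completion) (simp add: borel_compact)
    then show "measure lebesgue ?S = 1 / 2" by (simp add: content_std_simplex)
  qed
  have iS: "interior ?S \<in> lmeasurable" "measure lebesgue (interior ?S) = 1 / 2"
  proof -
    have bd: "bounded ?S" by (intro bounded_convex_hull finite_imp_bounded) simp
    then show "interior ?S \<in> lmeasurable" by (intro lmeasurable_interior)
    show "measure lebesgue (interior ?S) = 1 / 2"
      using S measure_interior[OF bd] negligible_convex_frontier[of ?S] by simp
  qed
  have "tri y z = L ` ?S"
  proof (intro set_eqI iffI)
    fix q assume "q \<in> tri y z"
    then obtain u v where uv: "0 \<le> u" "0 \<le> v" "u + v \<le> 1" "q = u *\<^sub>R y + v *\<^sub>R z"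
      unfolding tri_def by blast
    then have "q = L (vector [u, v])" "vector [u, v] \<in> ?S"
      unfolding std_simplex_plane by (simp_all add: L_def)
    then show "q \<in> L ` ?S" by blast
  next
    fix q assume "q \<in> L ` ?S"
    then show "q \<in> tri y z" unfolding tri_def std_simplex_plane L_def by blast
  qed
  then show "tri y z \<in> lmeasurable" "measure lebesgue (tri y z) = \<bar>cross2 y z\<bar> / 2"
    using measurable_linear_image[OF lin S(1)] measure_linear_image[OF lin S(1)] S(2) det by auto
  have "otri y z = L ` interior ?S"
  proof (intro set_eqI iffI)
    fix q assume "q \<in> otri y z"
    then obtain u v where uv: "0 < u" "0 < v" "u + v < 1" "q = u *\<^sub>R y + v *\<^sub>R z"
      unfolding otri_def by blast
    then have "q = L (vector [u, v])" "vector [u, v] \<in> interior ?S"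
      unfolding std_simplex_plane(2) by (simp_all add: L_def)
    then show "q \<in> L ` interior ?S" by blast
  next
    fix q assume "q \<in> L ` interior ?S"
    then show "q \<in> otri y z" unfolding otri_def std_simplex_plane(2) L_def by blast
  qed
  then show "otri y z \<in> lmeasurable" "measure lebesgue (otri y z) = \<bar>cross2 y z\<bar> / 2"
    using measurable_linear_image[OF lin iS(1)] measure_linear_image[OF lin iS(1)] iS(2) det by auto
qed

lemma tri_mem:
  assumes "0 \<le> \<kappa>" "\<kappa> \<le> 1" "0 \<le> q" "q \<le> l"
  shows "\<kappa> *\<^sub>R (y + q *\<^sub>R v) \<in> tri y (y + l *\<^sub>R v)" "\<kappa> *\<^sub>R (y + q *\<^sub>R v) \<in> tri (y + l *\<^sub>R v) y"
proof -
  define \<mu> where "\<mu> = q / l"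
  have \<mu>: "0 \<le> \<mu>" "\<mu> \<le> 1" "\<mu> * l = q" using assms by (auto simp: \<mu>_def divide_le_eq_1)
  have eq: "\<kappa> *\<^sub>R (y + q *\<^sub>R v) = (\<kappa> * (1 - \<mu>)) *\<^sub>R y + (\<kappa> * \<mu>) *\<^sub>R (y + l *\<^sub>R v)"
    unfolding \<mu>(3)[symmetric] by (simp add: algebra_simps)
  have k: "0 \<le> \<kappa> * (1 - \<mu>)" "0 \<le> \<kappa> * \<mu>" "\<kappa> * (1 - \<mu>) + \<kappa> * \<mu> \<le> 1"
    using assms \<mu> by (auto simp: algebra_simps mult_left_le)
  show "\<kappa> *\<^sub>R (y + q *\<^sub>R v) \<in> tri y (y + l *\<^sub>R v)"
    unfolding tri_def mem_Collect_eq by (intro exI[of _ "\<kappa> * (1 - \<mu>)"] exI[of _ "\<kappa> * \<mu>"] conjI k eq)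
  have k': "\<kappa> * \<mu> + \<kappa> * (1 - \<mu>) \<le> 1" using k(3) by simp
  have eq': "\<kappa> *\<^sub>R (y + q *\<^sub>R v) = (\<kappa> * \<mu>) *\<^sub>R (y + l *\<^sub>R v) + (\<kappa> * (1 - \<mu>)) *\<^sub>R y"
    using eq by (simp add: add.commute)
  show "\<kappa> *\<^sub>R (y + q *\<^sub>R v) \<in> tri (y + l *\<^sub>R v) y"
    unfolding tri_def mem_Collect_eq by (intro exI[of _ "\<kappa> * (1 - \<mu>)"] exI[of _ "\<kappa> * \<mu>"] conjI k k' eq')
qed

section \<open>Convex bodies as turning curves\<close>

text \<open>A turning curve assigns to every normal direction a boundary point of a convex body at which
  the line with that normal supports the body; the bounds on the support function
  \<open>x t \<bullet> nrm t\<close> say that the body lies between the two discs.\<close>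

definition turning :: "real \<Rightarrow> real \<Rightarrow> (real \<Rightarrow> real^2) \<Rightarrow> bool" where
  "turning a b x \<longleftrightarrow> (\<forall>t. x (t + 2 * pi) = x t) \<and> (\<forall>s t. x s \<bullet> nrm t \<le> x t \<bullet> nrm t) \<and>
     (\<forall>t. a \<le> x t \<bullet> nrm t \<and> x t \<bullet> nrm t \<le> b)"

definition body :: "(real \<Rightarrow> real^2) \<Rightarrow> (real^2) set" where
  "body x = {y. \<forall>t. y \<bullet> nrm t \<le> x t \<bullet> nrm t}"

lemma turningD:
  assumes "turning a b x"
  shows "x (t + 2 * pi) = x t" "x s \<bullet> nrm t \<le> x t \<bullet> nrm t" "a \<le> x t \<bullet> nrm t" "x t \<bullet> nrm t \<le> b"
  using assms unfolding turning_def by blast+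

lemma turning_mem_body: "turning a b x \<Longrightarrow> x t \<in> body x"
  unfolding turning_def body_def by blast

lemma norm_body_le:
  assumes "turning a b x" "y \<in> body x"
  shows "norm y \<le> b"
proof -
  obtain t where t: "y = norm y *\<^sub>R nrm t" by (rule polar_form[of 0 y])
  have "norm y = y \<bullet> nrm t"
    by (subst (2) t) (simp add: nrm_inner_nrm)
  also have "\<dots> \<le> b"
    using assms unfolding body_def turning_def by (smt (verit) mem_Collect_eq)
  finally show ?thesis .
qed

lemma turning_norm_le: "turning a b x \<Longrightarrow> norm (x t) \<le> b"
  using norm_body_le turning_mem_body by blast

lemma body_in_convex_class:
  assumes "turning a b x"
  shows "body x \<in> convex_class a b"
proof -
  have eq: "body x = (\<Inter>t. {y. nrm t \<bullet> y \<le> x t \<bullet> nrm t})"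
    unfolding body_def by (auto simp: inner_commute)
  have "convex (body x)"
    unfolding eq by (intro convex_INT convex_halfspace_le)
  moreover have "closed (body x)"
    unfolding eq by (intro closed_INT ballI closed_halfspace_le)
  moreover have sub: "body x \<subseteq> cball 0 b"
    using norm_body_le[OF assms] by auto
  moreover have "compact (body x)"
    using \<open>closed (body x)\<close> sub bounded_subset bounded_cball compact_eq_bounded_closed by blast
  moreover have "cball 0 a \<subseteq> body x"
  proof
    fix y :: "real^2" assume "y \<in> cball 0 a"
    then have "y \<bullet> nrm t \<le> x t \<bullet> nrm t" for t
      using abs_inner_nrm_le[of y t] turningD(3)[OF assms, of t] by (simp add: abs_le_iff)
    then show "y \<in> body x" by (simp add: body_def)
  qed
  ultimately show ?thesis by (simp add: convex_class_def)
qed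

lemma separating_nrm:
  fixes K :: "(real^2) set"
  assumes "closed K" "convex K" "K \<noteq> {}" "y \<notin> K"
  obtains t c where "c < y \<bullet> nrm t" "\<And>z. z \<in> K \<Longrightarrow> z \<bullet> nrm t < c"
proof -
  obtain e d where e: "e \<bullet> y < d" "\<And>z. z \<in> K \<Longrightarrow> d < e \<bullet> z"
    using separating_hyperplane_closed_point[of K y] assms by metis
  have "e \<noteq> 0" using e assms(3) by (metis ex_in_conv inner_zero_left order.asym)
  obtain t where t: "- e = norm (- e) *\<^sub>R nrm t" by (rule polar_form[of 0 "- e"])
  have n: "norm e > 0" using \<open>e \<noteq> 0\<close> by simp
  have *: "z \<bullet> nrm t = - (e \<bullet> z) / norm e" for z
  proof -
    have "z \<bullet> (- e) = norm e * (z \<bullet> nrm t)" by (subst t) simp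
    then show ?thesis using n by (simp add: field_simps inner_commute)
  qed
  show ?thesis
  proof (rule that[of "- d / norm e" t])
    show "- d / norm e < y \<bullet> nrm t" using e n by (simp add: * field_simps)
    fix z assume "z \<in> K" then show "z \<bullet> nrm t < - d / norm e"
      using e(2)[of z] n by (simp add: * field_simps)
  qed
qed

lemma convex_class_imp_body:
  assumes "0 < a" "K \<in> convex_class a b"
  obtains x where "turning a b x" "K = body x"
proof -
  have K: "compact K" "convex K" "cball 0 a \<subseteq> K" "K \<subseteq> cball 0 b"
    using assms(2) by (auto simp: convex_class_def)
  have ne: "K \<noteq> {}" using K(3) assms(1) by auto
  have "\<exists>y\<in>K. \<forall>z\<in>K. z \<bullet> v \<le> y \<bullet> v" for v
    by (rule continuous_attains_sup) (auto intro!: continuous_intros K ne)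
  then obtain f where f: "\<And>v. f v \<in> K" "\<And>v z. z \<in> K \<Longrightarrow> z \<bullet> v \<le> f v \<bullet> v"
    by metis
  define x where "x t = f (nrm t)" for t
  have xK: "x t \<in> K" for t by (simp add: x_def f)
  have sup: "z \<in> K \<Longrightarrow> z \<bullet> nrm t \<le> x t \<bullet> nrm t" for z t by (simp add: x_def f)
  have "a \<le> x t \<bullet> nrm t" for t
  proof -
    have "a *\<^sub>R nrm t \<in> K" using K(3) assms(1) by auto
    from sup[OF this, of t] show ?thesis by (simp add: nrm_inner_nrm)
  qed
  moreover have "x t \<bullet> nrm t \<le> b" for t
    using xK[of t] K(4) abs_inner_nrm_le[of "x t" t] by force
  ultimately have "turning a b x"
    unfolding turning_def using sup xK by (simp add: x_def)
  moreover have "K = body x"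
  proof
    show "K \<subseteq> body x" using sup by (auto simp: body_def)
    show "body x \<subseteq> K"
    proof
      fix y assume y: "y \<in> body x"
      show "y \<in> K"
      proof (rule ccontr)
        assume "y \<notin> K"
        then obtain t c where "c < y \<bullet> nrm t" "\<And>z. z \<in> K \<Longrightarrow> z \<bullet> nrm t < c"
          using separating_nrm[OF compact_imp_closed[OF K(1)] K(2) ne \<open>y \<notin> K\<close>] by metis
        moreover have "y \<bullet> nrm t \<le> x t \<bullet> nrm t" using y by (simp add: body_def)
        ultimately show False using xK[of t] by fastforce
      qed
    qed
  qed
  ultimately show ?thesis using that by blast
qed

text \<open>The possible increments of a turning curve between the normal angles \<open>s \<le> t \<le> s + \<pi>\<close>: nonnegative
  combinations of tangent vectors at angles between \<open>s\<close> and \<open>t\<close>.  Being closed under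
  concatenation, they allow a turning curve to be modified piece by piece.\<close>

definition adm :: "real \<Rightarrow> real \<Rightarrow> real^2 \<Rightarrow> bool" where
  "adm s t d \<longleftrightarrow> (\<forall>\<psi>. t \<le> \<psi> \<and> \<psi> \<le> s + pi \<longrightarrow> 0 \<le> d \<bullet> nrm \<psi>) \<and>
     (\<forall>\<psi>. t - pi \<le> \<psi> \<and> \<psi> \<le> s \<longrightarrow> d \<bullet> nrm \<psi> \<le> 0)"

lemma adm_0 [simp]: "adm s t 0"
  by (simp add: adm_def)

lemma adm_scale: "adm s t d \<Longrightarrow> 0 \<le> e \<Longrightarrow> adm s t (e *\<^sub>R d)"
  by (simp add: adm_def mult_nonneg_nonpos)

lemma adm_concat: "adm s r d \<Longrightarrow> adm r t e \<Longrightarrow> s \<le> r \<Longrightarrow> r \<le> t \<Longrightarrow> adm s t (d + e)"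
  unfolding adm_def inner_add_left
  by (intro conjI allI impI add_nonneg_nonneg add_nonpos_nonpos) auto

lemma adm_tng:
  assumes "0 \<le> e" "s \<le> r" "r \<le> t"
  shows "adm s t (e *\<^sub>R tng r)"
  unfolding adm_def
proof (intro conjI allI impI)
  fix \<psi> assume "t \<le> \<psi> \<and> \<psi> \<le> s + pi"
  then have "0 \<le> sin (\<psi> - r)" using assms by (intro sin_ge_zero) auto
  then show "0 \<le> (e *\<^sub>R tng r) \<bullet> nrm \<psi>" using assms by (simp add: tng_inner_nrm)
next
  fix \<psi> assume "t - pi \<le> \<psi> \<and> \<psi> \<le> s"
  then have "0 \<le> sin (r - \<psi>)" using assms by (intro sin_ge_zero) auto
  then have "sin (\<psi> - r) \<le> 0" using sin_minus[of "r - \<psi>"] by simp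
  then show "(e *\<^sub>R tng r) \<bullet> nrm \<psi> \<le> 0" using assms by (simp add: tng_inner_nrm mult_nonneg_nonpos)
qed

lemma adm_shift [simp]: "adm (s + 2 * pi) (t + 2 * pi) d \<longleftrightarrow> adm s t d"
proof -
  have "adm (s + 2 * pi) (t + 2 * pi) d" if "adm s t d" for s t
    unfolding adm_def
  proof (intro conjI allI impI)
    fix \<psi> assume "t + 2 * pi \<le> \<psi> \<and> \<psi> \<le> s + 2 * pi + pi"
    then have "0 \<le> d \<bullet> nrm (\<psi> - 2 * pi)" using that unfolding adm_def by auto
    then show "0 \<le> d \<bullet> nrm \<psi>" using nrm_periodic[of "\<psi> - 2 * pi"] by simp
  next
    fix \<psi> assume "t + 2 * pi - pi \<le> \<psi> \<and> \<psi> \<le> s + 2 * pi"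
    then have "d \<bullet> nrm (\<psi> - 2 * pi) \<le> 0" using that unfolding adm_def by auto
    then show "d \<bullet> nrm \<psi> \<le> 0" using nrm_periodic[of "\<psi> - 2 * pi"] by simp
  qed
  moreover have "adm s t d" if "adm (s + 2 * pi) (t + 2 * pi) d"
    unfolding adm_def
  proof (intro conjI allI impI)
    fix \<psi> assume "t \<le> \<psi> \<and> \<psi> \<le> s + pi"
    then have "t + 2 * pi \<le> \<psi> + 2 * pi \<and> \<psi> + 2 * pi \<le> s + 2 * pi + pi" by simp
    then have "0 \<le> d \<bullet> nrm (\<psi> + 2 * pi)" using that unfolding adm_def by blast
    then show "0 \<le> d \<bullet> nrm \<psi>" by simp
  next
    fix \<psi> assume "t - pi \<le> \<psi> \<and> \<psi> \<le> s"
    then have "t + 2 * pi - pi \<le> \<psi> + 2 * pi \<and> \<psi> + 2 * pi \<le> s + 2 * pi" by simp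
    then have "d \<bullet> nrm (\<psi> + 2 * pi) \<le> 0" using that unfolding adm_def by blast
    then show "d \<bullet> nrm \<psi> \<le> 0" by simp
  qed
  ultimately show ?thesis by blast
qed

lemma adm_of_two_normals:
  assumes "0 \<le> d \<bullet> nrm t" "d \<bullet> nrm s \<le> 0" "s < t" "t < s + pi"
  shows "adm s t d"
  unfolding adm_def
proof (intro conjI allI impI)
  have pos: "0 < sin (t - s)" using assms by (intro sin_gt_zero) auto
  fix \<psi>
  have id: "sin (t - s) * (d \<bullet> nrm \<psi>) = sin (t - \<psi>) * (d \<bullet> nrm s) + sin (\<psi> - s) * (d \<bullet> nrm t)"
    by (rule inner_nrm_three)
  {
    assume "t \<le> \<psi> \<and> \<psi> \<le> s + pi"
    then have "0 \<le> sin (\<psi> - t)" "0 \<le> sin (\<psi> - s)" using assms by (auto intro!: sin_ge_zero)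
    then have "0 \<le> sin (t - s) * (d \<bullet> nrm \<psi>)"
      unfolding id using assms sin_minus[of "\<psi> - t"]
      by (intro add_nonneg_nonneg) (auto simp: mult_nonneg_nonneg mult_nonneg_nonpos)
    then show "0 \<le> d \<bullet> nrm \<psi>" using pos by (simp add: zero_le_mult_iff)
  next
    assume "t - pi \<le> \<psi> \<and> \<psi> \<le> s"
    then have "0 \<le> sin (t - \<psi>)" "0 \<le> sin (s - \<psi>)" using assms by (auto intro!: sin_ge_zero)
    then have "sin (t - s) * (d \<bullet> nrm \<psi>) \<le> 0"
      unfolding id using assms sin_minus[of "s - \<psi>"]
      by (intro add_nonpos_nonpos) (auto simp: mult_nonneg_nonpos mult_nonpos_nonneg)
    then show "d \<bullet> nrm \<psi> \<le> 0" using pos by (simp add: mult_le_0_iff)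
  }
qed

lemma turning_adm:
  assumes "turning a b x" "s \<le> t" "t \<le> s + pi"
  shows "adm s t (x t - x s)"
proof -
  have 1: "0 \<le> (x t - x s) \<bullet> nrm t" "(x t - x s) \<bullet> nrm s \<le> 0"
    using assms unfolding turning_def by (auto simp: inner_diff_left)
  consider "s = t" | "t = s + pi" | "s < t" "t < s + pi" using assms by linarith
  then show ?thesis
  proof cases
    case 2
    have "\<psi> = t" if "t \<le> \<psi> \<and> \<psi> \<le> s + pi" for \<psi> using that 2 by simp
    moreover have "\<psi> = s" if "t - pi \<le> \<psi> \<and> \<psi> \<le> s" for \<psi> using that 2 by simp
    ultimately show ?thesis using 1 unfolding adm_def by blast
  qed (use 1 adm_of_two_normals in auto)
qed

definition adm_on :: "real \<Rightarrow> real \<Rightarrow> (real \<Rightarrow> real^2) \<Rightarrow> bool" where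
  "adm_on l r y \<longleftrightarrow> (\<forall>s t. l \<le> s \<and> s \<le> t \<and> t \<le> r \<and> t \<le> s + pi \<longrightarrow> adm s t (y t - y s))"

lemma adm_on_join:
  assumes "adm_on l r y" "adm_on r q y"
  shows "adm_on l q y"
  unfolding adm_on_def
proof (intro allI impI)
  fix s t assume st: "l \<le> s \<and> s \<le> t \<and> t \<le> q \<and> t \<le> s + pi"
  show "adm s t (y t - y s)"
  proof (cases "r \<le> s \<or> t \<le> r")
    case True
    then show ?thesis using assms st unfolding adm_on_def by auto
  next
    case False
    then have "adm s r (y r - y s)" "adm r t (y t - y r)"
      using assms st unfolding adm_on_def by auto
    from adm_concat[OF this] False show ?thesis by simp
  qed
qed

lemma adm_on_cong: "adm_on l r y \<Longrightarrow> (\<And>t. l \<le> t \<Longrightarrow> t \<le> r \<Longrightarrow> y' t = y t) \<Longrightarrow> adm_on l r y'"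
  unfolding adm_on_def by (metis order_trans)

lemma turning_adm_on: "turning a b x \<Longrightarrow> adm_on l r x"
  unfolding adm_on_def using turning_adm by blast

lemma adm_on_scale:
  assumes "adm_on l r x" "0 \<le> e" and y: "\<And>t. l \<le> t \<Longrightarrow> t \<le> r \<Longrightarrow> y t = e *\<^sub>R x t + v"
  shows "adm_on l r y"
  unfolding adm_on_def
proof (intro allI impI)
  fix s t assume st: "l \<le> s \<and> s \<le> t \<and> t \<le> r \<and> t \<le> s + pi"
  then have "adm s t (e *\<^sub>R (x t - x s))"
    using assms adm_scale unfolding adm_on_def by blast
  then show "adm s t (y t - y s)" using y st by (simp add: scaleR_diff_right)
qed

text \<open>The periodic function that agrees with \<open>y\<close> on the period starting at \<open>c\<close>.\<close>

definition periodize :: "real \<Rightarrow> (real \<Rightarrow> 'a) \<Rightarrow> real \<Rightarrow> 'a" where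
  "periodize c y t = y (t - 2 * pi * of_int \<lfloor>(t - c) / (2 * pi)\<rfloor>)"

lemma periodize_eq:
  assumes "c \<le> t" "t < c + 2 * pi"
  shows "periodize c y t = y t"
proof -
  have "\<lfloor>(t - c) / (2 * pi)\<rfloor> = 0"
    using assms by (simp add: floor_eq_iff field_simps)
  then show ?thesis by (simp add: periodize_def)
qed

lemma periodize_periodic: "periodize c y (t + 2 * pi) = periodize c y t"
proof -
  have "(t + 2 * pi - c) / (2 * pi) = (t - c) / (2 * pi) + 1" by (simp add: field_simps)
  then have "\<lfloor>(t + 2 * pi - c) / (2 * pi)\<rfloor> = \<lfloor>(t - c) / (2 * pi)\<rfloor> + 1" by linarith
  then show ?thesis by (simp add: periodize_def algebra_simps)
qed

lemma periodic_shift_int: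
  assumes "\<And>t::real. f (t + 2 * pi) = f t"
  shows "f (t + 2 * pi * of_int k) = f t"
proof -
  have n: "f (s + 2 * pi * real n) = f s" for s n
  proof (induction n)
    case (Suc n)
    then show ?case using assms[of "s + 2 * pi * real n"] by (simp add: algebra_simps)
  qed simp
  show ?thesis
  proof (cases "k \<ge> 0")
    case True
    then show ?thesis using n[of t "nat k"] by simp
  next
    case False
    then have "real (nat (- k)) = - of_int k" by simp
    then show ?thesis using n[of "t + 2 * pi * of_int k" "nat (- k)"] by (simp add: algebra_simps)
  qed
qed

lemma exists_shift_into_period:
  obtains k :: int where "c \<le> t - 2 * pi * of_int k" "t - 2 * pi * of_int k < c + 2 * pi"
proof
  define k where "k = \<lfloor>(t - c) / (2 * pi)\<rfloor>"
  have k: "of_int k \<le> (t - c) / (2 * pi)" "(t - c) / (2 * pi) < of_int k + 1"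
    unfolding k_def by linarith+
  show "c \<le> t - 2 * pi * of_int \<lfloor>(t - c) / (2 * pi)\<rfloor>"
       "t - 2 * pi * of_int \<lfloor>(t - c) / (2 * pi)\<rfloor> < c + 2 * pi"
    using k pi_gt_zero unfolding k_def [symmetric] by (simp_all add: field_simps)
qed

text \<open>Admissible increments over one period already make a turning curve, because any two angles
  can be brought within distance \<open>\<pi>\<close> of each other.\<close>

lemma turning_periodize:
  assumes adm: "adm_on c (c + 2 * pi) y" and closed: "y (c + 2 * pi) = y c"
    and bounds: "\<And>t. c \<le> t \<Longrightarrow> t \<le> c + 2 * pi \<Longrightarrow> a \<le> y t \<bullet> nrm t \<and> y t \<bullet> nrm t \<le> b"
  shows "turning a b (periodize c y)"
proof -
  let ?x = "periodize c y"
  have per: "?x (t + 2 * pi) = ?x t" for t by (rule periodize_periodic)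
  have on1: "adm_on c (c + 2 * pi) ?x"
  proof (rule adm_on_cong[OF adm])
    fix t assume "c \<le> t" "t \<le> c + 2 * pi"
    then show "?x t = y t"
      using periodize_eq[of c t y] periodize_eq[of c c y] per[of c] closed
      by (cases "t = c + 2 * pi") auto
  qed
  have on2: "adm_on (c + 2 * pi) (c + 2 * pi + 2 * pi) ?x"
    unfolding adm_on_def
  proof (intro allI impI)
    fix s t assume st: "c + 2 * pi \<le> s \<and> s \<le> t \<and> t \<le> c + 2 * pi + 2 * pi \<and> t \<le> s + pi"
    then have "adm (s - 2 * pi) (t - 2 * pi) (?x (t - 2 * pi) - ?x (s - 2 * pi))"
      using on1 unfolding adm_on_def by simp
    then show "adm s t (?x t - ?x s)"
      using adm_shift[of "s - 2 * pi" "t - 2 * pi"] per[of "s - 2 * pi"] per[of "t - 2 * pi"] by simp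
  qed
  have on: "adm_on c (c + 2 * pi + 2 * pi) ?x"
    using adm_on_join[OF on1 on2] .
  have pi2: "?x (t + 2 * pi * of_int k) = ?x t" "nrm (t + 2 * pi * of_int k) = nrm t" for t k
    by (rule periodic_shift_int, simp add: per)+
  have main: "?x s \<bullet> nrm t \<le> ?x t \<bullet> nrm t" for s t
  proof -
    have *: "?x s \<bullet> nrm t \<le> ?x t \<bullet> nrm t" if t: "c + pi \<le> t" "t < c + pi + 2 * pi"
      and s: "t - pi \<le> s" "s < t - pi + 2 * pi" for s t
    proof (cases "s \<le> t")
      case True
      then have "adm s t (?x t - ?x s)"
        using on t s unfolding adm_on_def by simp
      then show ?thesis using True t s unfolding adm_def by (simp add: inner_diff_left)
    next
      case False
      then have "adm t s (?x s - ?x t)"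
        using on t s unfolding adm_on_def by simp
      then show ?thesis using False t s unfolding adm_def by (simp add: inner_diff_left)
    qed
    obtain k where k: "c + pi \<le> t - 2 * pi * of_int k" "t - 2 * pi * of_int k < c + pi + 2 * pi"
      by (rule exists_shift_into_period)
    define t' where "t' = t - 2 * pi * of_int k"
    obtain j where j: "t' - pi \<le> s - 2 * pi * of_int j" "s - 2 * pi * of_int j < t' - pi + 2 * pi"
      by (rule exists_shift_into_period)
    have "?x (s - 2 * pi * of_int j) \<bullet> nrm t' \<le> ?x t' \<bullet> nrm t'"
      using * k j unfolding t'_def by simp
    then show ?thesis
      using pi2[of "s - 2 * pi * of_int j" j] pi2[of t' k] by (simp add: t'_def)
  qed
  moreover have "a \<le> ?x t \<bullet> nrm t \<and> ?x t \<bullet> nrm t \<le> b" for t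
  proof -
    obtain k where k: "c \<le> t - 2 * pi * of_int k" "t - 2 * pi * of_int k < c + 2 * pi"
      by (rule exists_shift_into_period)
    then show ?thesis
      using bounds[of "t - 2 * pi * of_int k"] periodize_eq[of c "t - 2 * pi * of_int k" y]
        pi2[of "t - 2 * pi * of_int k" k] by simp
  qed
  ultimately show ?thesis using per unfolding turning_def by blast
qed

section \<open>Support function and tangential coordinate\<close>

abbreviation supp :: "(real \<Rightarrow> real^2) \<Rightarrow> real \<Rightarrow> real" where "supp x t \<equiv> x t \<bullet> nrm t"

abbreviation tco :: "(real \<Rightarrow> real^2) \<Rightarrow> real \<Rightarrow> real" where "tco x t \<equiv> x t \<bullet> tng t"

definition arcm :: "real \<Rightarrow> (real \<Rightarrow> real^2) \<Rightarrow> real \<Rightarrow> real" where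
  "arcm b x t = tco x t + 2 * b * t"

context
  fixes a b :: real and x :: "real \<Rightarrow> real^2"
  assumes T: "turning a b x" and a0: "0 < a"
begin

lemma b_pos: "0 < b"
  using turningD(3,4)[OF T, of 0] a0 by linarith

lemma abs_supp_le: "\<bar>supp x t\<bar> \<le> b" and abs_tco_le: "\<bar>tco x t\<bar> \<le> b"
  using abs_inner_nrm_le[of "x t" t] abs_inner_tng_le[of "x t" t] turning_norm_le[OF T, of t] by auto

lemma supp_pos: "0 < supp x t"
  using turningD(3)[OF T, of t] a0 by linarith

lemma tco_sq_le: "(tco x t)\<^sup>2 \<le> b\<^sup>2 - (supp x t)\<^sup>2"
proof -
  have "(norm (x t))\<^sup>2 \<le> b\<^sup>2"
    using turning_norm_le[OF T, of t] by (intro power_mono) auto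
  then show ?thesis using norm_frame[of "x t" t] by linarith
qed

lemma supp_ge: "supp x s * cos (t - s) + tco x s * sin (t - s) \<le> supp x t"
  using turningD(2)[OF T, of s t] inner_nrm_rotate[of "x s" t s] by simp

lemma supp_ge': "supp x t * cos (t - s) - tco x t * sin (t - s) \<le> supp x s"
  using supp_ge[of t s] cos_minus[of "t - s"] sin_minus[of "t - s"] by simp

lemma supp_lipschitz: "\<bar>supp x t - supp x s\<bar> \<le> b * \<bar>t - s\<bar>"
proof -
  have *: "supp x s - supp x t \<le> b * \<bar>t - s\<bar>" for s t
  proof -
    have "\<bar>x s \<bullet> (nrm s - nrm t)\<bar> \<le> norm (x s) * norm (nrm s - nrm t)"
      by (rule Cauchy_Schwarz_ineq2)
    also have "\<dots> \<le> b * \<bar>s - t\<bar>"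
      by (intro mult_mono norm_nrm_diff turning_norm_le[OF T]) (use b_pos in auto)
    finally show ?thesis
      using turningD(2)[OF T, of s t] by (simp add: inner_diff_right abs_minus_commute)
  qed
  show ?thesis using *[of s t] *[of t s] by (simp add: abs_le_iff abs_minus_commute)
qed

lemma continuous_supp: "continuous_on S (supp x)"
proof (rule continuous_on_subset[OF _ subset_UNIV])
  have "b-lipschitz_on UNIV (supp x)"
    using supp_lipschitz b_pos by (intro lipschitz_onI) (auto simp: dist_real_def)
  then show "continuous_on UNIV (supp x)" by (rule lipschitz_on_continuous_on)
qed

lemma supp_sum_ge:
  "0 \<le> (supp x s + supp x t) * (1 - cos (t - s)) + (tco x t - tco x s) * sin (t - s)"
  using supp_ge[of s t] supp_ge'[of t s] by (simp add: algebra_simps)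

text \<open>Adding the two support inequalities between \<open>s\<close> and \<open>t\<close> bounds how fast \<open>tco\<close> can decrease.  Thus \<open>tco\<close> is a difference of
  monotone functions, which makes it measurable and bounds its oscillation by increments of \<open>arcm\<close>.\<close>

lemma arcm_mono:
  assumes "s \<le> t"
  shows "arcm b x s \<le> arcm b x t"
proof (cases "t - s \<ge> 1")
  case True
  then have "2 * b * 1 \<le> 2 * b * (t - s)" using b_pos by (intro mult_left_mono) auto
  then show ?thesis
    using abs_tco_le[of s] abs_tco_le[of t] unfolding arcm_def abs_le_iff by (simp add: algebra_simps)
next
  case False
  show ?thesis
  proof (cases "s = t")
    case neq: False
    define h where "h = t - s"
    have h: "0 < h" "h < 1" using assms neq False by (auto simp: h_def)
    have hh: "h * h \<le> h * 1" using h by (intro mult_left_mono) auto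
    have sh: "h / 2 \<le> sin h" using sin_ge[of h] h hh unfolding power2_eq_square by linarith
    have "(supp x s + supp x t) * (1 - cos h) \<le> (2 * b) * (h\<^sup>2 / 2)"
      using abs_supp_le[of s] abs_supp_le[of t] supp_pos[of s] supp_pos[of t]
      by (intro mult_mono one_minus_cos_le) auto
    also have "\<dots> \<le> 2 * b * (h * sin h)"
    proof -
      have "h * (h / 2) \<le> h * sin h" using sh h by (intro mult_left_mono) auto
      then show ?thesis using b_pos by (intro mult_left_mono) (auto simp: power2_eq_square)
    qed
    finally have "0 \<le> (2 * b * h + (tco x t - tco x s)) * sin h"
      using supp_sum_ge[of s t] unfolding h_def by (simp add: algebra_simps)
    then have "0 \<le> 2 * b * h + (tco x t - tco x s)"
      using sh h by (simp add: zero_le_mult_iff)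
    then show ?thesis by (simp add: arcm_def h_def algebra_simps)
  qed simp
qed

lemma tco_diff_le:
  assumes "s \<le> r" "r \<le> t"
  shows "\<bar>tco x t - tco x r\<bar> \<le> (arcm b x t - arcm b x s) + 2 * b * (t - s)"
proof -
  have "b * (t - r) \<le> b * (t - s)" using assms b_pos by (intro mult_left_mono) auto
  moreover have "0 \<le> b * (t - r)" using assms b_pos by simp
  ultimately show ?thesis
    using arcm_mono[OF assms(1)] arcm_mono[OF assms(2)]
    unfolding arcm_def abs_le_iff by (simp add: algebra_simps)
qed

lemma borel_supp [measurable]: "supp x \<in> borel_measurable borel"
  by (intro borel_measurable_continuous_onI continuous_supp)

lemma borel_tco [measurable]: "tco x \<in> borel_measurable borel"
proof -
  have "arcm b x \<in> borel_measurable borel"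
    by (intro borel_measurable_mono monoI arcm_mono)
  then have "(\<lambda>t. arcm b x t - 2 * b * t) \<in> borel_measurable borel" by measurable
  then show ?thesis by (simp add: arcm_def)
qed

lemma integrable_supp: "supp x integrable_on {s..t}"
  by (intro integrable_continuous_real continuous_supp)

lemma integrable_tco: "tco x integrable_on {s..t}"
  by (rule integrable_bounded_borel[OF borel_tco abs_tco_le])

lemma integrable_quadr: "(\<lambda>t. (supp x t)\<^sup>2 - (tco x t)\<^sup>2) integrable_on {s..t}"
proof (rule integrable_bounded_borel)
  show "\<bar>(supp x t)\<^sup>2 - (tco x t)\<^sup>2\<bar> \<le> b\<^sup>2" for t
    using tco_sq_le[of t] by (smt (verit) zero_le_power2)
qed measurable

text \<open>Between close angles both sides lie between \<open>tco x s\<close> and \<open>tco x t\<close> times the length of the interval, up to second order, so they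
  differ by at most a constant times \<open>h (h + arcm b x t - arcm b x s)\<close>, where \<open>h = t - s\<close>.\<close>

lemma supp_increment_eq_integral:
  assumes "l \<le> r"
  shows "supp x r - supp x l = integral {l..r} (tco x)"
proof -
  define F where "F t = supp x t - integral {l..t} (tco x)" for t
  have inc: "\<bar>F t - F s\<bar> \<le> (1 + 3 * b) * ((t - s) * ((t - s) + (arcm b x t - arcm b x s)))"
    if st: "l \<le> s" "s \<le> t" "t \<le> r" "t \<le> s + 1" for s t
  proof -
    define h where "h = t - s"
    have h: "0 \<le> h" "h \<le> 1" using st by (auto simp: h_def)
    have split: "integral {l..t} (tco x) = integral {l..s} (tco x) + integral {s..t} (tco x)"
      using Henstock_Kurzweil_Integration.integral_combine[OF st(1,2) integrable_tco] by simp
    have up: "integral {s..t} (tco x) \<le> (tco x t + 2 * b * h) * h"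
    proof -
      have "tco x r \<le> tco x t + 2 * b * h" if r: "s \<le> r" "r \<le> t" for r
      proof -
        have "b * (t - r) \<le> b * h" using r b_pos by (simp add: h_def)
        then show ?thesis using arcm_mono[OF r(2)] by (simp add: arcm_def algebra_simps)
      qed
      from integral_le_const[OF integrable_tco st(2) this] show ?thesis by (simp add: h_def)
    qed
    have lo: "(tco x s - 2 * b * h) * h \<le> integral {s..t} (tco x)"
    proof -
      have "tco x s - 2 * b * h \<le> tco x r" if r: "s \<le> r" "r \<le> t" for r
      proof -
        have "b * (r - s) \<le> b * h" using r b_pos by (simp add: h_def)
        then show ?thesis using arcm_mono[OF r(1)] by (simp add: arcm_def algebra_simps)
      qed
      from integral_ge_const[OF integrable_tco st(2) this] show ?thesis by (simp add: h_def)
    qed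
    have c: "q * (1 - cos h) \<le> b * (h\<^sup>2 / 2)" if "0 < q" "q \<le> b" for q
      using that b_pos one_minus_cos_le[of h] by (intro mult_mono) auto
    have sn: "q * h - q * sin h \<le> b * (h\<^sup>2 / 2)" "q * sin h - q * h \<le> b * (h\<^sup>2 / 2)" if "\<bar>q\<bar> \<le> b" for q
    proof -
      have "\<bar>q * (h - sin h)\<bar> \<le> b * (h\<^sup>2 / 2)"
        unfolding abs_mult using that b_pos sin_ge[OF h] sin_x_le_x[OF h(1)]
        by (intro mult_mono) (auto simp: abs_le_iff)
      then show "q * h - q * sin h \<le> b * (h\<^sup>2 / 2)" "q * sin h - q * h \<le> b * (h\<^sup>2 / 2)"
        unfolding right_diff_distrib by linarith+
    qed
    have 1: "tco x s * h - b * h\<^sup>2 \<le> supp x t - supp x s"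
      using supp_ge[of s t] c[of "supp x s"] sn[of "tco x s"] abs_supp_le[of s] supp_pos[of s] abs_tco_le[of s]
      unfolding h_def[symmetric] by (simp add: algebra_simps abs_le_iff)
    have 2: "supp x t - supp x s \<le> tco x t * h + b * h\<^sup>2"
      using supp_ge'[of t s] c[of "supp x t"] sn[of "tco x t"] abs_supp_le[of t] supp_pos[of t] abs_tco_le[of t]
      unfolding h_def[symmetric] by (simp add: algebra_simps abs_le_iff)
    let ?D = "h * ((tco x t - tco x s) + 3 * b * h)"
    have "\<bar>F t - F s\<bar> \<le> ?D"
      unfolding F_def split abs_le_iff using 1 2 up lo by (simp add: algebra_simps power2_eq_square)
    also have "?D = h * ((arcm b x t - arcm b x s) + b * h)"
      by (simp add: arcm_def h_def algebra_simps)
    also have "\<dots> \<le> h * ((1 + 3 * b) * (h + (arcm b x t - arcm b x s)))"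
    proof (rule mult_left_mono[OF _ h(1)])
      have "0 \<le> b * h" "0 \<le> b * (arcm b x t - arcm b x s)" using b_pos h arcm_mono[OF st(2)] by auto
      then show "(arcm b x t - arcm b x s) + b * h \<le> (1 + 3 * b) * (h + (arcm b x t - arcm b x s))"
        using h by (simp add: algebra_simps)
    qed
    finally show ?thesis by (simp add: h_def algebra_simps)
  qed
  have "F l \<le> F r"
  proof (rule increment_ge[OF assms zero_less_one])
    fix s t assume "l \<le> s" "s \<le> t" "t \<le> r" "t \<le> s + 1"
    from inc[OF this] show "- (1 + 3 * b) * ((t - s) * ((t - s) + (arcm b x t - arcm b x s))) \<le> F t - F s"
      unfolding mult_minus_left by linarith
  qed
  moreover have "- F l \<le> - F r"
  proof (rule increment_ge[OF assms zero_less_one])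
    fix s t assume "l \<le> s" "s \<le> t" "t \<le> r" "t \<le> s + 1"
    from inc[OF this] show "- (1 + 3 * b) * ((t - s) * ((t - s) + (arcm b x t - arcm b x s))) \<le> - F t - - F s"
      unfolding mult_minus_left by linarith
  qed
  ultimately show ?thesis by (simp add: F_def)
qed

text \<open>Twice the area swept by the segment from the origin to \<open>x\<close> between two normal angles: the integral of the
  support function against arc length, after an integration by parts.\<close>

definition sweep :: "real \<Rightarrow> real \<Rightarrow> real" where
  "sweep s t = integral {s..t} (\<lambda>r. (supp x r)\<^sup>2 - (tco x r)\<^sup>2) + supp x t * tco x t - supp x s * tco x s"

lemma sweep_add: "l \<le> s \<Longrightarrow> s \<le> t \<Longrightarrow> sweep l t = sweep l s + sweep s t"
  using Henstock_Kurzweil_Integration.integral_combine[OF _ _ integrable_quadr] by (simp add: sweep_def)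

lemma sweep_approx:
  assumes st: "s \<le> t"
  shows "\<bar>sweep s t - supp x s * ((tco x t - tco x s) + supp x s * (t - s))\<bar>
     \<le> (6 * b\<^sup>2 + b) * ((t - s) * ((t - s) + (arcm b x t - arcm b x s)))"
proof -
  define h where "h = t - s"
  have h: "0 \<le> h" using st by (simp add: h_def)
  let ?f = "\<lambda>r. ((supp x r)\<^sup>2 - (tco x r)\<^sup>2) - (supp x s)\<^sup>2 + tco x t * tco x r"
  let ?D = "(6 * b\<^sup>2 + b) * (h + (arcm b x t - arcm b x s))"
  have int: "?f integrable_on {s..t}"
    by (intro integrable_add integrable_diff integrable_quadr integrable_const_ivl integrable_on_mult_right integrable_tco)
  have "((\<lambda>_. (supp x s)\<^sup>2) has_integral (supp x s)\<^sup>2 * h) {s..t}"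
    using has_integral_const_real[of "(supp x s)\<^sup>2" s t] st by (simp add: h_def mult.commute)
  then have "(?f has_integral (integral {s..t} (\<lambda>r. (supp x r)\<^sup>2 - (tco x r)\<^sup>2) - (supp x s)\<^sup>2 * h
      + tco x t * integral {s..t} (tco x))) {s..t}"
    by (intro has_integral_add has_integral_diff has_integral_mult_right integrable_integral
        integrable_quadr integrable_tco)
  then have "integral {s..t} ?f = integral {s..t} (\<lambda>r. (supp x r)\<^sup>2 - (tco x r)\<^sup>2) - (supp x s)\<^sup>2 * h
      + tco x t * integral {s..t} (tco x)" by (rule integral_unique)
  also have "integral {s..t} (tco x) = supp x t - supp x s"
    using supp_increment_eq_integral[OF st] by simp
  finally have eq: "sweep s t - supp x s * ((tco x t - tco x s) + supp x s * h) = integral {s..t} ?f"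
    by (simp add: sweep_def algebra_simps power2_eq_square)
  have bd: "\<bar>?f r\<bar> \<le> ?D" if r: "s \<le> r" "r \<le> t" for r
  proof -
    have "\<bar>supp x r - supp x s\<bar> \<le> b * h"
    proof -
      have "b * (r - s) \<le> b * h" using r b_pos by (simp add: h_def)
      then show ?thesis using supp_lipschitz[of r s] r by simp
    qed
    moreover have "\<bar>supp x r + supp x s\<bar> \<le> 2 * b"
      using abs_supp_le[of r] abs_supp_le[of s] by linarith
    ultimately have "\<bar>(supp x r - supp x s) * (supp x r + supp x s)\<bar> \<le> (b * h) * (2 * b)"
      unfolding abs_mult using b_pos h by (intro mult_mono) auto
    moreover have "\<bar>tco x r * (tco x t - tco x r)\<bar> \<le> b * ((arcm b x t - arcm b x s) + 2 * b * h)"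
      unfolding abs_mult h_def using tco_diff_le[OF r] abs_tco_le[of r] b_pos by (intro mult_mono) auto
    moreover have "?f r = (supp x r - supp x s) * (supp x r + supp x s) + tco x r * (tco x t - tco x r)"
      by (simp add: algebra_simps power2_eq_square)
    ultimately have "\<bar>?f r\<bar> \<le> (b * h) * (2 * b) + b * ((arcm b x t - arcm b x s) + 2 * b * h)"
      by linarith
    also have "\<dots> = 4 * b\<^sup>2 * h + b * (arcm b x t - arcm b x s)"
      by (simp add: algebra_simps power2_eq_square)
    also have "\<dots> \<le> ?D"
    proof -
      have "0 \<le> b\<^sup>2 * h" "0 \<le> b * h" "0 \<le> b\<^sup>2 * (arcm b x t - arcm b x s)"
        using b_pos h arcm_mono[OF st] by auto
      then show ?thesis by (simp add: algebra_simps)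
    qed
    finally show ?thesis .
  qed
  have "?f r \<le> ?D \<and> - ?D \<le> ?f r" if "s \<le> r" "r \<le> t" for r
    using bd[OF that] unfolding abs_le_iff by linarith
  then have "integral {s..t} ?f \<le> ?D * (t - s)" "- ?D * (t - s) \<le> integral {s..t} ?f"
    by (blast intro: integral_le_const[OF int st] integral_ge_const[OF int st])+
  then have "\<bar>integral {s..t} ?f\<bar> \<le> ?D * h"
    unfolding abs_le_iff mult_minus_left h_def by linarith
  then show ?thesis
    unfolding eq[symmetric] unfolding h_def by (simp only: mult_ac)
qed

text \<open>The boundary between two normals has length about \<open>tco x t - tco x s + supp x s * (t - s)\<close>, which can be negative only
  through the error of this approximation.\<close>

lemma side_ge:
  assumes "s \<le> t" "t \<le> s + 1"
  shows "- (2 * b + 1) * ((t - s) * ((t - s) + (arcm b x t - arcm b x s)))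
    \<le> (tco x t - tco x s) + supp x s * (t - s)"
proof (cases "s = t")
  case False
  note b = b_pos and mono = arcm_mono[OF assms(1)]
  define h where "h = t - s"
  define dm where "dm = tco x t - tco x s"
  define dg where "dg = arcm b x t - arcm b x s"
  have h: "0 < h" "h \<le> 1" using assms False by (auto simp: h_def)
  have dg: "0 \<le> dg" using mono by (simp add: dg_def)
  have "supp x s + supp x t \<le> 2 * supp x s + b * h"
    using supp_lipschitz[of t s] h by (simp add: h_def)
  moreover have "0 \<le> 2 * supp x s + b * h" using supp_pos[of s] b h by simp
  ultimately have "(supp x s + supp x t) * (1 - cos h) \<le> (2 * supp x s + b * h) * (h\<^sup>2 / 2)"
    using one_minus_cos_le[of h] by (intro mult_mono) auto
  then have 1: "- ((2 * supp x s + b * h) * (h\<^sup>2 / 2)) \<le> dm * sin h"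
    using supp_sum_ge[of s t] unfolding h_def dm_def by linarith
  have "\<bar>dm\<bar> \<le> dg + 2 * b * h"
    using tco_diff_le[of s s t] assms by (simp add: dm_def dg_def h_def)
  then have "\<bar>dm * (h - sin h)\<bar> \<le> (dg + 2 * b * h) * (h\<^sup>2 / 2)"
    unfolding abs_mult using sin_ge[of h] sin_x_le_x[of h] h by (intro mult_mono) auto
  then have 2: "- ((dg + 2 * b * h) * (h\<^sup>2 / 2)) \<le> dm * h - dm * sin h"
    unfolding right_diff_distrib by linarith
  have "- h * (h * (3 / 2 * b * h + dg / 2)) \<le> h * (dm + supp x s * h)"
    using 1 2 by (simp add: algebra_simps power2_eq_square)
  then have "- (h * (3 / 2 * b * h + dg / 2)) \<le> dm + supp x s * h"
    using h by (metis minus_mult_left minus_mult_right mult_le_cancel_left_pos)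
  moreover have "h * (3 / 2 * b * h + dg / 2) \<le> h * ((2 * b + 1) * (h + dg))"
  proof (rule mult_left_mono)
    have "0 \<le> b * h" "0 \<le> b * dg" using b h dg by auto
    then show "3 / 2 * b * h + dg / 2 \<le> (2 * b + 1) * (h + dg)" using h dg by (simp add: algebra_simps)
  qed (use h in simp)
  ultimately show ?thesis
    unfolding h_def[symmetric] dm_def[symmetric] dg_def[symmetric] mult_minus_left
    by (simp add: mult_ac)
qed simp

lemma supp_integral_approx:
  assumes "s \<le> t"
  shows "\<bar>integral {s..t} (supp x) - supp x s * (t - s)\<bar> \<le> b * (t - s)\<^sup>2"
proof -
  have *: "\<bar>supp x r - supp x s\<bar> \<le> b * (t - s)" if "s \<le> r" "r \<le> t" for r
  proof -
    have "b * (r - s) \<le> b * (t - s)" using that b_pos by simp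
    then show ?thesis using supp_lipschitz[of r s] that by simp
  qed
  have "supp x r \<le> supp x s + b * (t - s) \<and> supp x s - b * (t - s) \<le> supp x r" if "s \<le> r" "r \<le> t" for r
    using *[OF that] unfolding abs_le_iff by linarith
  then have "integral {s..t} (supp x) \<le> (supp x s + b * (t - s)) * (t - s)"
    "(supp x s - b * (t - s)) * (t - s) \<le> integral {s..t} (supp x)"
    by (blast intro: integral_le_const[OF integrable_supp assms]
        integral_ge_const[OF integrable_supp assms])+
  then show ?thesis
    unfolding abs_le_iff by (simp add: algebra_simps power2_eq_square)
qed

text \<open>Every supporting line has distance at least \<open>a\<close> from the origin, so the triangles with apex at the origin over small pieces of the
  boundary have height at least \<open>a\<close>.\<close>

lemma sweep_ge_length:
  assumes "l \<le> r"
  shows "a * (tco x r - tco x l + integral {l..r} (supp x)) \<le> sweep l r"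
proof -
  note b = b_pos
  define F where "F t = sweep l t - a * (tco x t + integral {l..t} (supp x))" for t
  define C where "C = (6 * b\<^sup>2 + b) + b * (2 * b + 1) + b * b"
  have "F l \<le> F r"
  proof (rule increment_ge[OF assms zero_less_one])
    fix s t assume st: "l \<le> s" "s \<le> t" "t \<le> r" "t \<le> s + 1"
    define h where "h = t - s"
    define dm where "dm = tco x t - tco x s"
    define dg where "dg = arcm b x t - arcm b x s"
    have h: "0 \<le> h" using st by (simp add: h_def)
    have dg: "0 \<le> dg" using arcm_mono[OF st(2)] by (simp add: dg_def)
    have "integral {l..t} (supp x) = integral {l..s} (supp x) + integral {s..t} (supp x)"
      using Henstock_Kurzweil_Integration.integral_combine[OF st(1,2) integrable_supp] by simp
    then have F: "F t - F s = sweep s t - a * (dm + integral {s..t} (supp x))"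
      unfolding F_def dm_def sweep_add[OF st(1,2)] by (simp add: algebra_simps)
    have 1: "supp x s * (dm + supp x s * h) - (6 * b\<^sup>2 + b) * (h * (h + dg)) \<le> sweep s t"
      using sweep_approx[OF st(2)] unfolding h_def dm_def dg_def abs_le_iff by linarith
    have "integral {s..t} (supp x) \<le> supp x s * h + b * h\<^sup>2"
      using supp_integral_approx[OF st(2)] unfolding h_def abs_le_iff by linarith
    then have "a * integral {s..t} (supp x) \<le> a * (supp x s * h) + a * (b * h\<^sup>2)"
      using a0 mult_left_mono[of _ _ a] by (fastforce simp: distrib_left)
    moreover have "a * (b * h\<^sup>2) \<le> b * (b * (h * (h + dg)))"
    proof (intro mult_mono)
      show "a \<le> b" using turningD(3,4)[OF T, of 0] by linarith
      show "h\<^sup>2 \<le> h * (h + dg)" using h dg by (simp add: power2_eq_square algebra_simps)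
    qed (use b h in auto)
    moreover have "- (b * ((2 * b + 1) * (h * (h + dg)))) \<le> (supp x s - a) * (dm + supp x s * h)"
    proof -
      let ?q = "(2 * b + 1) * (h * (h + dg))"
      have "- ?q \<le> dm + supp x s * h"
        using side_ge[OF st(2,4)] unfolding h_def dm_def dg_def mult_minus_left .
      then have "(supp x s - a) * (- ?q) \<le> (supp x s - a) * (dm + supp x s * h)"
        using turningD(3)[OF T, of s] by (intro mult_left_mono) auto
      moreover have "(supp x s - a) * ?q \<le> b * ?q"
        using turningD(4)[OF T, of s] a0 b h dg by (intro mult_right_mono) auto
      ultimately show ?thesis by simp
    qed
    ultimately have "- (C * (h * (h + dg))) \<le> F t - F s"
      unfolding F using 1 unfolding C_def by (simp add: algebra_simps)
    then show "- C * ((t - s) * ((t - s) + (arcm b x t - arcm b x s))) \<le> F t - F s"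
      by (simp add: h_def dg_def)
  qed
  moreover have "sweep l l = 0" by (simp add: sweep_def)
  ultimately show ?thesis by (simp add: F_def algebra_simps)
qed

section \<open>Boundary cells of a mesh of normals\<close>

text \<open>The two supporting lines with normal angles \<open>s < t\<close> meet at the corner
  \<open>x s + sideL s t *\<^sub>R tng s = x t - sideR s t *\<^sub>R tng t\<close>.\<close>

definition sideL :: "real \<Rightarrow> real \<Rightarrow> real" where
  "sideL s t = (supp x t - supp x s * cos (t - s) - tco x s * sin (t - s)) / sin (t - s)"

definition sideR :: "real \<Rightarrow> real \<Rightarrow> real" where
  "sideR s t = (supp x s - supp x t * cos (t - s) + tco x t * sin (t - s)) / sin (t - s)"

lemma sides_nonneg:
  assumes "s < t" "t < s + pi"
  shows "0 \<le> sideL s t" "0 \<le> sideR s t"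
proof -
  have "0 < sin (t - s)" using assms by (intro sin_gt_zero) auto
  then show "0 \<le> sideL s t" "0 \<le> sideR s t"
    unfolding sideL_def sideR_def using supp_ge[of s t] supp_ge'[of t s]
    by (auto intro!: divide_nonneg_nonneg)
qed

lemma sides_le:
  assumes "s < t" "t \<le> s + 1"
  shows "sideL s t + sideR s t \<le> (tco x t - tco x s) + supp x s * (t - s) + 2 * b * (t - s)\<^sup>2"
proof -
  note b = b_pos
  define h where "h = t - s"
  have h: "0 < h" "h \<le> 1" using assms by (auto simp: h_def)
  have hh: "h * h \<le> h" using h mult_left_mono[of h 1 h] by simp
  have hp: "h < pi" using h pi_gt3 by linarith
  then have sh: "0 < sin h" using h by (intro sin_gt_zero)
  have hhh: "h * h * h \<le> h * h" using h mult_left_mono[of h 1 "h * h"] by simp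
  have tan: "1 - cos h \<le> (h / 2 + h\<^sup>2 / 2) * sin h"
  proof -
    have "h * (h * h * h) \<le> h * (h * h)" using hhh h by (intro mult_left_mono) auto
    then have "h\<^sup>2 / 2 \<le> h\<^sup>2 / 2 + (h * (h * h) - h * (h * h * h)) / 4" by simp
    also have "\<dots> = (h / 2 + h\<^sup>2 / 2) * (h - h\<^sup>2 / 2)"
      by (simp add: power2_eq_square field_simps)
    also have "\<dots> \<le> (h / 2 + h\<^sup>2 / 2) * sin h"
      using sin_ge[of h] h by (intro mult_left_mono) auto
    finally have "h\<^sup>2 / 2 \<le> (h / 2 + h\<^sup>2 / 2) * sin h" .
    with one_minus_cos_le[of h] show ?thesis by (rule order_trans)
  qed
  have "supp x s + supp x t \<le> 2 * supp x s + b * h"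
    using supp_lipschitz[of t s] h by (simp add: h_def)
  moreover have "0 < supp x s + supp x t" using supp_pos[of s] supp_pos[of t] by simp
  ultimately have 1: "(supp x s + supp x t) * (1 - cos h)
      \<le> (2 * supp x s + b * h) * ((h / 2 + h\<^sup>2 / 2) * sin h)"
    using tan by (intro mult_mono) auto
  define K where "K = (2 * supp x s + b * h) * (h / 2 + h\<^sup>2 / 2)"
  have "sideL s t * sin h = supp x t - supp x s * cos h - tco x s * sin h"
    "sideR s t * sin h = supp x s - supp x t * cos h + tco x t * sin h"
    unfolding sideL_def sideR_def h_def[symmetric] using sh by simp_all
  moreover have "(supp x s + supp x t) * (1 - cos h) \<le> K * sin h"
    using 1 by (simp only: K_def mult.assoc)
  ultimately have "(sideL s t + sideR s t) * sin h \<le> ((tco x t - tco x s) + K) * sin h"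
    by (simp add: algebra_simps)
  then have "sideL s t + sideR s t \<le> (tco x t - tco x s) + (2 * supp x s + b * h) * (h / 2 + h\<^sup>2 / 2)"
    using sh unfolding K_def by (simp add: mult_le_cancel_right)
  also have "(2 * supp x s + b * h) * (h / 2 + h\<^sup>2 / 2) = supp x s * h + (supp x s * (h * h) + b / 2 * (h * h) + b / 2 * (h * h * h))"
    by (simp add: power2_eq_square field_simps)
  also have "\<dots> \<le> supp x s * h + (b * (h * h) + b / 2 * (h * h) + b / 2 * (h * h))"
  proof -
    have "supp x s * (h * h) \<le> b * (h * h)"
      using turningD(4)[OF T, of s] by (intro mult_right_mono) auto
    moreover have "b / 2 * (h * h * h) \<le> b / 2 * (h * h)"
      using hhh b by (intro mult_left_mono) auto
    ultimately show ?thesis by simp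
  qed
  finally show ?thesis by (simp add: h_def power2_eq_square algebra_simps)
qed

text \<open>The points of the body in the parallelogram spanned by the corner of two supporting lines and its two contact points; it
  contains the boundary arc between these points.\<close>

definition cell :: "real \<Rightarrow> real \<Rightarrow> (real^2) set" where
  "cell s t = {y \<in> body x. x s \<bullet> nrm t \<le> y \<bullet> nrm t \<and> x t \<bullet> nrm s \<le> y \<bullet> nrm s}"

lemma on_support_line:
  assumes "w \<bullet> nrm s = supp x s"
  shows "w = x s + ((w - x s) \<bullet> tng s) *\<^sub>R tng s"
  using frame_decomp[of "w - x s" s] assms by (simp add: inner_diff_left algebra_simps)

text \<open>A ray that starts in a cell and moves away from both half-planes crosses the corner formed by the two
  supporting lines.  Used for outer normals this shows that the metric projection maps the corner onto
  the boundary arc; used for radial directions it covers the body by triangles.\<close>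

lemma cell_ray:
  assumes st: "s < t" "t < s + pi" and y: "y \<in> cell s t" and e: "0 < e \<bullet> nrm s" "0 < e \<bullet> nrm t"
  obtains r q where "0 \<le> r" "0 \<le> q" "q \<le> sideL s t" "y + r *\<^sub>R e = x s + q *\<^sub>R tng s"
  | r q where "0 \<le> r" "0 \<le> q" "q \<le> sideR s t" "y + r *\<^sub>R e = x t - q *\<^sub>R tng t"
proof -
  have sh: "0 < sin (t - s)" using st by (intro sin_gt_zero) auto
  have yb: "y \<bullet> nrm s \<le> supp x s" "y \<bullet> nrm t \<le> supp x t" "x s \<bullet> nrm t \<le> y \<bullet> nrm t" "x t \<bullet> nrm s \<le> y \<bullet> nrm s"
    using y by (auto simp: cell_def body_def)
  define r1 where "r1 = (supp x s - y \<bullet> nrm s) / (e \<bullet> nrm s)"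
  define r2 where "r2 = (supp x t - y \<bullet> nrm t) / (e \<bullet> nrm t)"
  have r: "0 \<le> r1" "0 \<le> r2" using yb e by (auto simp: r1_def r2_def)
  have r1: "r1 * (e \<bullet> nrm s) = supp x s - y \<bullet> nrm s" using e by (simp add: r1_def)
  have r2: "r2 * (e \<bullet> nrm t) = supp x t - y \<bullet> nrm t" using e by (simp add: r2_def)
  have xs: "x s \<bullet> nrm t = supp x s * cos (t - s) + tco x s * sin (t - s)"
    by (rule inner_nrm_rotate)
  have xt: "x t \<bullet> nrm s = supp x t * cos (t - s) - tco x t * sin (t - s)"
    using inner_nrm_rotate[of "x t" s t] cos_minus[of "t - s"] sin_minus[of "t - s"] by simp
  show thesis
  proof (cases "r1 \<le> r2")
    case True
    define w where "w = y + r1 *\<^sub>R e"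
    define q where "q = (w - x s) \<bullet> tng s"
    have "w \<bullet> nrm s = supp x s" using r1 by (simp add: w_def inner_add_left)
    then have w: "w = x s + q *\<^sub>R tng s" unfolding q_def by (rule on_support_line)
    then have wt: "w \<bullet> nrm t = x s \<bullet> nrm t + q * sin (t - s)" by (simp add: inner_add_left tng_inner_nrm)
    have "r1 * (e \<bullet> nrm t) \<le> r2 * (e \<bullet> nrm t)" using True e by (intro mult_right_mono) auto
    then have up: "w \<bullet> nrm t \<le> supp x t" using r2 by (simp add: w_def inner_add_left)
    have "0 \<le> r1 * (e \<bullet> nrm t)" using r e by simp
    then have lo: "x s \<bullet> nrm t \<le> w \<bullet> nrm t" using yb by (simp add: w_def inner_add_left)
    have "0 \<le> q" using lo wt sh by (simp add: zero_le_mult_iff)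
    moreover have "q * sin (t - s) \<le> sideL s t * sin (t - s)"
      using up wt xs sh by (simp add: sideL_def)
    then have "q \<le> sideL s t" using sh by (simp add: mult_le_cancel_right)
    ultimately show thesis using that(1) r w unfolding w_def by blast
  next
    case False
    define w where "w = y + r2 *\<^sub>R e"
    define q where "q = - ((w - x t) \<bullet> tng t)"
    have "w \<bullet> nrm t = supp x t" using r2 by (simp add: w_def inner_add_left)
    then have w: "w = x t - q *\<^sub>R tng t" unfolding q_def using on_support_line[of w t] by simp
    have "tng t \<bullet> nrm s = - sin (t - s)"
      using tng_inner_nrm[of t s] sin_minus[of "t - s"] by simp
    then have wt: "w \<bullet> nrm s = x t \<bullet> nrm s + q * sin (t - s)" using w by (simp add: inner_diff_left)
    have "r2 * (e \<bullet> nrm s) \<le> r1 * (e \<bullet> nrm s)" using False e by (intro mult_right_mono) auto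
    then have up: "w \<bullet> nrm s \<le> supp x s" using r1 by (simp add: w_def inner_add_left)
    have "0 \<le> r2 * (e \<bullet> nrm s)" using r e by simp
    then have lo: "x t \<bullet> nrm s \<le> w \<bullet> nrm s" using yb by (simp add: w_def inner_add_left)
    have "0 \<le> q" using lo wt sh by (simp add: zero_le_mult_iff)
    moreover have "q * sin (t - s) \<le> sideR s t * sin (t - s)"
      using up wt xt sh by (simp add: sideR_def)
    then have "q \<le> sideR s t" using sh by (simp add: mult_le_cancel_right)
    ultimately show thesis using that(2) r w unfolding w_def by blast
  qed
qed

lemma supp_periodic: "supp x (t + 2 * pi) = supp x t"
  using turningD(1)[OF T] by simp

lemma frontier_normal:
  assumes "y \<in> frontier (body x)"
  obtains t where "c \<le> t" "t < c + 2 * pi" "y \<bullet> nrm t = supp x t" "y \<in> body x"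
proof -
  have closed: "closed (body x)"
    using body_in_convex_class[OF T] compact_imp_closed by (auto simp: convex_class_def)
  have y: "y \<in> body x" "y \<notin> interior (body x)"
    using assms closed by (auto simp: frontier_def)
  define f where "f t = supp x t - y \<bullet> nrm t" for t
  have per: "f (t + 2 * pi * of_int k) = f t" for t k
    by (rule periodic_shift_int) (use supp_periodic in \<open>simp add: f_def\<close>)
  have "continuous_on {c..c + 2 * pi} f"
    unfolding f_def inner_nrm by (intro continuous_intros continuous_supp[unfolded inner_nrm])
  then obtain t0 where t0: "t0 \<in> {c..c + 2 * pi}" "\<And>t. t \<in> {c..c + 2 * pi} \<Longrightarrow> f t0 \<le> f t"
    using continuous_attains_inf[of "{c..c + 2 * pi}" f] by auto
  have min: "f t0 \<le> f t" for t
  proof -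
    obtain k where "c \<le> t - 2 * pi * of_int k" "t - 2 * pi * of_int k < c + 2 * pi"
      by (rule exists_shift_into_period)
    then have "f t0 \<le> f (t - 2 * pi * of_int k)" by (intro t0) auto
    then show ?thesis using per[of "t - 2 * pi * of_int k" k] by simp
  qed
  have "f t0 \<le> 0"
  proof (rule ccontr)
    assume pos: "\<not> f t0 \<le> 0"
    have "ball y (f t0) \<subseteq> body x"
    proof
      fix z assume "z \<in> ball y (f t0)"
      then have "norm (z - y) < f t0" by (simp add: dist_norm norm_minus_commute)
      then have "(z - y) \<bullet> nrm t \<le> f t" for t
        using abs_inner_nrm_le[of "z - y" t] min[of t] by linarith
      then show "z \<in> body x" by (simp add: body_def f_def inner_diff_left)
    qed
    then show False using y(2) pos by (meson centre_in_ball interiorI not_le open_ball)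
  qed
  moreover have "0 \<le> f t0" using y by (simp add: f_def body_def)
  ultimately have f0: "f t0 = 0" by simp
  obtain k where k: "c \<le> t0 - 2 * pi * of_int k" "t0 - 2 * pi * of_int k < c + 2 * pi"
    by (rule exists_shift_into_period)
  have "f (t0 - 2 * pi * of_int k) = 0" using f0 per[of "t0 - 2 * pi * of_int k" k] by simp
  then show ?thesis using that k y(1) by (auto simp: f_def)
qed

lemma cellI:
  assumes y: "y \<in> body x" "y \<bullet> nrm r = supp x r" and srt: "s \<le> r" "r \<le> t" "s < t" "t < s + pi"
    and L: "r = s \<Longrightarrow> 0 \<le> (y - x s) \<bullet> tng s" and R: "r = t \<Longrightarrow> (y - x t) \<bullet> tng t \<le> 0"
  shows "y \<in> cell s t"
proof -
  have sh: "0 < sin (t - s)" using srt by (intro sin_gt_zero) auto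
  have ys: "y \<bullet> nrm v \<le> supp x v" for v using y by (simp add: body_def)
  have "x s \<bullet> nrm t \<le> y \<bullet> nrm t"
  proof (cases "r = s")
    case True
    then have "y = x s + ((y - x s) \<bullet> tng s) *\<^sub>R tng s" using y on_support_line by blast
    then have "y \<bullet> nrm t = x s \<bullet> nrm t + ((y - x s) \<bullet> tng s) * sin (t - s)"
      by (metis inner_add_left inner_scaleR_left tng_inner_nrm)
    then show ?thesis using L[OF True] sh by simp
  next
    case False
    have "adm s r (y - x s)"
      using False srt y ys[of s] turningD(2)[OF T, of s r]
      by (intro adm_of_two_normals) (auto simp: inner_diff_left)
    then show ?thesis using srt unfolding adm_def by (simp add: inner_diff_left)
  qed
  moreover have "x t \<bullet> nrm s \<le> y \<bullet> nrm s"
  proof (cases "r = t")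
    case True
    then have "y = x t + ((y - x t) \<bullet> tng t) *\<^sub>R tng t" using y on_support_line by blast
    then have "y \<bullet> nrm s = x t \<bullet> nrm s + ((y - x t) \<bullet> tng t) * sin (s - t)"
      by (metis inner_add_left inner_scaleR_left tng_inner_nrm)
    then show ?thesis using R[OF True] sh sin_minus[of "t - s"] by (simp add: mult_nonpos_nonneg)
  next
    case False
    have "adm r t (x t - y)"
      using False srt y ys[of t] turningD(2)[OF T, of t r]
      by (intro adm_of_two_normals) (auto simp: inner_diff_left)
    then show ?thesis using srt unfolding adm_def by (simp add: inner_diff_left)
  qed
  ultimately show ?thesis using y by (simp add: cell_def)
qed

text \<open>A boundary point whose only normal is a mesh normal may lie before or after the selected point \<open>x t\<close> on its edge, and accordingly belongs to the
  preceding or to the following cell.  At the first mesh normal the preceding cell is the last one, by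
  periodicity.\<close>

lemma cells_cover_frontier:
  assumes y: "y \<in> frontier (body x)" and n: "0 < n" "2 * pi / real n < pi"
  obtains k r where "k < n" "y \<in> cell (mesh c (c + 2 * pi) n k) (mesh c (c + 2 * pi) n (Suc k))"
    "mesh c (c + 2 * pi) n k \<le> r" "r \<le> mesh c (c + 2 * pi) n (Suc k)" "y \<bullet> nrm r = supp x r"
proof -
  let ?m = "mesh c (c + 2 * pi) n"
  have step: "?m k < ?m (Suc k)" "?m (Suc k) < ?m k + pi" for k
    using n by (simp_all add: mesh_Suc)
  obtain t where t: "c \<le> t" "t < c + 2 * pi" "y \<bullet> nrm t = supp x t" and yb: "y \<in> body x"
    by (rule frontier_normal[OF y])
  obtain k where k: "k < n" "?m k \<le> t" "t \<le> ?m (Suc k)"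
    using mesh_cover[of c t "c + 2 * pi" n] t n by auto
  consider "t = ?m (Suc k) \<Longrightarrow> (y - x t) \<bullet> tng t \<le> 0" "t = ?m k \<Longrightarrow> 0 \<le> (y - x t) \<bullet> tng t"
    | "t = ?m (Suc k)" "0 < (y - x t) \<bullet> tng t"
    | "t = ?m k" "(y - x t) \<bullet> tng t < 0" by linarith
  then show ?thesis
  proof cases
    case 1
    then have "y \<in> cell (?m k) (?m (Suc k))"
      using yb t k step[of k] by (intro cellI[of y t]) auto
    then show ?thesis using that k t by blast
  next
    case 2
    have "Suc k \<noteq> n" using 2 t n by auto
    then have "Suc k < n" using k by simp
    moreover have "y \<in> cell (?m (Suc k)) (?m (Suc (Suc k)))"
      using 2 yb t step[of "Suc k"] by (intro cellI[of y t]) auto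
    ultimately show ?thesis using that[of "Suc k" t] 2 step[of "Suc k"] t by auto
  next
    case 3
    show ?thesis
    proof (cases k)
      case (Suc j)
      then have "y \<in> cell (?m j) (?m (Suc j))"
        using 3 yb t step[of j] by (intro cellI[of y t]) auto
      then show ?thesis using that[of j t] 3 Suc k step[of j] t by auto
    next
      case 0
      then have tc: "t = c" using 3 by simp
      have per: "x (c + 2 * pi) = x c" using turningD(1)[OF T] .
      have "?m (Suc (n - 1)) = c + 2 * pi" using n by simp
      moreover from this have "y \<in> cell (?m (n - 1)) (?m (Suc (n - 1)))"
        using 3 yb t step[of "n - 1"] tc per by (intro cellI[of y "c + 2 * pi"]) auto
      ultimately show ?thesis using that[of "n - 1" "c + 2 * pi"] n step[of "n - 1"] t tc per by auto
    qed
  qed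
qed

section \<open>The perimeter is the integral of the support function\<close>

lemma body_compact: "compact (body x)" and body_convex: "convex (body x)"
  and body_closed: "closed (body x)" and body_nonempty: "body x \<noteq> {}"
  using body_in_convex_class[OF T] turning_mem_body[OF T] compact_imp_closed
  unfolding convex_class_def by blast+

lemma closest_point_outer_normal:
  assumes y: "y \<in> body x" "y \<bullet> nrm r = supp x r" and \<rho>: "0 \<le> \<rho>"
  shows "closest_point (body x) (y + \<rho> *\<^sub>R nrm r) = y"
proof -
  have "dist (y + \<rho> *\<^sub>R nrm r) y \<le> dist (y + \<rho> *\<^sub>R nrm r) z" if "z \<in> body x" for z
  proof -
    have "z \<bullet> nrm r \<le> y \<bullet> nrm r" using that y by (simp add: body_def)
    then have "\<rho> \<le> (y + \<rho> *\<^sub>R nrm r - z) \<bullet> nrm r"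
      by (simp add: inner_add_left inner_diff_left nrm_inner_nrm)
    also have "\<dots> \<le> norm (y + \<rho> *\<^sub>R nrm r - z)"
      using abs_inner_nrm_le[of "y + \<rho> *\<^sub>R nrm r - z" r] by simp
    finally show ?thesis using \<rho> by (simp add: dist_norm)
  qed
  then show ?thesis
    using closest_point_unique[OF body_convex body_closed y(1), of "y + \<rho> *\<^sub>R nrm r"] by simp
qed

definition peri :: "real \<Rightarrow> real \<Rightarrow> real" where
  "peri c t = tco x t + integral {c..t} (supp x)"

lemma peri_period: "peri c (c + 2 * pi) - peri c c = integral {c..c + 2 * pi} (supp x)"
  using turningD(1)[OF T, of c] by (simp add: peri_def)

lemma peri_approx:
  assumes "c \<le> s" "s \<le> t"
  shows "\<bar>(peri c t - peri c s) - ((tco x t - tco x s) + supp x s * (t - s))\<bar> \<le> b * (t - s)\<^sup>2"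
proof -
  have "integral {c..t} (supp x) = integral {c..s} (supp x) + integral {s..t} (supp x)"
    using Henstock_Kurzweil_Integration.integral_combine[OF assms integrable_supp] by simp
  then show ?thesis
    using supp_integral_approx[OF assms(2)] by (simp add: peri_def)
qed

text \<open>The boundary is the image, under the 1-Lipschitz metric projection, of the boundary of the polygon cut out by
  the supporting lines of an equidistant mesh of normals.\<close>

lemma hausdorff1_frontier_le:
  "hausdorff1 (frontier (body x)) \<le> ennreal (integral {c..c + 2 * pi} (supp x))"
proof -
  let ?K = "body x" and ?I = "integral {c..c + 2 * pi} (supp x)"
  \<comment> \<open>From \<open>n = 7\<close> on, consecutive mesh normals differ by at most 1.\<close>
  have bound: "hausdorff1 (frontier ?K) \<le> ennreal (?I + 3 * b * (2 * pi) * (2 * pi) / real n)"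
    if n: "n \<ge> 7" for n :: nat
  proof -
    let ?m = "mesh c (c + 2 * pi) n"
    have n0: "0 < n" using n by simp
    have h1: "2 * pi / real n \<le> 1"
    proof -
      have "2 * pi \<le> 7" using pi_less_4 pi_approx by simp
      also have "\<dots> \<le> real n" using n by simp
      finally show ?thesis using n0 by (simp add: field_simps)
    qed
    have hpi: "2 * pi / real n < pi" using h1 pi_gt3 by linarith
    have step: "?m k < ?m (Suc k)" "?m (Suc k) < ?m k + pi" "?m (Suc k) \<le> ?m k + 1" for k
      using n0 h1 hpi by (simp_all add: mesh_Suc)
    define g where "g = (\<lambda>(k, B) q. if B then x (?m k) + q *\<^sub>R tng (?m k)
        else x (?m (Suc k)) - q *\<^sub>R tng (?m (Suc k)))"
    define len where "len = (\<lambda>(k, B). if B then sideL (?m k) (?m (Suc k)) else sideR (?m k) (?m (Suc k)))"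
    define F where "F = {..<n} \<times> (UNIV :: bool set)"
    have len0: "0 \<le> len i" for i
      using sides_nonneg[OF step(1,2)] by (auto simp: len_def split: prod.split)
    have "hausdorff1 (frontier ?K) \<le> ennreal (\<Sum>i\<in>F. len i)"
    proof (rule hausdorff1_le_lipschitz_cover[where f = "\<lambda>i q. closest_point ?K (g i q)"])
      show "finite F" by (simp add: F_def)
      show "dist (closest_point ?K (g i s)) (closest_point ?K (g i t)) \<le> \<bar>s - t\<bar>" for i s t
      proof -
        have "dist (closest_point ?K (g i s)) (closest_point ?K (g i t)) \<le> dist (g i s) (g i t)"
          by (rule closest_point_lipschitz[OF body_convex body_closed body_nonempty])
        also have "\<dots> = \<bar>s - t\<bar>"
          by (auto simp: g_def dist_norm abs_minus_commute simp flip: scaleR_diff_left split: prod.split)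
        finally show ?thesis .
      qed
      show "frontier ?K \<subseteq> (\<Union>i\<in>F. (\<lambda>q. closest_point ?K (g i q)) ` {0..len i})"
      proof
        fix y assume yf: "y \<in> frontier ?K"
        then obtain k r where k: "k < n" and y: "y \<in> cell (?m k) (?m (Suc k))"
          and r: "?m k \<le> r" "r \<le> ?m (Suc k)" "y \<bullet> nrm r = supp x r"
          using cells_cover_frontier[OF yf n0 hpi, of c] by blast
        have yK: "y \<in> ?K" using y by (simp add: cell_def)
        have close: "\<bar>r - ?m k\<bar> \<le> 1" "\<bar>r - ?m (Suc k)\<bar> \<le> 1" using r step(3)[of k] by auto
        then have e: "0 < nrm r \<bullet> nrm (?m k)" "0 < nrm r \<bullet> nrm (?m (Suc k))"
          using pi_gt3 by (auto simp: nrm_inner_nrm intro!: cos_gt_zero_pi)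
        show "y \<in> (\<Union>i\<in>F. (\<lambda>q. closest_point ?K (g i q)) ` {0..len i})"
        proof (rule cell_ray[OF step(1,2) y e])
          fix \<rho> q assume *: "0 \<le> \<rho>" "0 \<le> q" "q \<le> sideL (?m k) (?m (Suc k))"
            "y + \<rho> *\<^sub>R nrm r = x (?m k) + q *\<^sub>R tng (?m k)"
          then have "y = closest_point ?K (g (k, True) q)" "q \<in> {0..len (k, True)}"
            using closest_point_outer_normal[OF yK r(3) *(1)] by (simp_all add: g_def len_def)
          then show ?thesis using k unfolding F_def by blast
        next
          fix \<rho> q assume *: "0 \<le> \<rho>" "0 \<le> q" "q \<le> sideR (?m k) (?m (Suc k))"
            "y + \<rho> *\<^sub>R nrm r = x (?m (Suc k)) - q *\<^sub>R tng (?m (Suc k))"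
          then have "y = closest_point ?K (g (k, False) q)" "q \<in> {0..len (k, False)}"
            using closest_point_outer_normal[OF yK r(3) *(1)] by (simp_all add: g_def len_def)
          then show ?thesis using k unfolding F_def by blast
        qed
      qed
    qed (use len0 in auto)
    also have "(\<Sum>i\<in>F. len i) = (\<Sum>k<n. sideL (?m k) (?m (Suc k)) + sideR (?m k) (?m (Suc k)))"
    proof -
      have "(\<Sum>i\<in>F. len i) = (\<Sum>k<n. \<Sum>B\<in>UNIV. len (k, B))"
        unfolding F_def by (simp add: sum.cartesian_product)
      then show ?thesis by (simp add: len_def UNIV_bool add.commute)
    qed
    also have "\<dots> \<le> peri c (c + 2 * pi) - peri c c
        + 3 * b * (c + 2 * pi - c) * ((c + 2 * pi - c) + (0 - 0)) / real n"
    proof (rule mesh_sum_le[where \<eta> = 1 and A = "\<lambda>s t. sideL s t + sideR s t" and \<Phi> = "peri c" and g = "\<lambda>_. 0"])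
      fix s t assume st: "c \<le> s" "s \<le> t" "t \<le> c + 2 * pi" "t \<le> s + 1"
      show "sideL s t + sideR s t \<le> peri c t - peri c s + 3 * b * ((t - s) * ((t - s) + (0 - 0)))"
      proof (cases "s = t")
        case True
        then show ?thesis by (simp add: sideL_def sideR_def)
      next
        case False
        then have "sideL s t + sideR s t \<le> (tco x t - tco x s) + supp x s * (t - s) + 2 * b * (t - s)\<^sup>2"
          using sides_le[of s t] st by simp
        moreover have "(tco x t - tco x s) + supp x s * (t - s) - b * (t - s)\<^sup>2 \<le> peri c t - peri c s"
          using peri_approx[OF st(1,2)] by (simp add: abs_le_iff)
        ultimately show ?thesis by (simp add: power2_eq_square)
      qed
    qed (use n0 h1 in auto)
    finally show ?thesis
      unfolding peri_period by (simp add: ennreal_leI)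
  qed
  then have fin: "hausdorff1 (frontier ?K) < top"
    using le_less_trans[OF bound[of 7]] by (simp add: less_top)
  have "enn2real (hausdorff1 (frontier ?K)) - 3 * b * (2 * pi) * (2 * pi) / real n \<le> ?I" if "n \<ge> 7" for n
  proof -
    have "0 \<le> ?I + 3 * b * (2 * pi) * (2 * pi) / real n"
      using b_pos supp_pos
      by (intro add_nonneg_nonneg integral_nonneg integrable_supp) (auto intro: less_imp_le)
    then have "enn2real (hausdorff1 (frontier ?K)) \<le> ?I + 3 * b * (2 * pi) * (2 * pi) / real n"
      using bound[OF that] by (intro enn2real_leI)
    then show ?thesis by simp
  qed
  then have "enn2real (hausdorff1 (frontier ?K)) \<le> ?I" by (rule ge_of_ge_minus_inverse)
  then show ?thesis
    using fin by (metis ennreal_enn2real ennreal_leI)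
qed

text \<open>The gauge of the body: for \<open>r \<ge> 0\<close>, \<open>y\<close> lies in \<open>r\<close> times the body iff \<open>pgauge y \<le> r\<close>.\<close>

definition pgauge :: "real^2 \<Rightarrow> real" where
  "pgauge y = (SUP t. y \<bullet> nrm t / supp x t)"

lemma pgauge_le_iff: "pgauge y \<le> r \<longleftrightarrow> (\<forall>t. y \<bullet> nrm t \<le> r * supp x t)"
proof -
  have "y \<bullet> nrm t / supp x t \<le> norm y / a" for t
    using abs_inner_nrm_le[of y t] turningD(3)[OF T, of t] a0
    by (intro frac_le) (auto simp: abs_le_iff)
  then have "bdd_above (range (\<lambda>t. y \<bullet> nrm t / supp x t))" by (intro bdd_aboveI2)
  then show ?thesis
    unfolding pgauge_def by (subst cSUP_le_iff) (auto simp: pos_divide_le_eq supp_pos)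
qed

lemma pgauge_ge: "y \<bullet> nrm t \<le> pgauge y * supp x t"
  using pgauge_le_iff[of y "pgauge y"] by simp

lemma body_iff_pgauge: "y \<in> body x \<longleftrightarrow> pgauge y \<le> 1"
  by (simp add: pgauge_le_iff body_def)

lemma pgauge_triangle: "pgauge (y + z) \<le> pgauge y + pgauge z"
  unfolding pgauge_le_iff using pgauge_ge[of y] pgauge_ge[of z]
  by (simp add: inner_add_left distrib_right add_mono)

lemma norm_le_pgauge: "norm y \<le> b * pgauge y" and pgauge_nonneg: "0 \<le> pgauge y"
proof -
  obtain t where t: "y = norm y *\<^sub>R nrm t" by (rule polar_form[of 0 y])
  then have "y \<bullet> nrm t = norm y" by (metis inner_scaleR_left nrm_inner_nrm cos_zero diff_self mult.right_neutral)
  then have *: "norm y \<le> pgauge y * supp x t" using pgauge_ge[of y t] by simp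
  then show "0 \<le> pgauge y"
    using supp_pos[of t] by (metis norm_ge_zero order_trans zero_le_mult_iff not_le)
  then have "pgauge y * supp x t \<le> pgauge y * b"
    using turningD(4)[OF T] by (intro mult_left_mono) auto
  with * show "norm y \<le> b * pgauge y" by (simp add: mult.commute)
qed

lemma pgauge_le_norm: "pgauge y \<le> norm y / a"
  unfolding pgauge_le_iff
proof
  fix t
  have "norm y / a * a \<le> norm y / a * supp x t"
    using turningD(3)[OF T] a0 by (intro mult_left_mono) auto
  then show "y \<bullet> nrm t \<le> norm y / a * supp x t"
    using abs_inner_nrm_le[of y t] a0 by (simp add: abs_le_iff)
qed

lemma pgauge_scale:
  assumes "0 \<le> r"
  shows "pgauge (r *\<^sub>R y) = r * pgauge y"
proof (cases "r = 0")
  case True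
  then show ?thesis using pgauge_le_norm[of 0] pgauge_nonneg[of 0] by simp
next
  case False
  have le: "pgauge (r *\<^sub>R y) \<le> r * pgauge y" if "0 < r" for r y
    unfolding pgauge_le_iff using pgauge_ge[of y] that by (simp add: mult.assoc)
  have "pgauge ((1 / r) *\<^sub>R r *\<^sub>R y) \<le> (1 / r) * pgauge (r *\<^sub>R y)"
    using assms False by (intro le) auto
  then have "r * pgauge y \<le> pgauge (r *\<^sub>R y)" using assms False by (simp add: field_simps)
  then show ?thesis using le[of r y] assms False by simp
qed

lemma pgauge_lipschitz: "\<bar>pgauge y - pgauge z\<bar> \<le> norm (y - z) / a"
  using pgauge_triangle[of "y - z" z] pgauge_triangle[of "z - y" y]
    pgauge_le_norm[of "y - z"] pgauge_le_norm[of "z - y"]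
  by (simp add: abs_le_iff norm_minus_commute)

lemma continuous_pgauge: "continuous_on S pgauge"
proof (rule continuous_on_subset[OF _ subset_UNIV])
  have "(1 / a)-lipschitz_on UNIV pgauge"
    using pgauge_lipschitz a0 by (intro lipschitz_onI) (auto simp: dist_norm)
  then show "continuous_on UNIV pgauge" by (rule lipschitz_on_continuous_on)
qed

lemma pgauge_curve: "pgauge (x t) = 1"
proof (rule antisym)
  show "pgauge (x t) \<le> 1" using turning_mem_body[OF T] body_iff_pgauge by blast
  have "supp x t \<le> pgauge (x t) * supp x t" by (rule pgauge_ge)
  then show "1 \<le> pgauge (x t)"
    using supp_pos[of t] by (metis mult_1 mult_le_cancel_right_pos)
qed

lemma pgauge_pos: "y \<noteq> 0 \<Longrightarrow> 0 < pgauge y"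
  using norm_le_pgauge[of y] b_pos pgauge_nonneg[of y]
  by (metis less_eq_real_def mult_zero_right norm_le_zero_iff)

lemma pgauge_1_frontier:
  assumes "pgauge w = 1"
  shows "w \<in> frontier (body x)"
proof -
  have w0: "w \<noteq> 0" using assms pgauge_le_norm[of 0] by auto
  have "w \<notin> interior (body x)"
  proof
    assume "w \<in> interior (body x)"
    then obtain e where e: "0 < e" "ball w e \<subseteq> body x" by (auto simp: mem_interior)
    define q where "q = e / (2 * norm w)"
    have q: "0 < q" using e w0 by (simp add: q_def)
    have "dist w ((1 + q) *\<^sub>R w) = q * norm w"
      using q by (simp add: dist_norm scaleR_add_left)
    also have "\<dots> < e" using e w0 by (simp add: q_def)
    finally have "(1 + q) *\<^sub>R w \<in> body x" using e(2) by auto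
    then show False using assms q by (simp add: body_iff_pgauge pgauge_scale)
  qed
  then show ?thesis
    using assms body_iff_pgauge[of w] body_closed by (simp add: frontier_def)
qed

text \<open>The bound \<open>2 b sin h \<le> a cos h\<close> for \<open>h \<le> order_gap\<close> forces curve points with close normals into counterclockwise order around the
  origin.\<close>

definition order_gap :: real where "order_gap = a / (4 * b)"

lemma order_gap: "0 < order_gap" "order_gap \<le> 1 / 4"
proof -
  have "a \<le> b" using turningD(3,4)[OF T, of 0] by linarith
  then show "0 < order_gap" "order_gap \<le> 1 / 4"
    using a0 by (auto simp: order_gap_def field_simps)
qed

lemma order_gap_trig:
  assumes "0 \<le> h" "h \<le> order_gap"
  shows "1 / 2 \<le> cos h" "2 * b * sin h \<le> a * cos h"
proof -
  have "h\<^sup>2 \<le> 1\<^sup>2" using assms order_gap by (intro power_mono) auto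
  then show c: "1 / 2 \<le> cos h" using one_minus_cos_le[of h] by simp
  have "2 * b * sin h \<le> 2 * b * order_gap"
    using sin_x_le_x[OF assms(1)] assms b_pos by (intro mult_left_mono) auto
  also have "\<dots> = a * (1 / 2)" using b_pos by (simp add: order_gap_def)
  also have "\<dots> \<le> a * cos h" using c a0 by (intro mult_left_mono) auto
  finally show "2 * b * sin h \<le> a * cos h" .
qed

lemma cross2_curve:
  assumes "s \<le> t" "t \<le> s + order_gap"
  defines "d \<equiv> x t - x s"
  shows "0 \<le> d \<bullet> tng s" "- (d \<bullet> nrm s) * cos (t - s) \<le> (d \<bullet> tng s) * sin (t - s)" "d \<bullet> nrm s \<le> 0"
    "a / 2 * (d \<bullet> tng s) \<le> cross2 (x s) (x t)"
proof -
  define h where "h = t - s"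
  have h: "0 \<le> h" "h \<le> order_gap" using assms by (auto simp: h_def)
  note trig = order_gap_trig[OF h]
  note b = b_pos
  have hpi: "h < pi" using h order_gap pi_gt3 by linarith
  show d1: "d \<bullet> nrm s \<le> 0" using turningD(2)[OF T, of t s] by (simp add: d_def inner_diff_left)
  have "0 \<le> d \<bullet> nrm t" using turningD(2)[OF T, of s t] by (simp add: d_def inner_diff_left)
  then show rel: "- (d \<bullet> nrm s) * cos (t - s) \<le> (d \<bullet> tng s) * sin (t - s)"
    using inner_nrm_rotate[of d t s] by simp
  show d2: "0 \<le> d \<bullet> tng s"
  proof (cases "h = 0")
    case True
    then show ?thesis by (simp add: h_def d_def)
  next
    case False
    then have "0 < sin h" using h hpi by (intro sin_gt_zero) auto
    moreover have "0 \<le> - (d \<bullet> nrm s) * cos h" using d1 trig by (simp add: mult_nonpos_nonneg)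
    then have "0 \<le> (d \<bullet> tng s) * sin h" using rel unfolding h_def by linarith
    ultimately show ?thesis by (simp add: zero_le_mult_iff)
  qed
  have "2 * b * (- (d \<bullet> nrm s)) * cos h \<le> 2 * b * ((d \<bullet> tng s) * sin h)"
    using rel b unfolding h_def[symmetric] mult.assoc by (intro mult_left_mono) auto
  also have "\<dots> \<le> (d \<bullet> tng s) * (a * cos h)"
    using mult_left_mono[OF trig(2) d2] by (simp add: mult_ac)
  finally have "2 * b * (- (d \<bullet> nrm s)) * cos h \<le> a * (d \<bullet> tng s) * cos h" by (simp add: mult_ac)
  then have "2 * b * (- (d \<bullet> nrm s)) \<le> a * (d \<bullet> tng s)"
    by (rule mult_right_le_imp_le) (use trig(1) in simp)
  then have 1: "b * (- (d \<bullet> nrm s)) \<le> a / 2 * (d \<bullet> tng s)" by simp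
  have "x t = x s + d" by (simp add: d_def)
  then have "cross2 (x s) (x t) = cross2 (x s) d" by (simp add: cross2_simps)
  also have "\<dots> = supp x s * (d \<bullet> tng s) - tco x s * (d \<bullet> nrm s)" by (rule cross2_frame)
  finally have cr: "cross2 (x s) (x t) = supp x s * (d \<bullet> tng s) + tco x s * (- (d \<bullet> nrm s))" by simp
  have "a * (d \<bullet> tng s) \<le> supp x s * (d \<bullet> tng s)"
    using turningD(3)[OF T] d2 by (intro mult_right_mono) auto
  moreover have "- b * (- (d \<bullet> nrm s)) \<le> tco x s * (- (d \<bullet> nrm s))"
    using abs_tco_le[of s] d1 by (intro mult_right_mono) (auto simp: abs_le_iff)
  ultimately show "a / 2 * (d \<bullet> tng s) \<le> cross2 (x s) (x t)" using 1 cr by simp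
qed

text \<open>The polar angle of \<open>x t\<close>, chosen within \<open>\<pi>/2\<close> of the normal angle \<open>t\<close>.\<close>

definition pang :: "real \<Rightarrow> real" where
  "pang t = t + arctan (tco x t / supp x t)"

lemma pang_period: "pang (t + 2 * pi) = pang t + 2 * pi"
  using turningD(1)[OF T, of t] by (simp add: pang_def)

lemma pang_bounds: "t - pi / 2 < pang t" "pang t < t + pi / 2"
  using arctan_lbound[of "tco x t / supp x t"] arctan_ubound[of "tco x t / supp x t"]
  by (auto simp: pang_def)

lemma curve_polar: "x t = norm (x t) *\<^sub>R nrm (pang t)" "x t \<noteq> 0"
proof -
  note p = supp_pos[of t]
  define \<psi> where "\<psi> = arctan (tco x t / supp x t)"
  have c: "0 < cos \<psi>" unfolding \<psi>_def by (rule cos_arctan_not_zero[THEN not_sym, THEN order.not_eq_order_implies_strict])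
      (use arctan_lbound arctan_ubound in \<open>auto intro!: cos_ge_zero simp: less_imp_le\<close>)
  have "tan \<psi> = tco x t / supp x t" by (simp add: \<psi>_def tan_arctan)
  then have s: "sin \<psi> * supp x t = tco x t * cos \<psi>" using c p by (simp add: tan_def field_simps)
  have "nrm (pang t) = cos \<psi> *\<^sub>R nrm t + sin \<psi> *\<^sub>R tng t"
    using frame_decomp[of "nrm (pang t)" t] cos_minus[of \<psi>]
    by (simp add: nrm_inner_nrm nrm_inner_tng pang_def \<psi>_def)
  then have "(supp x t / cos \<psi>) *\<^sub>R nrm (pang t) = supp x t *\<^sub>R nrm t + tco x t *\<^sub>R tng t"
    using c s by (simp add: scaleR_add_right field_simps)
  then have eq: "x t = (supp x t / cos \<psi>) *\<^sub>R nrm (pang t)" using frame_decomp[of "x t" t] by simp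
  have "norm (x t) = supp x t / cos \<psi>" by (subst eq) (use c p in simp)
  with eq show "x t = norm (x t) *\<^sub>R nrm (pang t)" by simp
  show "x t \<noteq> 0" using p by auto
qed

lemma pang_le:
  assumes "s \<le> t" "t \<le> s + order_gap"
  shows "pang s \<le> pang t"
proof (rule ccontr)
  assume "\<not> pang s \<le> pang t"
  then have neg: "pang t < pang s" by simp
  have "0 \<le> a / 2 * ((x t - x s) \<bullet> tng s)" using cross2_curve(1)[OF assms] a0 by simp
  then have "0 \<le> cross2 (x s) (x t)" using cross2_curve(4)[OF assms] by linarith
  then have "0 \<le> norm (x s) * norm (x t) * sin (pang t - pang s)"
    using curve_polar(1)[of s] curve_polar(1)[of t] cross2_nrm by metis
  moreover have "0 < norm (x s) * norm (x t)" using curve_polar(2) by simp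
  ultimately have "0 \<le> sin (pang t - pang s)"
    by (metis linorder_not_less mult_pos_neg)
  moreover have "0 < sin (pang s - pang t)"
    using neg pang_bounds(2)[of s] pang_bounds(1)[of t] assms by (intro sin_gt_zero) auto
  ultimately show False using sin_minus[of "pang s - pang t"] by simp
qed

definition cone :: "real \<Rightarrow> real \<Rightarrow> (real^2) set" where
  "cone s t = {y. 0 < cross2 (x s) y \<and> 0 < cross2 y (x t)}"

lemma cone_angle:
  assumes st: "s \<le> t" "t \<le> s + order_gap" and y: "y \<in> cone s t"
  obtains \<phi> where "pang s < \<phi>" "\<phi> < pang t" "y = norm y *\<^sub>R nrm \<phi>" "y \<noteq> 0"
proof -
  obtain \<phi> where \<phi>: "pang s \<le> \<phi>" "\<phi> < pang s + 2 * pi" "y = norm y *\<^sub>R nrm \<phi>" by (rule polar_form)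
  have y0: "y \<noteq> 0" using y by (auto simp: cone_def cross2_def)
  have "0 < norm (x s) * norm y * sin (\<phi> - pang s)" "0 < norm y * norm (x t) * sin (pang t - \<phi>)"
    using y curve_polar(1)[of s] curve_polar(1)[of t] \<phi>(3) cross2_nrm unfolding cone_def mem_Collect_eq by metis+
  then have pos: "0 < sin (\<phi> - pang s)" "0 < sin (pang t - \<phi>)"
    using y0 curve_polar(2) zero_less_mult_pos by (metis mult_pos_pos zero_less_norm_iff)+
  have "\<phi> < pang s + pi"
  proof (rule ccontr)
    assume "\<not> \<phi> < pang s + pi"
    then have "0 \<le> sin (\<phi> - pang s - pi)" using \<phi> by (intro sin_ge_zero) auto
    then show False using pos sin_minus_pi[of "\<phi> - pang s"] by (simp add: sin_diff)
  qed
  moreover have "\<phi> < pang t"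
  proof (rule ccontr)
    assume "\<not> \<phi> < pang t"
    then have "0 \<le> sin (\<phi> - pang t)" using \<open>\<phi> < pang s + pi\<close> pang_le[OF st] by (intro sin_ge_zero) auto
    then show False using pos sin_minus[of "\<phi> - pang t"] by simp
  qed
  moreover have "pang s < \<phi>" using pos \<phi>(1) by (cases "pang s = \<phi>") auto
  ultimately show ?thesis using that \<phi>(3) y0 by blast
qed

text \<open>Along the mesh the polar angle of the curve increases, by \<open>2 \<pi>\<close> in total.\<close>

lemma cones_disjoint:
  fixes c :: real
  assumes n: "0 < n" "2 * pi / real n \<le> order_gap" and jk: "j < k" "k < n"
  defines "m \<equiv> mesh c (c + 2 * pi) n"
  shows "cone (m j) (m (Suc j)) \<inter> cone (m k) (m (Suc k)) = {}"
proof (rule ccontr)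
  assume "cone (m j) (m (Suc j)) \<inter> cone (m k) (m (Suc k)) \<noteq> {}"
  then obtain y where y: "y \<in> cone (m j) (m (Suc j))" "y \<in> cone (m k) (m (Suc k))" by blast
  have step: "m i \<le> m (Suc i)" "m (Suc i) \<le> m i + order_gap" for i
    using n by (auto simp: m_def mesh_Suc)
  have mono: "pang (m i) \<le> pang (m i')" if "i \<le> i'" for i i'
    by (rule lift_Suc_mono_le[OF _ that]) (rule pang_le[OF step])
  obtain \<phi> where \<phi>: "pang (m j) < \<phi>" "\<phi> < pang (m (Suc j))" "y = norm y *\<^sub>R nrm \<phi>" "y \<noteq> 0"
    by (rule cone_angle[OF step y(1)])
  obtain \<phi>' where \<phi>': "pang (m k) < \<phi>'" "\<phi>' < pang (m (Suc k))" "y = norm y *\<^sub>R nrm \<phi>'"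
    by (rule cone_angle[OF step y(2)])
  have "nrm \<phi> = nrm \<phi>'" using \<phi> \<phi>' by (metis norm_eq_zero scaleR_cancel_left)
  then have "cos (\<phi>' - \<phi>) = 1" using nrm_inner_nrm[of \<phi> \<phi>'] nrm_inner_nrm[of \<phi>' \<phi>'] by simp
  then obtain i :: int where i: "\<phi>' - \<phi> = of_int i * 2 * pi" using cos_one_2pi_int by blast
  have "\<phi> < \<phi>'" using \<phi> \<phi>' mono[of "Suc j" k] jk by simp
  moreover have "\<phi>' - \<phi> < 2 * pi"
  proof -
    have "pang (m (Suc k)) \<le> pang (m n)" "pang (m 0) \<le> pang (m j)" using mono jk by auto
    moreover have "pang (m n) = pang (m 0) + 2 * pi" using n pang_period[of c] by (simp add: m_def)
    ultimately show ?thesis using \<phi> \<phi>' by linarith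
  qed
  ultimately have "0 < pi * (of_int i :: real)" "pi * (of_int i :: real) < pi * 1"
    using i by (simp_all add: mult.commute)
  then have "0 < (of_int i :: real)" "(of_int i :: real) < 1"
    using zero_less_mult_pos pi_gt_zero mult_less_cancel_left_pos by blast+
  then show False by simp
qed

text \<open>Central projection of slightly shortened chords onto the boundary gives compact arcs in disjoint cones; each of them projects
  to the direction of its initial tangent onto an interval almost as long as the projected chord.\<close>

lemma chord_sum_le:
  fixes c :: real
  assumes n: "0 < n" "2 * pi / real n \<le> order_gap"
  defines "m \<equiv> mesh c (c + 2 * pi) n"
  shows "(\<Sum>k<n. (x (m (Suc k)) - x (m k)) \<bullet> tng (m k)) \<le> enn2real (hausdorff1 (frontier (body x)))"
proof (rule field_le_epsilon)
  fix e :: real assume e: "0 < e"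
  let ?g = "pgauge"
  define d where "d k = x (m (Suc k)) - x (m k)" for k
  define v where "v k r = x (m k) + r *\<^sub>R d k" for k r
  define w where "w k r = (1 / ?g (v k r)) *\<^sub>R v k r" for k r
  define F where "F k r = w k r \<bullet> tng (m k)" for k r
  define I where "I = {k. k < n \<and> 0 < d k \<bullet> tng (m k)}"
  have step: "m i \<le> m (Suc i)" "m (Suc i) \<le> m i + order_gap" for i
    using n by (auto simp: m_def mesh_Suc)
  have cross: "0 < cross2 (x (m k)) (x (m (Suc k)))" if "k \<in> I" for k
  proof -
    have "0 < a / 2 * (d k \<bullet> tng (m k))" using that a0 by (simp add: I_def)
    then show ?thesis using cross2_curve(4)[OF step, of k] unfolding d_def by linarith
  qed
  have v_left: "cross2 (x (m k)) (v k r) = r * cross2 (x (m k)) (x (m (Suc k)))"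
    and v_right: "cross2 (v k r) (x (m (Suc k))) = (1 - r) * cross2 (x (m k)) (x (m (Suc k)))" for k r
    by (simp_all add: v_def d_def cross2_simps algebra_simps)
  have v0: "v k r \<noteq> 0" if "k \<in> I" "0 \<le> r" "r \<le> 1" for k r
  proof
    assume "v k r = 0"
    then have "cross2 (x (m k)) (v k r) = 0" "cross2 (v k r) (x (m (Suc k))) = 0"
      by (simp_all add: cross2_def)
    then show False using v_left[of k r] v_right[of k r] cross[OF that(1)] by simp
  qed
  have g0: "0 < ?g (v k r)" if "k \<in> I" "0 \<le> r" "r \<le> 1" for k r
    by (rule pgauge_pos[OF v0[OF that]])
  have wfr: "w k r \<in> frontier (body x)" if "k \<in> I" "0 \<le> r" "r \<le> 1" for k r
  proof (rule pgauge_1_frontier)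
    show "?g (w k r) = 1" using g0[OF that] by (simp add: w_def pgauge_scale)
  qed
  have wcont: "continuous_on {0..1} (w k)" if "k \<in> I" for k
  proof -
    have "continuous_on {0..1} (v k)" unfolding v_def by (intro continuous_intros)
    moreover from this have "continuous_on {0..1} (\<lambda>r. ?g (v k r))"
      by (rule continuous_on_compose2[OF continuous_pgauge[of UNIV]]) auto
    ultimately show ?thesis
      unfolding w_def using g0[OF that] by (intro continuous_intros) force+
  qed
  have Fcont: "continuous_on {0..1} (F k)" if "k \<in> I" for k
    unfolding F_def by (intro continuous_intros wcont that)
  have F01: "F k 1 - F k 0 = d k \<bullet> tng (m k)" for k
    by (simp add: F_def w_def v_def pgauge_curve inner_diff_left d_def)
  have "\<exists>\<epsilon>. 0 < \<epsilon> \<and> \<epsilon> < 1 / 2 \<and> F k \<epsilon> \<le> F k (1 - \<epsilon>) \<and> d k \<bullet> tng (m k) - e / n \<le> F k (1 - \<epsilon>) - F k \<epsilon>"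
    if "k \<in> I" for k
  proof -
    have "F k 0 < F k 1" "0 < e / n" using that F01[of k] e n by (auto simp: I_def)
    from shrink_interval[OF Fcont[OF that] this] show ?thesis unfolding F01 by metis
  qed
  then obtain \<epsilon> where \<epsilon>: "\<And>k. k \<in> I \<Longrightarrow> 0 < \<epsilon> k \<and> \<epsilon> k < 1 / 2 \<and> F k (\<epsilon> k) \<le> F k (1 - \<epsilon> k) \<and>
      d k \<bullet> tng (m k) - e / n \<le> F k (1 - \<epsilon> k) - F k (\<epsilon> k)" by metis
  define C where "C k = w k ` {\<epsilon> k..1 - \<epsilon> k}" for k
  have sub: "{\<epsilon> k..1 - \<epsilon> k} \<subseteq> {0..1}" if "k \<in> I" for k using \<epsilon>[OF that] by auto
  have Ccone: "C k \<subseteq> cone (m k) (m (Suc k))" if "k \<in> I" for k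
  proof
    fix y assume "y \<in> C k"
    then obtain r where r': "y = w k r" "r \<in> {\<epsilon> k..1 - \<epsilon> k}" by (auto simp: C_def)
    then have r: "y = w k r" "0 < r" "r < 1" using \<epsilon>[OF that] by auto
    then show "y \<in> cone (m k) (m (Suc k))"
      using cross[OF that] g0[OF that, of r] v_left[of k r] v_right[of k r]
      by (simp add: cone_def w_def cross2_simps)
  qed
  have "ennreal (\<Sum>k\<in>I. F k (1 - \<epsilon> k) - F k (\<epsilon> k)) \<le> hausdorff1 (frontier (body x))"
  proof (rule hausdorff1_ge_separated[where C = C and f = "\<lambda>k y. y \<bullet> tng (m k)"])
    show "finite I" by (simp add: I_def)
    show "compact (C k)" if "k \<in> I" for k
      unfolding C_def using wcont[OF that] sub[OF that]
      by (intro compact_continuous_image continuous_on_subset[OF wcont[OF that]]) auto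
    show "C k \<subseteq> frontier (body x)" if "k \<in> I" for k
      unfolding C_def using wfr[OF that] sub[OF that] by auto
    show "C i \<inter> C j = {}" if "i \<in> I" "j \<in> I" "i \<noteq> j" for i j
    proof -
      have "i < n" "j < n" using that by (auto simp: I_def)
      then have "cone (m i) (m (Suc i)) \<inter> cone (m j) (m (Suc j)) = {}"
        using cones_disjoint[OF n, of i j c] cones_disjoint[OF n, of j i c] that(3)
        unfolding m_def by (metis inf_commute linorder_neqE_nat)
      then show ?thesis using Ccone that by blast
    qed
    show "\<bar>y \<bullet> tng (m k) - z \<bullet> tng (m k)\<bar> \<le> dist y z" for k y z
      using abs_inner_tng_le[of "y - z" "m k"] by (simp add: inner_diff_left dist_norm)
    show "{F k (\<epsilon> k)..F k (1 - \<epsilon> k)} \<subseteq> (\<lambda>y. y \<bullet> tng (m k)) ` C k" if "k \<in> I" for k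
    proof
      fix q assume q: "q \<in> {F k (\<epsilon> k)..F k (1 - \<epsilon> k)}"
      have "\<exists>r. \<epsilon> k \<le> r \<and> r \<le> 1 - \<epsilon> k \<and> F k r = q"
        using q \<epsilon>[OF that] by (intro IVT' continuous_on_subset[OF Fcont[OF that] sub[OF that]]) auto
      then show "q \<in> (\<lambda>y. y \<bullet> tng (m k)) ` C k" by (auto simp: F_def C_def)
    qed
    show "F k (\<epsilon> k) \<le> F k (1 - \<epsilon> k)" if "k \<in> I" for k using \<epsilon>[OF that] by blast
  qed
  moreover have fin: "hausdorff1 (frontier (body x)) < top"
    using le_less_trans[OF hausdorff1_frontier_le[of 0]] by (simp add: less_top)
  ultimately have "(\<Sum>k\<in>I. F k (1 - \<epsilon> k) - F k (\<epsilon> k)) \<le> enn2real (hausdorff1 (frontier (body x)))"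
    by (metis ennreal_enn2real ennreal_le_iff enn2real_nonneg)
  moreover have "(\<Sum>k<n. d k \<bullet> tng (m k)) \<le> (\<Sum>k\<in>I. d k \<bullet> tng (m k))"
  proof -
    have "(\<Sum>k<n. d k \<bullet> tng (m k)) = (\<Sum>k\<in>I. d k \<bullet> tng (m k)) + (\<Sum>k\<in>{..<n} - I. d k \<bullet> tng (m k))"
      by (subst add.commute) (rule sum.subset_diff, auto simp: I_def)
    moreover have "(\<Sum>k\<in>{..<n} - I. d k \<bullet> tng (m k)) \<le> 0"
      by (rule sum_nonpos) (auto simp: I_def)
    ultimately show ?thesis by simp
  qed
  moreover have "(\<Sum>k\<in>I. d k \<bullet> tng (m k)) \<le> (\<Sum>k\<in>I. (F k (1 - \<epsilon> k) - F k (\<epsilon> k)) + e / n)"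
    using \<epsilon> by (intro sum_mono) force
  moreover have "(\<Sum>k\<in>I. (F k (1 - \<epsilon> k) - F k (\<epsilon> k)) + e / n)
      \<le> (\<Sum>k\<in>I. F k (1 - \<epsilon> k) - F k (\<epsilon> k)) + e"
  proof -
    have "card I \<le> n" using card_mono[of "{..<n}" I] by (auto simp: I_def)
    then have "real (card I) * (e / n) \<le> real n * (e / n)" using e by (intro mult_right_mono) auto
    then show ?thesis using n by (simp add: sum.distrib)
  qed
  ultimately show "(\<Sum>k<n. (x (m (Suc k)) - x (m k)) \<bullet> tng (m k)) \<le> enn2real (hausdorff1 (frontier (body x))) + e"
    unfolding d_def by linarith
qed

lemma chord_ge:
  assumes "s \<le> t" "t \<le> s + 1"
  shows "(tco x t - tco x s) + supp x s * (t - s) - 2 * b * (t - s)\<^sup>2 \<le> (x t - x s) \<bullet> tng s"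
proof -
  note b = b_pos
  define h where "h = t - s"
  have h: "0 \<le> h" "h \<le> 1" using assms by (auto simp: h_def)
  have eq: "(x t - x s) \<bullet> tng s = supp x t * sin h + tco x t * cos h - tco x s"
    using inner_tng_rotate[of "x t" s t] cos_minus[of h] sin_minus[of h] by (simp add: h_def inner_diff_left)
  have 1: "supp x s * h - b * h * h \<le> supp x t * h"
  proof -
    have "(supp x s - b * h) * h \<le> supp x t * h"
      using supp_lipschitz[of t s] h by (intro mult_right_mono) (auto simp: h_def abs_le_iff)
    then show ?thesis by (simp add: algebra_simps)
  qed
  have 2: "supp x t * (h - sin h) \<le> b * (h\<^sup>2 / 2)"
    using turningD(4)[OF T, of t] b sin_ge[OF h] sin_x_le_x[OF h(1)] by (intro mult_mono) auto
  have 3: "tco x t * (1 - cos h) \<le> b * (h\<^sup>2 / 2)"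
    using abs_tco_le[of t] b one_minus_cos_le[of h] by (intro mult_mono) (auto simp: abs_le_iff)
  show ?thesis
    unfolding eq using 1 2 3 unfolding h_def[symmetric] by (simp add: algebra_simps power2_eq_square)
qed

lemma eventually_mesh_small:
  assumes "0 < \<eta>"
  obtains N :: nat where "\<And>n. n \<ge> N \<Longrightarrow> 0 < n \<and> 2 * pi / real n \<le> \<eta>"
proof -
  obtain N :: nat where N: "2 * pi / \<eta> < real N" using reals_Archimedean2 by blast
  have "0 < n \<and> 2 * pi / real n \<le> \<eta>" if "n \<ge> Suc N" for n
  proof -
    have "2 * pi / \<eta> \<le> real n" using that N by linarith
    then show ?thesis using that assms by (simp add: field_simps)
  qed
  then show ?thesis using that by blast
qed

theorem perimeter_body: "perimeter (body x) = integral {c..c + 2 * pi} (supp x)"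
proof -
  let ?I = "integral {c..c + 2 * pi} (supp x)" and ?H = "hausdorff1 (frontier (body x))"
  have I0: "0 \<le> ?I"
    using supp_pos by (intro integral_nonneg integrable_supp) (auto intro: less_imp_le)
  have le: "enn2real ?H \<le> ?I"
    using hausdorff1_frontier_le I0 by (intro enn2real_leI)
  obtain N where N: "\<And>n. n \<ge> N \<Longrightarrow> 0 < n \<and> 2 * pi / real n \<le> order_gap"
    using eventually_mesh_small[OF order_gap(1)] by blast
  have "?I - 3 * b * (2 * pi) * (2 * pi) / real n \<le> enn2real ?H" if "n \<ge> N" for n
  proof -
    let ?m = "mesh c (c + 2 * pi) n"
    have n: "0 < n" "2 * pi / real n \<le> order_gap" using N[OF that] by auto
    have "(\<Sum>k<n. - ((x (?m (Suc k)) - x (?m k)) \<bullet> tng (?m k))) \<le> - peri c (c + 2 * pi) - - peri c c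
        + 3 * b * (c + 2 * pi - c) * ((c + 2 * pi - c) + (0 - 0)) / real n"
    proof (rule mesh_sum_le[where \<eta> = "order_gap" and A = "\<lambda>s t. - ((x t - x s) \<bullet> tng s)"
          and \<Phi> = "\<lambda>t. - peri c t" and g = "\<lambda>_. 0"])
      fix s t assume st: "c \<le> s" "s \<le> t" "t \<le> c + 2 * pi" "t \<le> s + order_gap"
      have "t \<le> s + 1" using st order_gap(2) by linarith
      from chord_ge[OF st(2) this] peri_approx[OF st(1,2)]
      show "- ((x t - x s) \<bullet> tng s) \<le> - peri c t - - peri c s + 3 * b * ((t - s) * ((t - s) + (0 - 0)))"
        by (simp add: abs_le_iff power2_eq_square)
    qed (use n in auto)
    then have "peri c (c + 2 * pi) - peri c c - 3 * b * (2 * pi) * (2 * pi) / real n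
        \<le> (\<Sum>k<n. (x (?m (Suc k)) - x (?m k)) \<bullet> tng (?m k))"
      by (simp add: sum_negf)
    also have "\<dots> \<le> enn2real ?H" by (rule chord_sum_le[OF n])
    finally show ?thesis unfolding peri_period .
  qed
  then have "?I \<le> enn2real ?H" by (rule ge_of_ge_minus_inverse)
  with le show ?thesis by (simp add: perimeter_def)
qed

section \<open>The area as an integral\<close>

lemma body_lmeasurable: "body x \<in> lmeasurable"
  using body_convex body_compact compact_imp_bounded by (intro measurable_convex) auto

text \<open>The ray from the origin through a boundary point of a cell crosses the corner of that cell, so the triangles over the sides of
  the corners cover the body.\<close>

lemma area_le_triangles:
  fixes c :: real
  assumes n: "0 < n" "2 * pi / real n \<le> order_gap"
  defines "m \<equiv> mesh c (c + 2 * pi) n"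
  shows "area (body x) \<le> (\<Sum>k<n. (sideL (m k) (m (Suc k)) * supp x (m k)
           + sideR (m k) (m (Suc k)) * supp x (m (Suc k))) / 2)"
proof -
  define A where "A k = tri (x (m k)) (x (m k) + sideL (m k) (m (Suc k)) *\<^sub>R tng (m k))" for k
  define B where "B k = tri (x (m (Suc k)) + sideR (m k) (m (Suc k)) *\<^sub>R (- tng (m (Suc k)))) (x (m (Suc k)))" for k
  have gap: "order_gap < pi" using order_gap(2) pi_gt3 by linarith
  have step: "m k < m (Suc k)" "m (Suc k) < m k + pi" "m (Suc k) - m k \<le> order_gap" for k
    using n gap by (simp_all add: m_def mesh_Suc)
  have meas: "A k \<union> B k \<in> lmeasurable" for k
    unfolding A_def B_def by (intro fmeasurable.Un tri_measure)
  have mA: "measure lebesgue (A k \<union> B k) \<le> (sideL (m k) (m (Suc k)) * supp x (m k)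
           + sideR (m k) (m (Suc k)) * supp x (m (Suc k))) / 2" for k
  proof -
    have "measure lebesgue (A k \<union> B k) \<le> measure lebesgue (A k) + measure lebesgue (B k)"
      unfolding A_def B_def by (intro measure_Un_le fmeasurableD tri_measure)
    also have "\<dots> = \<bar>sideL (m k) (m (Suc k)) * supp x (m k)\<bar> / 2
           + \<bar>sideR (m k) (m (Suc k)) * supp x (m (Suc k))\<bar> / 2"
      unfolding A_def B_def tri_measure by (simp add: cross2_simps cross2_tng)
    finally show ?thesis
      using sides_nonneg[OF step(1,2)] supp_pos by (simp add: abs_mult add_divide_distrib less_imp_le)
  qed
  have cover: "body x \<subseteq> (\<Union>k<n. A k \<union> B k)"
  proof
    fix y assume y: "y \<in> body x"
    show "y \<in> (\<Union>k<n. A k \<union> B k)"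
    proof (cases "y = 0")
      case True
      then have "y \<in> A 0" unfolding A_def tri_def by force
      then show ?thesis using n by blast
    next
      case False
      define g where "g = pgauge y"
      have g: "0 < g" "g \<le> 1"
        using pgauge_pos[OF False] y body_iff_pgauge by (auto simp: g_def)
      define z where "z = (1 / g) *\<^sub>R y"
      have "pgauge z = 1" using g pgauge_scale[of "1 / g" y] by (simp add: z_def g_def)
      then have zf: "z \<in> frontier (body x)" by (rule pgauge_1_frontier)
      have "2 * pi / real n < pi" using n gap by linarith
      then obtain k r where k: "k < n" and z: "z \<in> cell (m k) (m (Suc k))"
        using cells_cover_frontier[OF zf n(1), of c] unfolding m_def by blast
      define h where "h = m (Suc k) - m k"
      have h: "0 \<le> h" "h \<le> order_gap" using step[of k] by (auto simp: h_def)
      note trig = order_gap_trig[OF h]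
      have b: "0 < b" by (rule b_pos)
      have sh: "0 \<le> sin h" using h gap by (intro sin_ge_zero) auto
      have "0 < a * (1 / 2)" using a0 by simp
      also have "a * (1 / 2) \<le> a * cos h" using trig(1) a0 by (intro mult_left_mono) auto
      finally have ac: "0 < a * cos h" .
      have supc: "a * cos h \<le> supp x t * cos h" for t
        using turningD(3)[OF T, of t] trig(1) by (intro mult_right_mono) auto
      have tcs: "\<bar>tco x t * sin h\<bar> \<le> b * sin h" for t
        unfolding abs_mult using abs_tco_le[of t] sh by (intro mult_mono) auto
      have pos: "0 < x (m k) \<bullet> nrm (m (Suc k))" "0 < x (m (Suc k)) \<bullet> nrm (m k)"
      proof -
        show "0 < x (m k) \<bullet> nrm (m (Suc k))"
          using inner_nrm_rotate[of "x (m k)" "m (Suc k)" "m k"] supc[of "m k"] tcs[of "m k"] trig(2) ac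
          unfolding h_def[symmetric] abs_le_iff by linarith
        show "0 < x (m (Suc k)) \<bullet> nrm (m k)"
          using inner_nrm_rotate[of "x (m (Suc k))" "m k" "m (Suc k)"] supc[of "m (Suc k)"] tcs[of "m (Suc k)"] trig(2) ac
            cos_minus[of h] sin_minus[of h]
          unfolding h_def minus_diff_eq abs_le_iff by simp
      qed
      then have e: "0 < z \<bullet> nrm (m k)" "0 < z \<bullet> nrm (m (Suc k))"
        using z unfolding cell_def by (auto intro: less_le_trans)
      have yz: "y = (g / (1 + r)) *\<^sub>R (z + r *\<^sub>R z)" if "0 \<le> r" for r
      proof -
        have "z + r *\<^sub>R z = (1 + r) *\<^sub>R z" by (simp add: algebra_simps)
        then show ?thesis using that g by (simp add: z_def)
      qed
      have kap: "0 \<le> g / (1 + r)" "g / (1 + r) \<le> 1" if "0 \<le> r" for r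
        using that g by (auto simp: field_simps)
      show ?thesis
      proof (rule cell_ray[OF step(1,2) z e])
        fix r q assume *: "0 \<le> r" "0 \<le> q" "q \<le> sideL (m k) (m (Suc k))" "z + r *\<^sub>R z = x (m k) + q *\<^sub>R tng (m k)"
        have "y \<in> A k"
          unfolding A_def by (subst yz[OF *(1)], subst *(4)) (rule tri_mem[OF kap[OF *(1)] *(2,3)])
        then show ?thesis using k by blast
      next
        fix r q assume *: "0 \<le> r" "0 \<le> q" "q \<le> sideR (m k) (m (Suc k))" "z + r *\<^sub>R z = x (m (Suc k)) - q *\<^sub>R tng (m (Suc k))"
        have eqR: "z + r *\<^sub>R z = x (m (Suc k)) + q *\<^sub>R (- tng (m (Suc k)))" using *(4) by simp
        have "y \<in> B k"
          unfolding B_def by (subst yz[OF *(1)], subst eqR) (rule tri_mem[OF kap[OF *(1)] *(2,3)])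
        then show ?thesis using k by blast
      qed
    qed
  qed
  have "area (body x) \<le> measure lebesgue (\<Union>k<n. A k \<union> B k)"
    unfolding area_def using body_lmeasurable meas cover by (intro measure_mono_fmeasurable fmeasurable.finite_UN) auto
  also have "\<dots> \<le> (\<Sum>k<n. measure lebesgue (A k \<union> B k))"
    by (rule measure_UNION_le) (use meas in auto)
  also have "\<dots> \<le> (\<Sum>k<n. (sideL (m k) (m (Suc k)) * supp x (m k)
           + sideR (m k) (m (Suc k)) * supp x (m (Suc k))) / 2)"
    by (intro sum_mono mA)
  finally show ?thesis .
qed

lemma triangles_le_area:
  fixes c :: real
  assumes n: "0 < n" "2 * pi / real n \<le> order_gap"
  defines "m \<equiv> mesh c (c + 2 * pi) n"
  shows "(\<Sum>k<n. cross2 (x (m k)) (x (m (Suc k))) / 2) \<le> area (body x)"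
proof -
  let ?cr = "\<lambda>k. cross2 (x (m k)) (x (m (Suc k)))"
  define I where "I = {k. k < n \<and> 0 < ?cr k}"
  define Tk where "Tk k = otri (x (m k)) (x (m (Suc k)))" for k
  have fin: "finite I" by (simp add: I_def)
  have step: "m i \<le> m (Suc i)" "m (Suc i) \<le> m i + order_gap" for i
    using n by (auto simp: m_def mesh_Suc)
  have sub: "Tk k \<subseteq> body x" for k
  proof
    fix y assume "y \<in> Tk k"
    then obtain u v where uv: "0 < u" "0 < v" "u + v < 1" "y = u *\<^sub>R x (m k) + v *\<^sub>R x (m (Suc k))"
      unfolding Tk_def otri_def by blast
    have "y \<bullet> nrm t \<le> supp x t" for t
    proof -
      have "y \<bullet> nrm t = u * (x (m k) \<bullet> nrm t) + v * (x (m (Suc k)) \<bullet> nrm t)" using uv by (simp add: inner_add_left)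
      also have "\<dots> \<le> u * supp x t + v * supp x t"
        using uv turningD(2)[OF T] by (intro add_mono mult_left_mono) auto
      also have "\<dots> = (u + v) * supp x t" by (simp add: algebra_simps)
      also have "\<dots> \<le> 1 * supp x t" using uv supp_pos[of t] by (intro mult_right_mono) auto
      finally show ?thesis by simp
    qed
    then show "y \<in> body x" by (simp add: body_def)
  qed
  have cone: "Tk k \<subseteq> cone (m k) (m (Suc k))" if "k \<in> I" for k
  proof
    fix y assume "y \<in> Tk k"
    then obtain u v where uv: "0 < u" "0 < v" "y = u *\<^sub>R x (m k) + v *\<^sub>R x (m (Suc k))"
      unfolding Tk_def otri_def by blast
    then show "y \<in> cone (m k) (m (Suc k))"
      using that by (simp add: cone_def cross2_simps I_def)
  qed
  have "disjnt (Tk i) (Tk j)" if "i \<in> I" "j \<in> I" "i \<noteq> j" for i j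
  proof -
    have "i < n" "j < n" using that by (auto simp: I_def)
    then have "cone (m i) (m (Suc i)) \<inter> cone (m j) (m (Suc j)) = {}"
      using cones_disjoint[OF n, of i j c] cones_disjoint[OF n, of j i c] that(3)
      unfolding m_def by (metis inf_commute linorder_neqE_nat)
    then show ?thesis using cone that unfolding disjnt_def by blast
  qed
  then have "measure lebesgue (\<Union>k\<in>I. Tk k) = (\<Sum>k\<in>I. measure lebesgue (Tk k))"
    using fin by (intro measure_UNION') (auto simp: Tk_def tri_measure pairwise_def)
  also have "\<dots> = (\<Sum>k\<in>I. ?cr k / 2)"
    by (intro sum.cong) (auto simp: Tk_def tri_measure I_def)
  finally have eq: "measure lebesgue (\<Union>k\<in>I. Tk k) = (\<Sum>k\<in>I. ?cr k / 2)" .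
  have "(\<Sum>k<n. ?cr k / 2) = (\<Sum>k\<in>{..<n} - I. ?cr k / 2) + (\<Sum>k\<in>I. ?cr k / 2)"
    by (rule sum.subset_diff) (auto simp: I_def)
  moreover have "(\<Sum>k\<in>{..<n} - I. ?cr k / 2) \<le> 0"
    by (rule sum_nonpos) (auto simp: I_def)
  moreover have "measure lebesgue (\<Union>k\<in>I. Tk k) \<le> area (body x)"
    unfolding area_def using sub fin body_lmeasurable
    by (intro measure_mono_fmeasurable fmeasurableD[OF fmeasurable.finite_UN]) (auto simp: Tk_def tri_measure)
  ultimately show ?thesis using eq by linarith
qed

lemma sweep_diff: "c \<le> s \<Longrightarrow> s \<le> t \<Longrightarrow> sweep c t - sweep c s = sweep s t"
  using sweep_add[of c s t] by simp

lemma corner_area_le: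
  assumes st: "s \<le> t" "t \<le> s + 1"
  shows "sideL s t * supp x s + sideR s t * supp x t \<le> sweep s t
     + ((6 * b\<^sup>2 + b) + 2 * b\<^sup>2 + b * (1 + b)) * ((t - s) * ((t - s) + (arcm b x t - arcm b x s)))"
proof (cases "s = t")
  case True
  then show ?thesis by (simp add: sideL_def sideR_def sweep_def)
next
  case False
  note b = b_pos
  define h where "h = t - s"
  define dm where "dm = tco x t - tco x s"
  define dg where "dg = arcm b x t - arcm b x s"
  define D where "D = h + dg"
  have h: "0 < h" "h \<le> 1" using st False by (auto simp: h_def)
  have dg: "0 \<le> dg" "dg = dm + 2 * b * h"
    using arcm_mono[OF st(1)] by (auto simp: dg_def dm_def h_def arcm_def algebra_simps)
  have hD: "h * h \<le> h * D" using h dg by (simp add: D_def)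
  have lt: "s < t" "t < s + pi" using False st pi_gt3 by linarith+
  note nonneg = sides_nonneg[OF lt]
  let ?L = "sideL s t" and ?R = "sideR s t"
  have LR: "?L + ?R \<le> dm + supp x s * h + 2 * b * h\<^sup>2"
    using sides_le[OF lt(1) st(2)] by (simp add: h_def dm_def)
  have LR': "?L + ?R \<le> (1 + b) * D"
  proof -
    have "supp x s * h \<le> b * h" using turningD(4)[OF T] h by (intro mult_right_mono) auto
    moreover have "b * h\<^sup>2 \<le> b * h" using h b by (simp add: power2_eq_square mult_left_le)
    moreover have "0 \<le> b * dg" using b dg by simp
    moreover have "(1 + b) * D = h + dg + b * h + b * dg" by (simp add: D_def algebra_simps)
    ultimately have "dm + supp x s * h + 2 * b * h\<^sup>2 \<le> (1 + b) * D"
      using dg(2) h(1) by linarith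
    with LR show ?thesis by linarith
  qed
  have "?L * supp x s + ?R * supp x t = supp x s * (?L + ?R) + ?R * (supp x t - supp x s)"
    by (simp add: algebra_simps)
  also have "\<dots> \<le> supp x s * (dm + supp x s * h + 2 * b * h\<^sup>2) + ((1 + b) * D) * (b * h)"
  proof (rule add_mono)
    show "supp x s * (?L + ?R) \<le> supp x s * (dm + supp x s * h + 2 * b * h\<^sup>2)"
      using LR supp_pos[of s] by (intro mult_left_mono) auto
    have "?R * (supp x t - supp x s) \<le> ?R * (b * h)"
      using supp_lipschitz[of t s] nonneg h by (intro mult_left_mono) (auto simp: h_def abs_le_iff)
    also have "\<dots> \<le> ((1 + b) * D) * (b * h)"
      using LR' nonneg b h by (intro mult_right_mono) auto
    finally show "?R * (supp x t - supp x s) \<le> ((1 + b) * D) * (b * h)" .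
  qed
  also have "\<dots> = supp x s * (dm + supp x s * h) + 2 * b * (supp x s * (h * h)) + b * (1 + b) * (h * D)"
    by (simp add: algebra_simps power2_eq_square)
  also have "\<dots> \<le> (sweep s t + (6 * b\<^sup>2 + b) * (h * D)) + 2 * b * (b * (h * D)) + b * (1 + b) * (h * D)"
  proof (intro add_mono order_refl)
    show "supp x s * (dm + supp x s * h) \<le> sweep s t + (6 * b\<^sup>2 + b) * (h * D)"
      using sweep_approx[OF st(1)] unfolding abs_le_iff h_def dm_def D_def dg_def by linarith
    have "supp x s * (h * h) \<le> b * (h * D)"
      by (rule mult_mono[OF turningD(4)[OF T] hD]) (use b h in auto)
    then show "2 * b * (supp x s * (h * h)) \<le> 2 * b * (b * (h * D))" using b by simp
  qed
  finally show ?thesis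
    unfolding h_def[symmetric] dg_def[symmetric] D_def[symmetric] by (simp add: algebra_simps power2_eq_square)
qed

lemma chord_area_ge:
  assumes st: "s \<le> t" "t \<le> s + order_gap"
  shows "- cross2 (x s) (x t) \<le> - sweep s t
     + ((6 * b\<^sup>2 + b) + 2 * b\<^sup>2 + 2 * b) * ((t - s) * ((t - s) + (arcm b x t - arcm b x s)))"
proof -
  note b = b_pos
  define d where "d = x t - x s"
  define h where "h = t - s"
  define dm where "dm = tco x t - tco x s"
  define dg where "dg = arcm b x t - arcm b x s"
  define D where "D = h + dg"
  have h: "0 \<le> h" "h \<le> order_gap" "h \<le> 1" using st order_gap(2) by (auto simp: h_def)
  have dg: "0 \<le> dg" "dg = dm + 2 * b * h"
    using arcm_mono[OF st(1)] by (auto simp: dg_def dm_def h_def arcm_def algebra_simps)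
  have hD: "h * h \<le> h * D" "h * dg \<le> h * D" 
    using h mult_nonneg_nonneg[OF h(1) dg(1)] by (auto simp: D_def distrib_left)
  note c = cross2_curve[OF st, folded d_def]
  have lo: "dm + supp x s * h - 2 * b * (h * h) \<le> d \<bullet> tng s"
    using chord_ge[OF st(1)] h unfolding h_def dm_def d_def by (simp add: power2_eq_square)
  have up: "d \<bullet> tng s \<le> dg"
  proof -
    have eq: "d \<bullet> tng s = supp x t * sin h + tco x t * cos h - tco x s"
      using inner_tng_rotate[of "x t" s t] cos_minus[of h] sin_minus[of h]
      by (simp add: d_def h_def inner_diff_left)
    have "supp x t * sin h \<le> b * h"
      using turningD(4)[OF T, of t] b h sin_x_le_x[OF h(1)] supp_pos[of t] sin_ge_zero[of h] pi_gt3
      by (intro mult_mono) auto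
    moreover have "- tco x t * (1 - cos h) \<le> b * (h\<^sup>2 / 2)"
      using abs_tco_le[of t] b one_minus_cos_le[of h] by (intro mult_mono) (auto simp: abs_le_iff)
    moreover have "b * (h\<^sup>2 / 2) \<le> b * h" using h b mult_left_le[of h h] by (simp add: power2_eq_square)
    ultimately show ?thesis unfolding eq dg(2) dm_def by (simp add: algebra_simps)
  qed
  have n1: "- (d \<bullet> nrm s) \<le> 2 * (h * dg)"
  proof -
    have "- (d \<bullet> nrm s) * (1 / 2) \<le> - (d \<bullet> nrm s) * cos h"
      using c(3) order_gap_trig(1)[OF h(1,2)] by (intro mult_left_mono) auto
    also have "\<dots> \<le> (d \<bullet> tng s) * sin h" using c(2) by (simp add: h_def)
    also have "\<dots> \<le> dg * h"
      using up c(1) sin_x_le_x[OF h(1)] h sin_ge_zero[of h] pi_gt3 by (intro mult_mono) auto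
    finally show ?thesis by (simp add: mult.commute)
  qed
  have "x t = x s + d" by (simp add: d_def)
  then have "cross2 (x s) (x t) = cross2 (x s) d" by (simp add: cross2_simps)
  also have "\<dots> = supp x s * (d \<bullet> tng s) - tco x s * (d \<bullet> nrm s)" by (rule cross2_frame)
  finally have cr: "cross2 (x s) (x t) = supp x s * (d \<bullet> tng s) + tco x s * (- (d \<bullet> nrm s))" by simp
  have 1: "supp x s * (dm + supp x s * h) - 2 * b * (supp x s * (h * h)) \<le> supp x s * (d \<bullet> tng s)"
    using mult_left_mono[OF lo, of "supp x s"] supp_pos[of s] by (simp add: algebra_simps)
  have 2: "supp x s * (h * h) \<le> b * (h * D)"
    by (rule mult_mono[OF turningD(4)[OF T] hD(1)]) (use b h in auto)
  have "\<bar>tco x s * (- (d \<bullet> nrm s))\<bar> \<le> b * (2 * (h * dg))"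
    unfolding abs_mult using abs_tco_le[of s] n1 c(3) b by (intro mult_mono) auto
  moreover have "b * (2 * (h * dg)) \<le> b * (2 * (h * D))"
    by (rule mult_left_mono) (use hD b in auto)
  ultimately have 3: "- (2 * b * (h * D)) \<le> tco x s * (- (d \<bullet> nrm s))"
    unfolding abs_le_iff by linarith
  have 4: "sweep s t - (6 * b\<^sup>2 + b) * (h * D) \<le> supp x s * (dm + supp x s * h)"
    using sweep_approx[OF st(1)] unfolding abs_le_iff h_def dm_def D_def dg_def by linarith
  have 5: "2 * b * (supp x s * (h * h)) \<le> 2 * b * (b * (h * D))" using 2 b by simp
  have "- cross2 (x s) (x t) \<le> - sweep s t + ((6 * b\<^sup>2 + b) * (h * D) + 2 * b * (b * (h * D)) + 2 * b * (h * D))"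
    unfolding cr using 1 3 4 5 by linarith
  also have "\<dots> = - sweep s t + ((6 * b\<^sup>2 + b) + 2 * b\<^sup>2 + 2 * b) * (h * D)"
    by (simp add: algebra_simps power2_eq_square)
  finally show ?thesis by (simp add: h_def D_def dg_def)
qed

theorem area_body: "area (body x) = integral {c..c + 2 * pi} (\<lambda>t. (supp x t)\<^sup>2 - (tco x t)\<^sup>2) / 2"
proof -
  let ?A = "2 * area (body x)" and ?S = "sweep c (c + 2 * pi)"
  define G where "G = 2 * pi + (arcm b x (c + 2 * pi) - arcm b x c)"
  define C1 where "C1 = ((6 * b\<^sup>2 + b) + 2 * b\<^sup>2 + b * (1 + b))"
  define C2 where "C2 = ((6 * b\<^sup>2 + b) + 2 * b\<^sup>2 + 2 * b)"
  obtain N where N: "\<And>n. n \<ge> N \<Longrightarrow> 0 < n \<and> 2 * pi / real n \<le> order_gap"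
    using eventually_mesh_small[OF order_gap(1)] by blast
  have S0: "sweep c c = 0" by (simp add: sweep_def)
  have "?A - C1 * (2 * pi) * G / real n \<le> ?S" if "n \<ge> N" for n
  proof -
    let ?m = "mesh c (c + 2 * pi) n"
    have n: "0 < n" "2 * pi / real n \<le> order_gap" using N[OF that] by auto
    have "?A \<le> (\<Sum>k<n. sideL (?m k) (?m (Suc k)) * supp x (?m k) + sideR (?m k) (?m (Suc k)) * supp x (?m (Suc k)))"
      using area_le_triangles[OF n, of c] by (simp flip: sum_divide_distrib)
    also have "\<dots> \<le> sweep c (c + 2 * pi) - sweep c c
        + C1 * (c + 2 * pi - c) * ((c + 2 * pi - c) + (arcm b x (c + 2 * pi) - arcm b x c)) / real n"
    proof (rule mesh_sum_le[where \<eta> = "order_gap" and \<Phi> = "sweep c" and g = "arcm b x"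
          and A = "\<lambda>s t. sideL s t * supp x s + sideR s t * supp x t"])
      fix s t assume st: "c \<le> s" "s \<le> t" "t \<le> c + 2 * pi" "t \<le> s + order_gap"
      then have "t \<le> s + 1" using order_gap(2) by linarith
      then show "sideL s t * supp x s + sideR s t * supp x t \<le> sweep c t - sweep c s
          + C1 * ((t - s) * ((t - s) + (arcm b x t - arcm b x s)))"
        using corner_area_le[OF st(2)] unfolding C1_def sweep_diff[OF st(1,2)] by simp
    qed (use n in auto)
    finally show ?thesis unfolding S0 G_def by simp
  qed
  then have up: "?A \<le> ?S" by (rule ge_of_ge_minus_inverse)
  have "?S - C2 * (2 * pi) * G / real n \<le> ?A" if "n \<ge> N" for n
  proof -
    let ?m = "mesh c (c + 2 * pi) n"
    have n: "0 < n" "2 * pi / real n \<le> order_gap" using N[OF that] by auto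
    have "(\<Sum>k<n. - cross2 (x (?m k)) (x (?m (Suc k)))) \<le> - sweep c (c + 2 * pi) - - sweep c c
        + C2 * (c + 2 * pi - c) * ((c + 2 * pi - c) + (arcm b x (c + 2 * pi) - arcm b x c)) / real n"
    proof (rule mesh_sum_le[where \<eta> = "order_gap" and \<Phi> = "\<lambda>t. - sweep c t" and g = "arcm b x"
          and A = "\<lambda>s t. - cross2 (x s) (x t)"])
      fix s t assume st: "c \<le> s" "s \<le> t" "t \<le> c + 2 * pi" "t \<le> s + order_gap"
      have "- sweep c t - - sweep c s = - sweep s t" using sweep_diff[OF st(1,2)] by simp
      then show "- cross2 (x s) (x t) \<le> - sweep c t - - sweep c s
          + C2 * ((t - s) * ((t - s) + (arcm b x t - arcm b x s)))"
        using chord_area_ge[OF st(2,4)] unfolding C2_def by simp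
    qed (use n in auto)
    then have "?S - C2 * (2 * pi) * G / real n \<le> (\<Sum>k<n. cross2 (x (?m k)) (x (?m (Suc k))))"
      unfolding S0 G_def by (simp add: sum_negf)
    also have "\<dots> \<le> ?A"
      using triangles_le_area[OF n, of c] by (simp flip: sum_divide_distrib)
    finally show ?thesis .
  qed
  then have "?S \<le> ?A" by (rule ge_of_ge_minus_inverse)
  moreover have "?S = integral {c..c + 2 * pi} (\<lambda>t. (supp x t)\<^sup>2 - (tco x t)\<^sup>2)"
    using turningD(1)[OF T, of c] by (simp add: sweep_def)
  ultimately show ?thesis using up by simp
qed

end

section \<open>The functional in terms of the support function\<close>

definition dens :: "real \<Rightarrow> (real \<Rightarrow> real^2) \<Rightarrow> real \<Rightarrow> real" where
  "dens lam x t = lam / 2 * ((supp x t)\<^sup>2 - (tco x t)\<^sup>2) - supp x t"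

lemma integrable_dens:
  assumes "turning a b x" "0 < a"
  shows "dens lam x integrable_on {s..t}"
  unfolding dens_def
  by (intro integrable_diff integrable_on_mult_right integrable_quadr[OF assms] integrable_supp[OF assms])

theorem J_body:
  assumes "turning a b x" "0 < a"
  shows "J lam (body x) = integral {c..c + 2 * pi} (dens lam x)"
proof -
  have "integral {c..c + 2 * pi} (dens lam x)
      = lam / 2 * integral {c..c + 2 * pi} (\<lambda>t. (supp x t)\<^sup>2 - (tco x t)\<^sup>2) - integral {c..c + 2 * pi} (supp x)"
    unfolding dens_def
    by (intro integral_unique has_integral_diff has_integral_mult_right integrable_integral
        integrable_quadr[OF assms] integrable_supp[OF assms])
  then show ?thesis
    by (simp add: J_def area_body[OF assms, of c] perimeter_body[OF assms, of c])
qed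

lemma integral_minus_const:
  fixes f :: "real \<Rightarrow> real"
  assumes "f integrable_on {0..2 * pi}"
  shows "integral {0..2 * pi} (\<lambda>t. f t - q) = integral {0..2 * pi} f - 2 * pi * q"
proof -
  have "((\<lambda>_. q) has_integral 2 * pi * q) {0..2 * pi}"
    using has_integral_const_real[of q 0 "2 * pi"] by simp
  then show ?thesis
    by (intro integral_unique has_integral_diff integrable_integral assms)
qed

lemma integral_nonpos_imp_zero:
  fixes f :: "real \<Rightarrow> real"
  assumes "continuous_on {l..r} f" "l < r" "\<And>t. t \<in> {l..r} \<Longrightarrow> 0 \<le> f t" "integral {l..r} f \<le> 0" "t \<in> {l..r}"
  shows "f t = 0"
proof -
  have "0 \<le> integral {l..r} f"
    by (rule integral_nonneg) (use assms integrable_continuous_real in auto)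
  then show ?thesis using integral_eq_0_iff[OF assms(1-3)] assms(4,5) by auto
qed

subsection \<open>Discs\<close>

lemma turning_disc:
  assumes "a \<le> r" "r \<le> b" "0 \<le> r"
  shows "turning a b (\<lambda>t. r *\<^sub>R nrm t)"
  using assms unfolding turning_def by (simp add: nrm_inner_nrm mult_left_le)

lemma body_eq_cball:
  assumes "\<And>t. supp x t = r"
  shows "body x = cball 0 r"
proof -
  have "(\<forall>t. y \<bullet> nrm t \<le> r) \<longleftrightarrow> norm y \<le> r" for y
  proof
    assume *: "\<forall>t. y \<bullet> nrm t \<le> r"
    obtain t where t: "y = norm y *\<^sub>R nrm t" by (rule polar_form[of 0 y])
    then have "y \<bullet> nrm t = norm y" by (metis inner_scaleR_left nrm_inner_nrm cos_zero diff_self mult.right_neutral)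
    with * show "norm y \<le> r" by metis
  next
    assume "norm y \<le> r"
    then show "\<forall>t. y \<bullet> nrm t \<le> r" using abs_inner_nrm_le[of y] by (smt (verit))
  qed
  then show ?thesis using assms by (auto simp: body_def)
qed

lemma J_disc:
  assumes "0 < r"
  shows "J lam (cball 0 r) = 2 * pi * (lam / 2 * r\<^sup>2 - r)"
proof -
  have T: "turning r r (\<lambda>t. r *\<^sub>R nrm t)" using assms by (intro turning_disc) auto
  have "cball 0 r = body (\<lambda>t. r *\<^sub>R nrm t)"
    by (rule body_eq_cball[symmetric]) (simp add: nrm_inner_nrm)
  then have "J lam (cball 0 r) = integral {0..0 + 2 * pi} (dens lam (\<lambda>t. r *\<^sub>R nrm t))"
    by (simp only: J_body[OF T assms, of lam 0])
  also have "dens lam (\<lambda>t. r *\<^sub>R nrm t) = (\<lambda>_. lam / 2 * r\<^sup>2 - r)"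
    by (auto simp: dens_def nrm_inner_nrm nrm_inner_tng)
  finally show ?thesis by simp
qed

lemma disc_in_class: "a \<le> r \<Longrightarrow> r \<le> b \<Longrightarrow> cball 0 r \<in> convex_class a b"
  by (auto simp: convex_class_def subset_iff)

lemma supp_const:
  assumes "turning a b x" "\<And>t. t \<in> {0..2 * pi} \<Longrightarrow> supp x t = r"
  shows "supp x t = r"
proof -
  obtain k where k: "0 \<le> t - 2 * pi * of_int k" "t - 2 * pi * of_int k < 0 + 2 * pi"
    by (rule exists_shift_into_period)
  have "supp x (t - 2 * pi * of_int k + 2 * pi * of_int k) = supp x (t - 2 * pi * of_int k)"
    by (rule periodic_shift_int) (simp add: turningD(1)[OF assms(1)])
  then show ?thesis using assms(2)[of "t - 2 * pi * of_int k"] k by simp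
qed

text \<open>The radial bound \<open>tco\<^sup>2 \<le> b\<^sup>2 - supp\<^sup>2\<close> makes the integrand exceed that of the large disc by at least
  \<open>(b - supp) (1 - lam (b + supp))\<close>.\<close>

lemma small_lambda_disc:
  assumes T: "turning a b x" and a0: "0 < a" and lam: "0 \<le> lam" "lam \<le> 1 / (2 * b)"
    and J: "J lam (body x) \<le> J lam (cball 0 b)"
  shows "body x = cball 0 b"
proof -
  note b = b_pos[OF T a0]
  let ?f = "\<lambda>t. (b - supp x t)\<^sup>2 / (2 * b)"
  have ptw: "?f t \<le> dens lam x t - (lam / 2 * b\<^sup>2 - b)" for t
  proof -
    let ?p = "supp x t"
    have p: "0 \<le> b - ?p" "0 < ?p" using turningD(4)[OF T, of t] supp_pos[OF T a0, of t] by auto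
    have "lam * (b + ?p) \<le> 1 / (2 * b) * (b + ?p)"
      using lam p b by (intro mult_right_mono) auto
    then have "(b - ?p) / (2 * b) \<le> 1 - lam * (b + ?p)" using b by (simp add: field_simps)
    then have "(b - ?p) * ((b - ?p) / (2 * b)) \<le> (b - ?p) * (1 - lam * (b + ?p))"
      using p by (intro mult_left_mono) auto
    moreover have "lam / 2 * ((tco x t)\<^sup>2) \<le> lam / 2 * (b\<^sup>2 - ?p\<^sup>2)"
      using tco_sq_le[OF T a0, of t] lam by (intro mult_left_mono) auto
    ultimately show ?thesis
      unfolding dens_def by (simp add: power2_eq_square algebra_simps)
  qed
  have cont: "continuous_on {0..2 * pi} ?f"
    using b by (intro continuous_intros continuous_supp[OF T a0]) auto
  have "integral {0..2 * pi} ?f \<le> integral {0..2 * pi} (\<lambda>t. dens lam x t - (lam / 2 * b\<^sup>2 - b))"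
    by (intro integral_le ptw integrable_diff integrable_dens[OF T a0] integrable_continuous_real cont) auto
  also have "\<dots> = J lam (body x) - J lam (cball 0 b)"
    using J_body[OF T a0, of lam 0] J_disc[OF b, of lam]
    by (simp add: integral_minus_const integrable_dens[OF T a0])
  finally have "integral {0..2 * pi} ?f \<le> 0" using J by simp
  then have "?f t = 0" if "t \<in> {0..2 * pi}" for t
    using that b by (intro integral_nonpos_imp_zero[OF cont]) auto
  then have "supp x t = b" if "t \<in> {0..2 * pi}" for t using that b by simp
  then show ?thesis using supp_const[OF T] body_eq_cball by blast
qed

text \<open>Over a full period the boundary terms in \<open>sweep_ge_length\<close> cancel, and the area is at least \<open>a/2\<close> times the perimeter.\<close>

lemma large_lambda_disc:
  assumes T: "turning a b x" and a0: "0 < a" and lam: "2 / a < lam"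
    and J: "J lam (body x) \<le> J lam (cball 0 a)"
  shows "body x = cball 0 a"
proof -
  let ?P = "integral {0..2 * pi} (supp x)" and ?Q = "integral {0..2 * pi} (\<lambda>t. (supp x t)\<^sup>2 - (tco x t)\<^sup>2)"
  have l2: "2 < lam * a" using lam a0 by (simp add: field_simps)
  have lam0: "0 < lam" using lam a0 by (meson divide_pos_pos less_trans zero_less_numeral)
  have per: "x (2 * pi) = x 0" using turningD(1)[OF T, of 0] by simp
  have "a * ?P \<le> ?Q"
    using sweep_ge_length[OF T a0, of 0 "2 * pi"] tng_periodic[of 0] nrm_periodic[of 0]
    by (simp add: sweep_def[OF T a0] per)
  then have "lam / 2 * (a * ?P) \<le> lam / 2 * ?Q" using lam0 by simp
  moreover have "J lam (body x) = lam / 2 * ?Q - ?P"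
    using area_body[OF T a0, of 0] perimeter_body[OF T a0, of 0] by (simp add: J_def)
  ultimately have "(lam * a / 2 - 1) * ?P \<le> J lam (body x)" by (simp add: algebra_simps)
  also have "\<dots> \<le> (lam * a / 2 - 1) * (2 * pi * a)"
    using J J_disc[OF a0, of lam] by (simp add: power2_eq_square algebra_simps)
  finally have P: "?P \<le> 2 * pi * a" using l2 by (simp add: mult_le_cancel_left)
  let ?f = "\<lambda>t. supp x t - a"
  have cont: "continuous_on {0..2 * pi} ?f"
    by (intro continuous_intros continuous_supp[OF T a0])
  have "integral {0..2 * pi} ?f = ?P - 2 * pi * a"
    by (rule integral_minus_const[OF integrable_supp[OF T a0]])
  then have "?f t = 0" if "t \<in> {0..2 * pi}" for t
    using that turningD(3)[OF T] P by (intro integral_nonpos_imp_zero[OF cont]) auto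
  then have "supp x t = a" if "t \<in> {0..2 * pi}" for t using that by simp
  then show ?thesis using supp_const[OF T] body_eq_cball by blast
qed

section \<open>Existence of optimal sets\<close>

text \<open>Perimeter and area are monotone under inclusion and homogeneous under dilations.\<close>

lemma compare_scaled:
  assumes X: "turning a b x" and Y: "turning a b y" and a0: "0 < a" and e: "0 \<le> e"
    and le: "\<And>t. supp x t \<le> (1 + e) * supp y t"
  shows "perimeter (body x) \<le> (1 + e) * perimeter (body y)" "area (body x) \<le> (1 + e)\<^sup>2 * area (body y)"
proof -
  define z where "z t = (1 + e) *\<^sub>R y t" for t
  have Z: "turning ((1 + e) * a) ((1 + e) * b) z"
    using Y e unfolding turning_def z_def by (auto intro!: mult_left_mono)
  have a1: "0 < (1 + e) * a" using a0 e by simp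
  have "perimeter (body x) \<le> integral {0..0 + 2 * pi} (\<lambda>t. (1 + e) * supp y t)"
    unfolding perimeter_body[OF X a0, of 0] using le
    by (intro integral_le integrable_supp[OF X a0] integrable_on_mult_right integrable_supp[OF Y a0]) auto
  then show "perimeter (body x) \<le> (1 + e) * perimeter (body y)"
    unfolding perimeter_body[OF Y a0, of 0] by simp
  have "body x \<subseteq> body z"
    unfolding body_def z_def using le by (auto intro: order_trans)
  then have "area (body x) \<le> area (body z)"
    unfolding area_def using body_lmeasurable[OF X a0] body_lmeasurable[OF Z a1]
    by (intro measure_mono_fmeasurable) auto
  also have "area (body z) = (1 + e)\<^sup>2 * area (body y)"
  proof -
    have "(\<lambda>t. (supp z t)\<^sup>2 - (tco z t)\<^sup>2) = (\<lambda>t. (1 + e)\<^sup>2 * ((supp y t)\<^sup>2 - (tco y t)\<^sup>2))"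
      by (simp add: z_def power_mult_distrib right_diff_distrib)
    then show ?thesis unfolding area_body[OF Z a1, of 0] area_body[OF Y a0, of 0] by simp
  qed
  finally show "area (body x) \<le> (1 + e)\<^sup>2 * area (body y)" .
qed

lemma area_body_bounds:
  assumes X: "turning a b x" and a0: "0 < a"
  shows "0 \<le> area (body x)" "area (body x) \<le> area (cball 0 b)"
    "0 \<le> perimeter (body x)" "perimeter (body x) \<le> 2 * pi * b"
proof -
  show "0 \<le> area (body x)" by (simp add: area_def)
  show "area (body x) \<le> area (cball 0 b)"
    unfolding area_def using body_lmeasurable[OF X a0] norm_body_le[OF X]
    by (intro measure_mono_fmeasurable) auto
  show "0 \<le> perimeter (body x)" by (simp add: perimeter_def)
  have "integral {0..0 + 2 * pi} (supp x) \<le> integral {0..0 + 2 * pi} (\<lambda>_. b)"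
    using turningD(4)[OF X] by (intro integral_le integrable_supp[OF X a0]) auto
  then show "perimeter (body x) \<le> 2 * pi * b" unfolding perimeter_body[OF X a0, of 0] by simp
qed

text \<open>Blaschke's selection theorem for the class, via the Arzela-Ascoli theorem for the gauges.  Convergence of the gauges
  is convergence of the bodies up to dilations.\<close>

lemma selection:
  assumes X: "\<And>n. turning a b (X n)" and a0: "0 < a"
  obtains z k where "turning a b z" "strict_mono (k :: nat \<Rightarrow> nat)"
    "\<And>e. 0 < e \<Longrightarrow> \<exists>N. \<forall>n\<ge>N. \<forall>t. supp z t \<le> (1 + e) * supp (X (k n)) t \<and> supp (X (k n)) t \<le> (1 + e) * supp z t"
proof -
  define S :: "(real^2) set" where "S = cball 0 b"
  have b0: "0 < b" by (rule b_pos[OF X a0])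
  have bound: "norm (pgauge (X n) y) \<le> b / a" if "y \<in> S" for n y
  proof -
    have "pgauge (X n) y \<le> norm y / a" by (rule pgauge_le_norm[OF X a0])
    also have "\<dots> \<le> b / a" using that a0 by (intro divide_right_mono) (auto simp: S_def)
    finally show ?thesis using pgauge_nonneg[OF X a0, of n y] by simp
  qed
  have equi: "\<exists>d. 0 < d \<and> (\<forall>n z. z \<in> S \<and> norm (y - z) < d \<longrightarrow> norm (pgauge (X n) y - pgauge (X n) z) < e)"
    if "y \<in> S" "0 < e" for y e
  proof (intro exI conjI allI impI)
    show "0 < e * a" using that a0 by simp
    fix n z assume "z \<in> S \<and> norm (y - z) < e * a"
    then have "norm (y - z) / a < e" using a0 by (simp add: pos_divide_less_eq)
    then show "norm (pgauge (X n) y - pgauge (X n) z) < e"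
      using pgauge_lipschitz[OF X a0, of n y z] by simp
  qed
  obtain g k where g: "continuous_on S g" and k: "strict_mono (k :: nat \<Rightarrow> nat)"
    and conv: "\<And>e. 0 < e \<Longrightarrow> \<exists>N. \<forall>n y. n \<ge> N \<and> y \<in> S \<longrightarrow> norm (pgauge (X (k n)) y - g y) < e"
    using Arzela_Ascoli[of S "\<lambda>n. pgauge (X n)" "b / a", OF _ bound equi] unfolding S_def
    by (metis compact_cball)
  have lim: "(\<lambda>n. pgauge (X (k n)) y) \<longlonglongrightarrow> g y" if "y \<in> S" for y
    unfolding LIMSEQ_iff using conv that by blast
  have gscale: "g (r *\<^sub>R y) = r * g y" if "y \<in> S" "0 \<le> r" "r \<le> 1" for r y
  proof -
    have "norm (r *\<^sub>R y) \<le> 1 * b" unfolding norm_scaleR using that by (intro mult_mono) (auto simp: S_def)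
    then have "r *\<^sub>R y \<in> S" by (simp add: S_def)
    then have "(\<lambda>n. pgauge (X (k n)) (r *\<^sub>R y)) \<longlonglongrightarrow> g (r *\<^sub>R y)" by (rule lim)
    moreover have "(\<lambda>n. r * pgauge (X (k n)) y) \<longlonglongrightarrow> r * g y" by (intro tendsto_intros lim that)
    ultimately show ?thesis using LIMSEQ_unique by (simp add: pgauge_scale[OF X a0 that(2)])
  qed
  define K where "K = {y \<in> S. g y \<le> 1}"
  have "K \<in> convex_class a b"
  proof -
    have "compact K"
    proof -
      have "closed (S \<inter> g -` {..1})"
        using g by (intro continuous_closed_preimage) (auto simp: S_def)
      moreover have "K = S \<inter> g -` {..1}" by (auto simp: K_def)
      moreover have "bounded K" by (rule bounded_subset[of S]) (auto simp: K_def S_def)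
      ultimately show ?thesis by (simp add: compact_eq_bounded_closed)
    qed
    moreover have "convex K"
    proof (rule convexI)
      fix y z u v assume yz: "y \<in> K" "z \<in> K" and uv: "0 \<le> (u::real)" "0 \<le> v" "u + v = 1"
      have S: "y \<in> S" "z \<in> S" "g y \<le> 1" "g z \<le> 1" using yz by (auto simp: K_def)
      have wS: "u *\<^sub>R y + v *\<^sub>R z \<in> S"
        using S uv convexD[OF convex_cball[of 0 b]] by (simp add: S_def)
      have "g (u *\<^sub>R y + v *\<^sub>R z) \<le> u * g y + v * g z"
      proof (rule LIMSEQ_le[OF lim[OF wS]])
        show "(\<lambda>n. u * pgauge (X (k n)) y + v * pgauge (X (k n)) z) \<longlonglongrightarrow> u * g y + v * g z"
          by (intro tendsto_intros lim S)
        show "\<exists>N. \<forall>n\<ge>N. pgauge (X (k n)) (u *\<^sub>R y + v *\<^sub>R z) \<le> u * pgauge (X (k n)) y + v * pgauge (X (k n)) z"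
          using pgauge_triangle[OF X a0] pgauge_scale[OF X a0] uv by metis
      qed
      also have "\<dots> \<le> u * 1 + v * 1" using S uv by (intro add_mono mult_left_mono) auto
      finally show "u *\<^sub>R y + v *\<^sub>R z \<in> K" using wS uv by (simp add: K_def)
    qed
    moreover have "cball 0 a \<subseteq> K"
    proof
      fix y :: "real^2" assume y: "y \<in> cball 0 a"
      have "a \<le> b" using turningD(3,4)[OF X, of 0 0] by linarith
      then have yS: "y \<in> S" using y by (simp add: S_def)
      have "pgauge (X (k n)) y \<le> 1" for n
      proof -
        have "norm y / a \<le> 1" using y a0 by simp
        then show ?thesis using pgauge_le_norm[OF X a0, of "k n" y] by linarith
      qed
      then have "g y \<le> 1" by (intro LIMSEQ_le_const2[OF lim[OF yS]]) auto
      then show "y \<in> K" using yS by (simp add: K_def)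
    qed
    moreover have "K \<subseteq> cball 0 b" by (auto simp: K_def S_def)
    ultimately show ?thesis by (simp add: convex_class_def)
  qed
  then obtain z where z: "turning a b z" "K = body z" by (rule convex_class_imp_body[OF a0])
  have main: "supp z t \<le> (1 + e) * supp (X n) t \<and> supp (X n) t \<le> (1 + e) * supp z t"
    if e: "0 < e" and close: "\<And>y. y \<in> S \<Longrightarrow> norm (pgauge (X n) y - g y) < e" for e n t
  proof
    have "z t \<in> K" using turning_mem_body[OF z(1)] z(2) by simp
    then have zt: "z t \<in> S" "g (z t) \<le> 1" by (auto simp: K_def)
    then have "pgauge (X n) (z t) \<le> 1 + e" using close[OF zt(1)] by (auto simp: abs_less_iff)
    then show "supp z t \<le> (1 + e) * supp (X n) t" unfolding pgauge_le_iff[OF X a0] by blast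
    have w: "X n t \<in> S" using turning_norm_le[OF X] by (simp add: S_def)
    have "g (X n t) \<le> 1 + e" using close[OF w] pgauge_curve[OF X a0] by (auto simp: abs_less_iff)
    moreover have "g ((1 / (1 + e)) *\<^sub>R X n t) = 1 / (1 + e) * g (X n t)"
      using e by (intro gscale[OF w]) auto
    ultimately have "g ((1 / (1 + e)) *\<^sub>R X n t) \<le> 1" using e by simp
    moreover have "(1 / (1 + e)) *\<^sub>R X n t \<in> S"
    proof -
      have "norm (X n t) / (1 + e) \<le> norm (X n t) / 1" using e by (intro divide_left_mono) auto
      then show ?thesis using w e by (simp add: S_def)
    qed
    ultimately have "(1 / (1 + e)) *\<^sub>R X n t \<in> K" by (simp add: K_def)
    then have "(1 / (1 + e)) *\<^sub>R X n t \<in> body z" using z(2) by simp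
    then have "((1 / (1 + e)) *\<^sub>R X n t) \<bullet> nrm t \<le> supp z t" by (simp add: body_def)
    then show "supp (X n) t \<le> (1 + e) * supp z t" using e by (simp add: field_simps)
  qed
  show ?thesis
  proof (rule that[OF z(1) k])
    fix e :: real assume "0 < e"
    with conv[OF this] main show "\<exists>N. \<forall>n\<ge>N. \<forall>t. supp z t \<le> (1 + e) * supp (X (k n)) t \<and> supp (X (k n)) t \<le> (1 + e) * supp z t"
      by metis
  qed
qed

lemma optimal_exists:
  assumes a0: "0 < a" and ab: "a < b" and lam: "0 \<le> lam"
  shows "\<exists>\<Omega>. optimal a b lam \<Omega>"
proof -
  define V where "V = J lam ` convex_class a b"
  have ne: "V \<noteq> {}" using disc_in_class[of a a b] ab by (auto simp: V_def)
  have lb: "- (2 * pi * b) \<le> v" if "v \<in> V" for v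
  proof -
    from that obtain K where K: "K \<in> convex_class a b" "v = J lam K" by (auto simp: V_def)
    obtain x where x: "turning a b x" "K = body x" by (rule convex_class_imp_body[OF a0 K(1)])
    have "0 \<le> lam * area (body x)" using lam area_body_bounds(1)[OF x(1) a0] by simp
    then show ?thesis using area_body_bounds(4)[OF x(1) a0] unfolding K(2) x(2) J_def by linarith
  qed
  have bdd: "bdd_below V" using lb by (rule bdd_belowI)
  have "\<exists>x. turning a b x \<and> J lam (body x) < Inf V + 1 / real (Suc n)" for n
  proof -
    have "Inf V < Inf V + 1 / real (Suc n)" by simp
    then obtain v where "v \<in> V" "v < Inf V + 1 / real (Suc n)" using cInf_lessD[OF ne] by blast
    then obtain K where K: "K \<in> convex_class a b" "J lam K < Inf V + 1 / real (Suc n)" by (auto simp: V_def)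
    obtain x where "turning a b x" "K = body x" by (rule convex_class_imp_body[OF a0 K(1)])
    with K show ?thesis by blast
  qed
  then obtain X where X: "\<And>n. turning a b (X n)" "\<And>n. J lam (body (X n)) < Inf V + 1 / real (Suc n)"
    by metis
  obtain z k where z: "turning a b z" and k: "strict_mono (k :: nat \<Rightarrow> nat)"
    and conv: "\<And>e. 0 < e \<Longrightarrow> \<exists>N. \<forall>n\<ge>N. \<forall>t. supp z t \<le> (1 + e) * supp (X (k n)) t \<and> supp (X (k n)) t \<le> (1 + e) * supp z t"
    by (rule selection[where X = X, OF X(1) a0]) blast
  define C where "C = lam * (3 * area (cball 0 b)) + 2 * pi * b + 1"
  have C: "0 < C" using lam b_pos[OF z a0] by (auto simp: C_def area_def intro!: add_nonneg_pos)
  have "J lam (body z) \<le> Inf V + C * e" if e: "0 < e" "e \<le> 1" for e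
  proof -
    obtain N where N: "\<And>n t. n \<ge> N \<Longrightarrow> supp z t \<le> (1 + e) * supp (X (k n)) t \<and> supp (X (k n)) t \<le> (1 + e) * supp z t"
      using conv[OF e(1)] by blast
    obtain M :: nat where M: "1 / e < real M" using reals_Archimedean2 by blast
    define n where "n = k (max N M)"
    have nM: "M \<le> n" using seq_suble[OF k, of "max N M"] unfolding n_def by linarith
    have small: "1 / real (Suc n) \<le> e"
    proof -
      have "1 / e \<le> real (Suc n)" using M nM by linarith
      then show ?thesis using e by (simp add: field_simps)
    qed
    let ?A = "area (body (X n))" and ?P = "perimeter (body (X n))"
    note bd = area_body_bounds[OF X(1)[of n] a0]
    have 1: "?P \<le> (1 + e) * perimeter (body z)"
      using N e by (intro compare_scaled[OF X(1) z a0]) (auto simp: n_def)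
    have 2: "area (body z) \<le> (1 + e)\<^sup>2 * ?A"
      using N e by (intro compare_scaled[OF z X(1) a0]) (auto simp: n_def)
    have "perimeter (body z) * e \<le> (2 * pi * b) * e"
      using area_body_bounds(4)[OF z a0] e by (intro mult_right_mono) auto
    with 1 have 3: "- perimeter (body z) \<le> - ?P + 2 * pi * b * e" by (simp add: algebra_simps)
    have "e * e \<le> e * 1" using e by (intro mult_left_mono) auto
    then have "(1 + e)\<^sup>2 \<le> 1 + 3 * e" by (simp add: power2_eq_square algebra_simps)
    then have "(1 + e)\<^sup>2 * ?A \<le> (1 + 3 * e) * ?A" using bd by (intro mult_right_mono) auto
    also have "\<dots> \<le> ?A + 3 * e * area (cball 0 b)"
      using bd e by (simp add: algebra_simps mult_left_mono)
    finally have "area (body z) \<le> ?A + 3 * e * area (cball 0 b)" using 2 by simp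
    then have "lam * area (body z) \<le> lam * (?A + 3 * e * area (cball 0 b))" using lam by (rule mult_left_mono)
    then have "J lam (body z) \<le> J lam (body (X n)) + (lam * (3 * area (cball 0 b)) + 2 * pi * b) * e"
      using 3 unfolding J_def by (simp add: algebra_simps)
    also have "\<dots> \<le> Inf V + e + (lam * (3 * area (cball 0 b)) + 2 * pi * b) * e"
      using X(2)[of n] small by simp
    finally show ?thesis by (simp add: C_def algebra_simps)
  qed
  then have *: "J lam (body z) \<le> Inf V + C * e" if "0 < e" "e \<le> 1" for e using that by blast
  have "J lam (body z) \<le> Inf V"
  proof (rule field_le_epsilon)
    fix \<epsilon> :: real assume \<epsilon>: "0 < \<epsilon>"
    define e where "e = min 1 (\<epsilon> / C)"
    have e: "0 < e" "e \<le> 1" using \<epsilon> C by (auto simp: e_def)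
    have "C * e \<le> C * (\<epsilon> / C)" using C by (intro mult_left_mono) (auto simp: e_def)
    then show "J lam (body z) \<le> Inf V + \<epsilon>" using *[OF e] C by simp
  qed
  moreover have "Inf V \<le> J lam K" if "K \<in> convex_class a b" for K
    using that by (intro cInf_lower bdd) (auto simp: V_def)
  ultimately have "optimal a b lam (body z)"
    unfolding optimal_def is_arg_min_def using body_in_convex_class[OF z] by (metis leD order_trans)
  then show ?thesis by blast
qed

lemma optimalD:
  assumes "optimal a b lam \<Omega>"
  shows "\<Omega> \<in> convex_class a b" "\<And>K. K \<in> convex_class a b \<Longrightarrow> J lam \<Omega> \<le> J lam K"
  using assms unfolding optimal_def is_arg_min_def by (auto simp: not_less)

section \<open>Local modifications of a minimizer\<close>

text \<open>Admissible increments can be concatenated, so an arc may be exchanged for any other admissible one with the same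
  end points that respects both discs.\<close>

lemma replace_arc:
  assumes T: "turning a b x" and ab: "\<alpha> \<le> \<beta>" "\<beta> < \<alpha> + 2 * pi" and adm: "adm_on \<alpha> \<beta> y"
    and ends: "y \<alpha> = x \<alpha>" "y \<beta> = x \<beta>"
    and bounds: "\<And>t. \<alpha> \<le> t \<Longrightarrow> t \<le> \<beta> \<Longrightarrow> a \<le> supp y t \<and> supp y t \<le> b"
  obtains z where "turning a b z" "\<And>t. \<alpha> \<le> t \<Longrightarrow> t \<le> \<beta> \<Longrightarrow> z t = y t"
    "\<And>t. \<beta> \<le> t \<Longrightarrow> t \<le> \<alpha> + 2 * pi \<Longrightarrow> z t = x t"
proof
  define w where "w t = (if t \<le> \<beta> then y t else x t)" for t
  have wx: "w t = x t" if "\<beta> \<le> t" for t using that ends by (cases "t = \<beta>") (auto simp: w_def)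
  have per: "x (\<alpha> + 2 * pi) = x \<alpha>" by (rule turningD(1)[OF T])
  have w1: "adm_on \<alpha> \<beta> w" by (rule adm_on_cong[OF adm]) (simp add: w_def)
  have w2: "adm_on \<beta> (\<alpha> + 2 * pi) w" by (rule adm_on_cong[OF turning_adm_on[OF T]]) (simp add: wx)
  have w3: "w (\<alpha> + 2 * pi) = w \<alpha>" using wx[of "\<alpha> + 2 * pi"] ab per ends by (simp add: w_def)
  show "turning a b (periodize \<alpha> w)"
  proof (rule turning_periodize[OF adm_on_join[OF w1 w2] w3])
    show "a \<le> w t \<bullet> nrm t \<and> w t \<bullet> nrm t \<le> b" if "\<alpha> \<le> t" for t
      using bounds[of t] turningD(3,4)[OF T, of t] that by (auto simp: w_def)
  qed
  show "periodize \<alpha> w t = y t" if "\<alpha> \<le> t" "t \<le> \<beta>" for t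
    using that ab by (subst periodize_eq) (auto simp: w_def)
  show "periodize \<alpha> w t = x t" if "\<beta> \<le> t" "t \<le> \<alpha> + 2 * pi" for t
  proof (cases "t = \<alpha> + 2 * pi")
    case True
    then show ?thesis
      using periodize_periodic[of \<alpha> w \<alpha>] periodize_eq[of \<alpha> \<alpha> w] w3 wx[of t] that by simp
  next
    case False
    then show ?thesis using that ab wx by (subst periodize_eq) auto
  qed
qed

context
  fixes a b lam :: real and x :: "real \<Rightarrow> real^2"
  assumes T: "turning a b x" and a0: "0 < a"
    and minimal: "\<And>y. turning a b y \<Longrightarrow> J lam (body x) \<le> J lam (body y)"
begin

lemma local_minimality:
  assumes Z: "turning a b z" and ab: "\<alpha> \<le> \<beta>" "\<beta> < \<alpha> + 2 * pi"
    and eq: "\<And>t. \<beta> \<le> t \<Longrightarrow> t \<le> \<alpha> + 2 * pi \<Longrightarrow> z t = x t"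
  shows "integral {\<alpha>..\<beta>} (dens lam x) \<le> integral {\<alpha>..\<beta>} (dens lam z)"
proof -
  have split: "J lam (body y) = integral {\<alpha>..\<beta>} (dens lam y) + integral {\<beta>..\<alpha> + 2 * pi} (dens lam y)"
    if "turning a b y" for y
    unfolding J_body[OF that a0, of lam \<alpha>]
    using Henstock_Kurzweil_Integration.integral_combine[OF ab(1) less_imp_le[OF ab(2)] integrable_dens[OF that a0]] by simp
  have "integral {\<beta>..\<alpha> + 2 * pi} (dens lam z) = integral {\<beta>..\<alpha> + 2 * pi} (dens lam x)"
    by (rule Henstock_Kurzweil_Integration.integral_cong) (simp add: dens_def eq)
  then show ?thesis using minimal[OF Z] split[OF Z] split[OF T] by simp
qed

subsection \<open>Contact with the outer disc\<close>

lemma contact_outer_point: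
  assumes "supp x t = b"
  shows "x t = b *\<^sub>R nrm t"
proof -
  have "(tco x t)\<^sup>2 \<le> 0" using tco_sq_le[OF T a0, of t] assms by simp
  then have "tco x t = 0" by simp
  then show ?thesis using frame_decomp[of "x t" t] assms by simp
qed

text \<open>The chord between two contacts has at most the support function of the arc and satisfies \<open>tco\<^sup>2 = b\<^sup>2 - supp\<^sup>2\<close>, whereas the arc satisfies
  only \<open>tco\<^sup>2 \<le> b\<^sup>2 - supp\<^sup>2\<close>.  This turns the comparison into a pointwise one between support functions, in which the chord
  wins as soon as \<open>1 < lam (supp x + supp z)\<close>.\<close>

lemma contact_outer:
  assumes ab: "\<alpha> < \<beta>" and cont: "supp x \<alpha> = b" "supp x \<beta> = b" and lam: "0 < lam"
    and h: "\<beta> - \<alpha> < pi" "a \<le> b * cos ((\<beta> - \<alpha>) / 2)" "1 < 2 * lam * b * cos ((\<beta> - \<alpha>) / 2)"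
  shows "\<And>t. \<alpha> \<le> t \<Longrightarrow> t \<le> (\<alpha> + \<beta>) / 2 \<Longrightarrow> supp x t = x \<alpha> \<bullet> nrm t"
    "\<And>t. (\<alpha> + \<beta>) / 2 < t \<Longrightarrow> t \<le> \<beta> \<Longrightarrow> supp x t = x \<beta> \<bullet> nrm t"
proof -
  define \<mu> where "\<mu> = (\<alpha> + \<beta>) / 2"
  define h where "h = (\<beta> - \<alpha>) / 2"
  define y where "y t = (if t \<le> \<mu> then x \<alpha> else x \<beta>)" for t
  have b: "0 < b" by (rule b_pos[OF T a0])
  have h0: "0 < h" "h < pi / 2" and eqs: "\<mu> = \<alpha> + h" "\<beta> = \<mu> + h"
    using ab h by (auto simp: h_def \<mu>_def field_simps)
  have xa: "x \<alpha> = b *\<^sub>R nrm \<alpha>" and xb: "x \<beta> = b *\<^sub>R nrm \<beta>"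
    using contact_outer_point cont by auto
  have coslow: "cos h \<le> cos r" if "\<bar>r\<bar> \<le> h" for r
    using that h0 cos_monotone_0_pi_le[of "\<bar>r\<bar>" h] by simp
  have ylow: "b * cos h \<le> supp y t" and yup: "supp y t \<le> b" if "\<alpha> \<le> t" "t \<le> \<beta>" for t
  proof -
    obtain r where r: "supp y t = b * cos r" "\<bar>r\<bar> \<le> h"
    proof (cases "t \<le> \<mu>")
      case True
      then show ?thesis using that[of "t - \<alpha>"] \<open>\<alpha> \<le> t\<close> eqs by (auto simp: y_def xa nrm_inner_nrm)
    next
      case False
      show ?thesis
      proof (rule that[of "t - \<beta>"])
        show "supp y t = b * cos (t - \<beta>)" using False by (simp add: y_def xb nrm_inner_nrm)
        show "\<bar>t - \<beta>\<bar> \<le> h" using False \<open>t \<le> \<beta>\<close> eqs by linarith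
      qed
    qed
    then show "b * cos h \<le> supp y t" "supp y t \<le> b"
      using coslow[OF r(2)] b by (auto simp: mult_left_le)
  qed
  have "nrm (\<mu> + h) - nrm (\<mu> - h) = (2 * sin h) *\<^sub>R tng \<mu>"
    unfolding vec_eq_iff forall_2
    by (simp add: nrm_def tng_def cos_add sin_add cos_diff sin_diff)
  moreover have "\<mu> - h = \<alpha>" "\<mu> + h = \<beta>" using eqs by auto
  ultimately have diff: "x \<beta> - x \<alpha> = (2 * b * sin h) *\<^sub>R tng \<mu>"
    unfolding xa xb by (metis mult.assoc mult.left_commute scaleR_diff_right scaleR_scaleR)
  have adm: "adm_on \<alpha> \<beta> y"
    unfolding adm_on_def
  proof (intro allI impI)
    fix s t assume st: "\<alpha> \<le> s \<and> s \<le> t \<and> t \<le> \<beta> \<and> t \<le> s + pi"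
    have "0 \<le> sin h" using h0 by (intro sin_ge_zero) auto
    then have "adm s t (x \<beta> - x \<alpha>)" if "s \<le> \<mu>" "\<mu> \<le> t"
      unfolding diff using that b by (intro adm_tng) auto
    then show "adm s t (y t - y s)" using st by (auto simp: y_def)
  qed
  have yends: "y \<alpha> = x \<alpha>" "y \<beta> = x \<beta>" using h0 eqs by (auto simp: y_def)
  have ab2: "\<alpha> \<le> \<beta>" "\<beta> < \<alpha> + 2 * pi" using ab h by auto
  obtain z where z: "turning a b z" "\<And>t. \<alpha> \<le> t \<Longrightarrow> t \<le> \<beta> \<Longrightarrow> z t = y t"
    "\<And>t. \<beta> \<le> t \<Longrightarrow> t \<le> \<alpha> + 2 * pi \<Longrightarrow> z t = x t"
  proof (rule replace_arc[OF T ab2 adm yends])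
    show "a \<le> supp y t \<and> supp y t \<le> b" if "\<alpha> \<le> t" "t \<le> \<beta>" for t
      using ylow[OF that] yup[OF that] h(2) by (simp add: h_def)
  qed blast
  have le: "supp z t \<le> supp x t" if "\<alpha> \<le> t" "t \<le> \<beta>" for t
    using turningD(2)[OF T] z(2)[OF that] by (simp add: y_def)
  have zlow: "b * cos h \<le> supp z t" if "\<alpha> \<le> t" "t \<le> \<beta>" for t using ylow[OF that] z(2)[OF that] by simp
  let ?f = "\<lambda>t. (supp x t - supp z t) * (lam * (supp x t + supp z t) - 1)"
  have pos: "0 < lam * (supp x t + supp z t) - 1" if "\<alpha> \<le> t" "t \<le> \<beta>" for t
  proof -
    have "2 * (b * cos h) \<le> supp x t + supp z t" using le[OF that] zlow[OF that] by linarith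
    then have "lam * (2 * (b * cos h)) \<le> lam * (supp x t + supp z t)" using lam by (intro mult_left_mono) auto
    then show ?thesis using h(3) by (simp add: h_def mult_ac)
  qed
  have cf: "continuous_on {\<alpha>..\<beta>} ?f"
    by (intro continuous_intros continuous_supp[OF T a0] continuous_supp[OF z(1) a0])
  have "integral {\<alpha>..\<beta>} ?f \<le> integral {\<alpha>..\<beta>} (\<lambda>t. dens lam x t - dens lam z t)"
  proof (rule integral_le)
    fix t assume t: "t \<in> {\<alpha>..\<beta>}"
    have "(norm (z t))\<^sup>2 = b\<^sup>2" using z(2)[of t] t by (simp add: y_def xa xb b less_imp_le)
    then have tz: "(tco z t)\<^sup>2 = b\<^sup>2 - (supp z t)\<^sup>2" using norm_frame[of "z t" t] by simp
    have "lam / 2 * (tco x t)\<^sup>2 \<le> lam / 2 * (b\<^sup>2 - (supp x t)\<^sup>2)"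
      using tco_sq_le[OF T a0, of t] lam by (intro mult_left_mono) auto
    then show "?f t \<le> dens lam x t - dens lam z t"
      unfolding dens_def tz by (simp add: algebra_simps power2_eq_square)
  qed (intro integrable_continuous_real cf integrable_diff integrable_dens[OF T a0] integrable_dens[OF z(1) a0])+
  also have "\<dots> = integral {\<alpha>..\<beta>} (dens lam x) - integral {\<alpha>..\<beta>} (dens lam z)"
    by (intro Henstock_Kurzweil_Integration.integral_diff integrable_dens[OF T a0] integrable_dens[OF z(1) a0])
  also have "\<dots> \<le> 0" using local_minimality[OF z(1) ab2 z(3)] by simp
  finally have int0: "integral {\<alpha>..\<beta>} ?f \<le> 0" .
  have "supp x t = supp y t" if t: "\<alpha> \<le> t" "t \<le> \<beta>" for t
  proof -
    have "?f t = 0"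
      using int0 pos le t ab by (intro integral_nonpos_imp_zero[OF cf]) (auto intro!: mult_nonneg_nonneg simp: less_imp_le)
    then have "supp x t = supp z t" using pos[OF t] by auto
    then show ?thesis using z(2)[OF t] by simp
  qed
  then show "\<And>t. \<alpha> \<le> t \<Longrightarrow> t \<le> (\<alpha> + \<beta>) / 2 \<Longrightarrow> supp x t = x \<alpha> \<bullet> nrm t"
    "\<And>t. (\<alpha> + \<beta>) / 2 < t \<Longrightarrow> t \<le> \<beta> \<Longrightarrow> supp x t = x \<beta> \<bullet> nrm t"
    using ab unfolding y_def \<mu>_def by auto
qed

subsection \<open>Contact with the inner disc\<close>

lemma deriv_inner_nrm: "((\<lambda>t. v \<bullet> nrm t) has_real_derivative v \<bullet> tng t) (at t within S)"
  unfolding inner_nrm inner_tng by (auto intro!: derivative_eq_intros)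

lemma deriv_inner_tng: "((\<lambda>t. v \<bullet> tng t) has_real_derivative - (v \<bullet> nrm t)) (at t within S)"
  unfolding inner_nrm inner_tng by (auto intro!: derivative_eq_intros)

lemma vertex_integrals:
  assumes "\<alpha> \<le> \<beta>"
  shows "((\<lambda>t. v \<bullet> nrm t) has_integral (v \<bullet> tng \<alpha> - v \<bullet> tng \<beta>)) {\<alpha>..\<beta>}"
    "((\<lambda>t. (v \<bullet> nrm t)\<^sup>2 - (v \<bullet> tng t)\<^sup>2) has_integral
      ((v \<bullet> nrm \<alpha>) * (v \<bullet> tng \<alpha>) - (v \<bullet> nrm \<beta>) * (v \<bullet> tng \<beta>))) {\<alpha>..\<beta>}"
proof -
  have "((\<lambda>t. v \<bullet> nrm t) has_integral (- (v \<bullet> tng \<beta>) - - (v \<bullet> tng \<alpha>))) {\<alpha>..\<beta>}"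
    using DERIV_minus[OF deriv_inner_tng[of v]]
    by (intro fundamental_theorem_of_calculus[OF assms]) (simp add: has_real_derivative_iff_has_vector_derivative)
  then show "((\<lambda>t. v \<bullet> nrm t) has_integral (v \<bullet> tng \<alpha> - v \<bullet> tng \<beta>)) {\<alpha>..\<beta>}" by simp
  have "((\<lambda>t. - ((v \<bullet> nrm t) * (v \<bullet> tng t))) has_real_derivative (v \<bullet> nrm t)\<^sup>2 - (v \<bullet> tng t)\<^sup>2) (at t within S)" for t S
    by (rule derivative_eq_intros deriv_inner_nrm deriv_inner_tng refl)+ (simp add: power2_eq_square)
  then have "((\<lambda>t. (v \<bullet> nrm t)\<^sup>2 - (v \<bullet> tng t)\<^sup>2) has_integral
      (- ((v \<bullet> nrm \<beta>) * (v \<bullet> tng \<beta>)) - - ((v \<bullet> nrm \<alpha>) * (v \<bullet> tng \<alpha>)))) {\<alpha>..\<beta>}"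
    by (intro fundamental_theorem_of_calculus[OF assms]) (simp add: has_real_derivative_iff_has_vector_derivative)
  then show "((\<lambda>t. (v \<bullet> nrm t)\<^sup>2 - (v \<bullet> tng t)\<^sup>2) has_integral
      ((v \<bullet> nrm \<alpha>) * (v \<bullet> tng \<alpha>) - (v \<bullet> nrm \<beta>) * (v \<bullet> tng \<beta>))) {\<alpha>..\<beta>}" by simp
qed

text \<open>The two tangents at the contacts have distance \<open>a\<close> from the origin, and the supporting lines between
  them have at least this distance.  Replacing the arc by the corner of the tangents therefore increases the area by at most \<open>a/2\<close> times the increase of the
  perimeter, an improvement if \<open>lam < 2 / a\<close>.\<close>

lemma contact_inner:
  assumes ab: "\<alpha> < \<beta>" and cont: "supp x \<alpha> = a" "supp x \<beta> = a" and lam: "0 < lam" "lam < 2 / a"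
    and h: "\<beta> - \<alpha> < pi" "a \<le> b * cos ((\<beta> - \<alpha>) / 2)"
  shows "\<exists>v. \<forall>t. \<alpha> \<le> t \<and> t \<le> \<beta> \<longrightarrow> supp x t = v \<bullet> nrm t"
proof -
  define \<mu> where "\<mu> = (\<alpha> + \<beta>) / 2"
  define h where "h = (\<beta> - \<alpha>) / 2"
  have h0: "0 < h" "h < pi / 2" and eqs: "\<alpha> = \<mu> - h" "\<beta> = \<mu> + h"
    using ab h by (auto simp: h_def \<mu>_def field_simps)
  have ch: "0 < cos h" using h0 by (intro cos_gt_zero_pi) auto
  define v where "v = (a / cos h) *\<^sub>R nrm \<mu>"
  have vn: "v \<bullet> nrm t = a / cos h * cos (t - \<mu>)" for t by (simp add: v_def nrm_inner_nrm)
  have va: "v \<bullet> nrm \<alpha> = a" and vb: "v \<bullet> nrm \<beta> = a" using ch by (auto simp: vn eqs)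
  have sp: "0 < sin (\<beta> - \<alpha>)" using ab h by (intro sin_gt_zero) auto
  define y where "y t = (if t \<le> \<alpha> then x \<alpha> else if \<beta> \<le> t then x \<beta> else v)" for t
  define e1 where "e1 = (v - x \<alpha>) \<bullet> tng \<alpha>"
  define e2 where "e2 = - ((v - x \<beta>) \<bullet> tng \<beta>)"
  have v1: "v = x \<alpha> + e1 *\<^sub>R tng \<alpha>"
    unfolding e1_def by (rule on_support_line[OF T a0]) (simp add: va cont)
  have v2: "v = x \<beta> - e2 *\<^sub>R tng \<beta>"
    using on_support_line[OF T a0, of v \<beta>] by (simp add: e2_def vb cont)
  have e1: "0 \<le> e1"
  proof -
    have "v \<bullet> nrm \<beta> = x \<alpha> \<bullet> nrm \<beta> + e1 * sin (\<beta> - \<alpha>)"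
      by (subst v1) (simp add: inner_add_left tng_inner_nrm)
    then have "0 \<le> e1 * sin (\<beta> - \<alpha>)" using turningD(2)[OF T, of \<alpha> \<beta>] vb cont by simp
    then show ?thesis using sp by (simp add: zero_le_mult_iff)
  qed
  have e2: "0 \<le> e2"
  proof -
    have "tng \<beta> \<bullet> nrm \<alpha> = - sin (\<beta> - \<alpha>)" using tng_inner_nrm[of \<beta> \<alpha>] sin_minus[of "\<beta> - \<alpha>"] by simp
    then have "v \<bullet> nrm \<alpha> = x \<beta> \<bullet> nrm \<alpha> + e2 * sin (\<beta> - \<alpha>)"
      by (subst v2) (simp add: inner_diff_left)
    then have "0 \<le> e2 * sin (\<beta> - \<alpha>)" using turningD(2)[OF T, of \<beta> \<alpha>] va cont by simp
    then show ?thesis using sp by (simp add: zero_le_mult_iff)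
  qed
  have adm: "adm_on \<alpha> \<beta> y"
    unfolding adm_on_def
  proof (intro allI impI)
    fix s t assume st: "\<alpha> \<le> s \<and> s \<le> t \<and> t \<le> \<beta> \<and> t \<le> s + pi"
    have L: "adm \<alpha> t (v - x \<alpha>)" if "\<alpha> \<le> t" for t
      using adm_tng[OF e1, of \<alpha> \<alpha> t] that v1 by simp
    have R: "adm s \<beta> (x \<beta> - v)" if "s \<le> \<beta>" for s
      using adm_tng[OF e2, of s \<beta> \<beta>] that v2 by simp
    have LR: "adm \<alpha> \<beta> (x \<beta> - x \<alpha>)" using turning_adm[OF T, of \<alpha> \<beta>] ab h by simp
    consider "s = t" | "s = \<alpha>" "t = \<beta>" | "s = \<alpha>" "\<alpha> < t" "t < \<beta>" | "\<alpha> < s" "s < \<beta>" "t = \<beta>" | "\<alpha> < s" "t < \<beta>"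
      using st by linarith
    then show "adm s t (y t - y s)"
      by cases (use L R LR ab st in \<open>auto simp: y_def\<close>)
  qed
  have yends: "y \<alpha> = x \<alpha>" "y \<beta> = x \<beta>" using ab by (auto simp: y_def)
  have suppy: "supp y t = v \<bullet> nrm t" if "\<alpha> \<le> t" "t \<le> \<beta>" for t
    using that va vb cont by (cases "t = \<alpha>"; cases "t = \<beta>") (auto simp: y_def)
  have ab2: "\<alpha> \<le> \<beta>" "\<beta> < \<alpha> + 2 * pi" using ab h by auto
  obtain z where z: "turning a b z" "\<And>t. \<alpha> \<le> t \<Longrightarrow> t \<le> \<beta> \<Longrightarrow> z t = y t"
    "\<And>t. \<beta> \<le> t \<Longrightarrow> t \<le> \<alpha> + 2 * pi \<Longrightarrow> z t = x t"
  proof (rule replace_arc[OF T ab2 adm yends])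
    show "a \<le> supp y t \<and> supp y t \<le> b" if "\<alpha> \<le> t" "t \<le> \<beta>" for t
    proof -
      have "\<bar>t - \<mu>\<bar> \<le> h" using that eqs by auto
      then have "cos h \<le> cos (t - \<mu>)"
        using h0 cos_monotone_0_pi_le[of "\<bar>t - \<mu>\<bar>" h] by simp
      then have "a * cos h \<le> a * cos (t - \<mu>)" "a * cos (t - \<mu>) \<le> a * 1"
        using a0 by (auto intro!: mult_left_mono)
      moreover have "a * 1 \<le> b * cos h" using h(2) by (simp add: h_def)
      ultimately show ?thesis
        unfolding suppy[OF that] vn using ch by (simp add: field_simps)
    qed
  qed blast
  let ?P = "integral {\<alpha>..\<beta>} (supp x)" and ?V = "integral {\<alpha>..\<beta>} (\<lambda>t. v \<bullet> nrm t)"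
  let ?k = "lam * a / 2 - 1"
  have k: "?k < 0" using lam a0 by (simp add: field_simps)
  have "a * ?P \<le> integral {\<alpha>..\<beta>} (\<lambda>t. (supp x t)\<^sup>2 - (tco x t)\<^sup>2)"
    using sweep_ge_length[OF T a0 ab2(1)] by (simp add: sweep_def[OF T a0] cont algebra_simps)
  then have "lam / 2 * (a * ?P) \<le> lam / 2 * integral {\<alpha>..\<beta>} (\<lambda>t. (supp x t)\<^sup>2 - (tco x t)\<^sup>2)"
    using lam by simp
  moreover have "integral {\<alpha>..\<beta>} (dens lam x) = lam / 2 * integral {\<alpha>..\<beta>} (\<lambda>t. (supp x t)\<^sup>2 - (tco x t)\<^sup>2) - ?P"
    unfolding dens_def
    by (intro integral_unique has_integral_diff has_integral_mult_right integrable_integral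
        integrable_quadr[OF T a0] integrable_supp[OF T a0])
  ultimately have "?k * ?P \<le> integral {\<alpha>..\<beta>} (dens lam x)" by (simp add: algebra_simps)
  also have "\<dots> \<le> integral {\<alpha>..\<beta>} (dens lam z)" by (rule local_minimality[OF z(1) ab2 z(3)])
  also have "\<dots> = ?k * ?V"
  proof -
    have V: "?V = v \<bullet> tng \<alpha> - v \<bullet> tng \<beta>" by (rule integral_unique[OF vertex_integrals(1)[OF ab2(1)]])
    have I: "((\<lambda>t. lam / 2 * ((v \<bullet> nrm t)\<^sup>2 - (v \<bullet> tng t)\<^sup>2) - v \<bullet> nrm t) has_integral
        (lam / 2 * (a * (v \<bullet> tng \<alpha>) - a * (v \<bullet> tng \<beta>)) - (v \<bullet> tng \<alpha> - v \<bullet> tng \<beta>))) {\<alpha>..\<beta>}"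
      by (intro has_integral_diff has_integral_mult_right vertex_integrals(1)[OF ab2(1)]
          vertex_integrals(2)[OF ab2(1), of v, unfolded va vb])
    have val: "lam / 2 * (a * (v \<bullet> tng \<alpha>) - a * (v \<bullet> tng \<beta>)) - (v \<bullet> tng \<alpha> - v \<bullet> tng \<beta>) = ?k * ?V"
      unfolding V by (simp add: algebra_simps)
    have "(dens lam z has_integral ?k * ?V) {\<alpha>..\<beta>}"
      by (rule has_integral_spike_finite[of "{\<alpha>, \<beta>}", OF _ _ I[unfolded val]])
         (auto simp: dens_def z(2) y_def)
    then show ?thesis by (rule integral_unique)
  qed
  finally have "?V \<le> ?P" using k by (simp add: mult_le_cancel_left)
  let ?f = "\<lambda>t. v \<bullet> nrm t - supp x t"
  have cf: "continuous_on {\<alpha>..\<beta>} ?f"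
    by (intro continuous_on_diff continuous_supp[OF T a0]) (unfold inner_nrm, intro continuous_intros)
  have f0: "0 \<le> ?f t" if t: "t \<in> {\<alpha>..\<beta>}" for t
  proof -
    have s: "0 \<le> sin (\<beta> - t)" "0 \<le> sin (t - \<alpha>)" using t h by (auto intro!: sin_ge_zero)
    have "sin (\<beta> - \<alpha>) * supp x t = sin (\<beta> - t) * (x t \<bullet> nrm \<alpha>) + sin (t - \<alpha>) * (x t \<bullet> nrm \<beta>)"
      by (rule inner_nrm_three)
    also have "\<dots> \<le> sin (\<beta> - t) * a + sin (t - \<alpha>) * a"
      using s turningD(2)[OF T, of t] cont by (intro add_mono mult_left_mono) metis+
    also have "\<dots> = sin (\<beta> - \<alpha>) * (v \<bullet> nrm t)" using inner_nrm_three[of \<beta> \<alpha> v t] va vb by simp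
    finally show ?thesis using sp by (simp add: mult_le_cancel_left)
  qed
  have "integral {\<alpha>..\<beta>} ?f = ?V - ?P"
    using vertex_integrals(1)[OF ab2(1), of v] integrable_supp[OF T a0]
    by (intro Henstock_Kurzweil_Integration.integral_diff) (auto simp: integrable_on_def)
  then have "integral {\<alpha>..\<beta>} ?f \<le> 0" using \<open>?V \<le> ?P\<close> by simp
  then have "?f t = 0" if "t \<in> {\<alpha>..\<beta>}" for t
    using f0 ab that by (intro integral_nonpos_imp_zero[OF cf])
  then show ?thesis by (intro exI[of _ v]) auto
qed

subsection \<open>Free arcs\<close>

lemma supp_bounds_compact:
  assumes "l \<le> r" "\<And>t. l \<le> t \<Longrightarrow> t \<le> r \<Longrightarrow> a < supp x t \<and> supp x t < b"
  obtains \<eta> where "0 < \<eta>" "\<And>t. l \<le> t \<Longrightarrow> t \<le> r \<Longrightarrow> a + \<eta> \<le> supp x t \<and> supp x t \<le> b - \<eta>"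
proof -
  have ne: "{l..r} \<noteq> {}" "compact {l..r}" using assms by auto
  obtain t1 where t1: "t1 \<in> {l..r}" "\<And>t. t \<in> {l..r} \<Longrightarrow> supp x t1 \<le> supp x t"
    using continuous_attains_inf[OF ne(2,1) continuous_supp[OF T a0]] by blast
  obtain t2 where t2: "t2 \<in> {l..r}" "\<And>t. t \<in> {l..r} \<Longrightarrow> supp x t \<le> supp x t2"
    using continuous_attains_sup[OF ne(2,1) continuous_supp[OF T a0]] by blast
  define \<eta> where "\<eta> = min (supp x t1 - a) (b - supp x t2)"
  have "0 < \<eta>" using assms(2)[of t1] assms(2)[of t2] t1(1) t2(1) by (auto simp: \<eta>_def)
  moreover have "a + \<eta> \<le> supp x t \<and> supp x t \<le> b - \<eta>" if "l \<le> t" "t \<le> r" for t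
    using t1(2)[of t] t2(2)[of t] that by (auto simp: \<eta>_def min_def)
  ultimately show ?thesis using that by blast
qed

text \<open>A Poincare inequality in contrapositive form.  Expanding the integral of \<open>(N - V t)\<^sup>2\<close> over \<open>{l..t}\<close> bounds \<open>(V t)\<^sup>2\<close> by the
  integral of \<open>N\<^sup>2\<close>, and integrating this over an interval of length at most \<open>1/2\<close> gains a factor \<open>1/2\<close>.\<close>

lemma poincare:
  fixes N V :: "real \<Rightarrow> real"
  assumes lr: "l \<le> r" "r \<le> l + 1 / 2"
    and int: "\<And>s t. N integrable_on {s..t}" "\<And>s t. (\<lambda>u. (N u)\<^sup>2) integrable_on {s..t}"
    and V: "\<And>t. l \<le> t \<Longrightarrow> t \<le> r \<Longrightarrow> V t = integral {l..t} N" and cV: "continuous_on {l..r} V"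
    and le: "integral {l..r} (\<lambda>u. (N u)\<^sup>2) \<le> integral {l..r} (\<lambda>u. (V u)\<^sup>2)"
    and t: "l \<le> t" "t \<le> r"
  shows "V t = 0"
proof -
  let ?E = "integral {l..r} (\<lambda>u. (N u)\<^sup>2)"
  have sq: "(V t)\<^sup>2 \<le> ?E" if t: "l \<le> t" "t \<le> r" for t
  proof -
    let ?q = "V t"
    have "((\<lambda>_. ?q\<^sup>2) has_integral ?q\<^sup>2 * (t - l)) {l..t}"
      using has_integral_const_real[of "?q\<^sup>2" l t] t by (simp add: mult.commute)
    then have "((\<lambda>u. (N u)\<^sup>2 - 2 * ?q * N u + ?q\<^sup>2) has_integral
        (integral {l..t} (\<lambda>u. (N u)\<^sup>2) - 2 * ?q * integral {l..t} N + ?q\<^sup>2 * (t - l))) {l..t}"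
      by (intro has_integral_add has_integral_diff has_integral_mult_right integrable_integral int)
    moreover have "0 \<le> (N u)\<^sup>2 - 2 * ?q * N u + ?q\<^sup>2" for u
      using zero_le_power2[of "N u - ?q"] by (simp add: power2_diff algebra_simps)
    ultimately have "0 \<le> integral {l..t} (\<lambda>u. (N u)\<^sup>2) - 2 * ?q * integral {l..t} N + ?q\<^sup>2 * (t - l)"
      by (rule has_integral_nonneg)
    moreover have "2 * ?q * integral {l..t} N = 2 * ?q\<^sup>2" using V[OF t] by (simp add: power2_eq_square)
    moreover have "?q\<^sup>2 * (t - l) \<le> ?q\<^sup>2 * 1" using t lr by (intro mult_left_mono) auto
    moreover have "integral {l..t} (\<lambda>u. (N u)\<^sup>2) \<le> ?E"
      using t by (intro integral_subset_le int) auto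
    ultimately show ?thesis by linarith
  qed
  have E0: "0 \<le> ?E" by (intro integral_nonneg int) auto
  have "integral {l..r} (\<lambda>u. (V u)\<^sup>2) \<le> ?E * (r - l)"
    by (rule integral_le_const) (use lr sq in \<open>auto intro!: integrable_continuous_real continuous_intros cV\<close>)
  also have "\<dots> \<le> ?E * (1 / 2)" using lr E0 by (intro mult_left_mono) auto
  finally have "?E \<le> 0" using le by simp
  then have "(V t)\<^sup>2 \<le> 0" using sq[OF t] by (rule order_trans[rotated])
  then show ?thesis by simp
qed

lemma planar_dependence:
  fixes d1 d2 d3 :: "real^2"
  obtains c1 c2 c3 :: real where "c1 \<noteq> 0 \<or> c2 \<noteq> 0 \<or> c3 \<noteq> 0" "c1 *\<^sub>R d1 + c2 *\<^sub>R d2 + c3 *\<^sub>R d3 = 0"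
proof (cases "cross2 d1 d2 = 0")
  case False
  have "cross2 d2 d3 *\<^sub>R d1 + cross2 d3 d1 *\<^sub>R d2 + cross2 d1 d2 *\<^sub>R d3 = 0"
    unfolding vec_eq_iff forall_2 by (simp add: cross2_def algebra_simps)
  then show ?thesis using that False by blast
next
  case True
  then have c: "d1$1 * d2$2 = d1$2 * d2$1" by (simp add: cross2_def)
  show ?thesis
  proof (cases "d1 = 0")
    case True
    then show ?thesis using that[of 1 0 0] by simp
  next
    case False
    then consider "d1$1 \<noteq> 0" | "d1$2 \<noteq> 0" unfolding vec_eq_iff forall_2 by auto
    then show ?thesis
    proof cases
      case 1
      have "(- (d2$1)) *\<^sub>R d1 + (d1$1) *\<^sub>R d2 + 0 *\<^sub>R d3 = 0"
        unfolding vec_eq_iff forall_2 using c by (simp add: algebra_simps)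
      then show ?thesis using that 1 by blast
    next
      case 2
      have "(- (d2$2)) *\<^sub>R d1 + (d1$2) *\<^sub>R d2 + 0 *\<^sub>R d3 = 0"
        unfolding vec_eq_iff forall_2 using c by (simp add: algebra_simps)
      then show ?thesis using that 2 by blast
    qed
  qed
qed

text \<open>Three consecutive nondegenerate arcs away from both circles can be dilated by factors \<open>1 + e c\<^sub>i\<close> so that the
  total displacement vanishes.  The functional is quadratic in \<open>e\<close>, and by the Poincare inequality
  its second-order term is negative, so that \<open>e\<close> or \<open>-e\<close> improves it.\<close>

lemma no_three_arcs:
  assumes s: "s0 \<le> s1" "s1 \<le> s2" "s2 \<le> s3" "s3 \<le> s0 + 1 / 2" and lam: "0 < lam"
    and free: "\<And>t. s0 \<le> t \<Longrightarrow> t \<le> s3 \<Longrightarrow> a < supp x t \<and> supp x t < b"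
    and r1: "s0 \<le> r1" "r1 \<le> s1" "x s0 \<bullet> nrm r1 < supp x r1"
    and r2: "s1 \<le> r2" "r2 \<le> s2" "x s1 \<bullet> nrm r2 < supp x r2"
    and r3: "s2 \<le> r3" "r3 \<le> s3" "x s2 \<bullet> nrm r3 < supp x r3"
  shows False
proof -
  obtain c1 c2 c3 where c: "c1 \<noteq> 0 \<or> c2 \<noteq> 0 \<or> c3 \<noteq> 0"
    and dep: "c1 *\<^sub>R (x s1 - x s0) + c2 *\<^sub>R (x s2 - x s1) + c3 *\<^sub>R (x s3 - x s2) = 0"
    by (rule planar_dependence)
  define k1 where "k1 = - (c1 *\<^sub>R x s0)"
  define k2 where "k2 = c1 *\<^sub>R (x s1 - x s0) - c2 *\<^sub>R x s1"
  define k3 where "k3 = c1 *\<^sub>R (x s1 - x s0) + c2 *\<^sub>R (x s2 - x s1) - c3 *\<^sub>R x s2"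
  \<comment> \<open>The displacement: on each arc a dilation by \<open>c\<^sub>i\<close>, with translations that make it continuous at \<open>s1\<close> and \<open>s2\<close>.\<close>
  define W where "W t = (if t \<le> s1 then c1 *\<^sub>R x t + k1 else if t \<le> s2 then c2 *\<^sub>R x t + k2 else c3 *\<^sub>R x t + k3)" for t
  have W1: "W t = c1 *\<^sub>R x t + k1" if "t \<le> s1" for t using that by (simp add: W_def)
  have W2: "W t = c2 *\<^sub>R x t + k2" if "s1 \<le> t" "t \<le> s2" for t
    using that by (cases "t = s1") (auto simp: W_def k1_def k2_def algebra_simps)
  have W3: "W t = c3 *\<^sub>R x t + k3" if "s2 \<le> t" for t
  proof (cases "t = s2")
    case True
    then have "W t = c2 *\<^sub>R x s2 + k2" using W2[of s2] s by simp
    then show ?thesis using True by (simp add: k2_def k3_def algebra_simps)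
  qed (use that s in \<open>auto simp: W_def\<close>)
  have Wends: "W s0 = 0" "W s3 = 0"
    using W1[of s0] W3[of s3] s dep by (auto simp: k1_def k3_def algebra_simps)
  define q where "q = \<bar>c1\<bar> + \<bar>c2\<bar> + \<bar>c3\<bar>"
  define B where "B = q * b + norm k1 + norm k2 + norm k3 + 1"
  have b: "0 < b" by (rule b_pos[OF T a0])
  have B: "0 < B" using b by (auto simp: B_def q_def intro!: add_nonneg_pos add_nonneg_nonneg)
  have WB: "norm (W t) \<le> B" for t
  proof -
    have *: "norm (c *\<^sub>R x t + k) \<le> B" if "\<bar>c\<bar> \<le> q" "norm k \<le> norm k1 + norm k2 + norm k3" for c k
    proof -
      have "norm (c *\<^sub>R x t + k) \<le> \<bar>c\<bar> * norm (x t) + norm k" using norm_triangle_ineq[of "c *\<^sub>R x t" k] by simp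
      also have "\<dots> \<le> q * b + (norm k1 + norm k2 + norm k3)"
        using that turning_norm_le[OF T, of t] by (intro add_mono mult_mono) (auto simp: q_def)
      finally show ?thesis by (simp add: B_def)
    qed
    show ?thesis unfolding W_def by (auto intro!: * simp: q_def)
  qed
  have s03: "s0 \<le> s3" "s3 < s0 + 2 * pi" using s pi_gt3 by linarith+
  obtain \<eta> where \<eta>: "0 < \<eta>" "\<And>t. s0 \<le> t \<Longrightarrow> t \<le> s3 \<Longrightarrow> a + \<eta> \<le> supp x t \<and> supp x t \<le> b - \<eta>"
    using supp_bounds_compact[OF s03(1) free] by blast
  have vary: "\<exists>z. turning a b z \<and> (\<forall>t. s0 \<le> t \<and> t \<le> s3 \<longrightarrow> z t = x t + e *\<^sub>R W t) \<and>
      integral {s0..s3} (dens lam x) \<le> integral {s0..s3} (dens lam z)"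
    if e: "\<bar>e\<bar> * B \<le> \<eta>" "\<bar>e\<bar> * q \<le> 1" for e
  proof -
    define y where "y t = x t + e *\<^sub>R W t" for t
    have fac: "0 \<le> 1 + e * c" if "\<bar>c\<bar> \<le> q" for c
    proof -
      have "\<bar>e * c\<bar> \<le> \<bar>e\<bar> * q" unfolding abs_mult using that by (intro mult_left_mono) auto
      then show ?thesis using e by linarith
    qed
    have "adm_on s0 s1 y"
      by (rule adm_on_scale[OF turning_adm_on[OF T] fac[of c1], where v = "e *\<^sub>R k1"])
         (auto simp: q_def y_def W1 algebra_simps)
    moreover have "adm_on s1 s2 y"
      by (rule adm_on_scale[OF turning_adm_on[OF T] fac[of c2], where v = "e *\<^sub>R k2"])
         (auto simp: q_def y_def W2 algebra_simps)
    moreover have "adm_on s2 s3 y"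
      by (rule adm_on_scale[OF turning_adm_on[OF T] fac[of c3], where v = "e *\<^sub>R k3"])
         (auto simp: q_def y_def W3 algebra_simps)
    ultimately have adm: "adm_on s0 s3 y" using adm_on_join by blast
    have ends: "y s0 = x s0" "y s3 = x s3" using Wends by (auto simp: y_def)
    have bounds: "a \<le> supp y t \<and> supp y t \<le> b" if t: "s0 \<le> t" "t \<le> s3" for t
    proof -
      have "\<bar>e * (W t \<bullet> nrm t)\<bar> \<le> \<bar>e\<bar> * B"
        unfolding abs_mult using abs_inner_nrm_le[of "W t" t] WB[of t] by (intro mult_left_mono) auto
      then have "\<bar>e * (W t \<bullet> nrm t)\<bar> \<le> \<eta>" using e by linarith
      then show ?thesis using \<eta>(2)[OF t] by (auto simp: y_def inner_add_left abs_le_iff)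
    qed
    obtain z where z: "turning a b z" "\<And>t. s0 \<le> t \<Longrightarrow> t \<le> s3 \<Longrightarrow> z t = y t"
      "\<And>t. s3 \<le> t \<Longrightarrow> t \<le> s0 + 2 * pi \<Longrightarrow> z t = x t"
      by (rule replace_arc[OF T s03 adm ends bounds]) blast+
    show ?thesis
      using z(1,2) local_minimality[OF z(1) s03 z(3)] unfolding y_def by blast
  qed
  \<comment> \<open>Small enough for the support function to stay in \<open>{a..b}\<close> and for the dilation factors to be nonnegative.\<close>
  define e where "e = min (\<eta> / B) (1 / (q + 1))"
  have q: "0 \<le> q" by (simp add: q_def)
  have e: "0 < e" using \<eta> B q by (simp add: e_def)
  have "e * B \<le> \<eta> / B * B" using B by (intro mult_right_mono) (auto simp: e_def)
  then have eB: "e * B \<le> \<eta>" using B by simp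
  have "e * q \<le> 1 / (q + 1) * (q + 1)" using q e by (intro mult_mono) (auto simp: e_def)
  then have eq1: "e * q \<le> 1" using q by simp
  obtain z where z: "turning a b z" "\<And>t. s0 \<le> t \<Longrightarrow> t \<le> s3 \<Longrightarrow> z t = x t + e *\<^sub>R W t"
    "integral {s0..s3} (dens lam x) \<le> integral {s0..s3} (dens lam z)"
    using vary[of e] e eB eq1 by auto
  obtain z' where z': "turning a b z'" "\<And>t. s0 \<le> t \<Longrightarrow> t \<le> s3 \<Longrightarrow> z' t = x t - e *\<^sub>R W t"
    "integral {s0..s3} (dens lam x) \<le> integral {s0..s3} (dens lam z')"
    using vary[of "- e"] e eB eq1 by auto
  define V where "V t = (supp z t - supp x t) / e" for t
  define N where "N t = (tco z t - tco x t) / e" for t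
  have VW: "V t = W t \<bullet> nrm t" and NW: "N t = W t \<bullet> tng t" if "s0 \<le> t" "t \<le> s3" for t
    using z(2)[OF that] e by (auto simp: V_def N_def inner_add_left)
  have Vint: "V t = integral {s0..t} N" if t: "s0 \<le> t" "t \<le> s3" for t
  proof -
    have "integral {s0..t} N = (integral {s0..t} (tco z) - integral {s0..t} (tco x)) / e"
      unfolding N_def
      by (simp add: Henstock_Kurzweil_Integration.integral_diff integrable_tco[OF T a0] integrable_tco[OF z(1) a0])
    also have "\<dots> = ((supp z t - supp z s0) - (supp x t - supp x s0)) / e"
      using supp_increment_eq_integral[OF z(1) a0 t(1)] supp_increment_eq_integral[OF T a0 t(1)] by simp
    also have "\<dots> = V t" using z(2)[of s0] Wends s03 by (simp add: V_def)
    finally show ?thesis by simp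
  qed
  have NB: "\<bar>N t\<bar> \<le> 2 * b / e" for t
    unfolding N_def abs_divide using abs_tco_le[OF z(1) a0, of t] abs_tco_le[OF T a0, of t] e
    by (intro frac_le) (auto simp: abs_le_iff)
  have Nm: "N \<in> borel_measurable borel"
    unfolding N_def by (intro borel_measurable_divide borel_measurable_diff borel_tco[OF z(1) a0] borel_tco[OF T a0] borel_measurable_const)
  have N1: "N integrable_on {u..v}" for u v by (rule integrable_bounded_borel[OF Nm NB])
  have N2: "(\<lambda>t. (N t)\<^sup>2) integrable_on {u..v}" for u v
  proof (rule integrable_bounded_borel)
    show "(\<lambda>t. (N t)\<^sup>2) \<in> borel_measurable borel" using Nm by measurable
    show "\<bar>(N t)\<^sup>2\<bar> \<le> (2 * b / e)\<^sup>2" for t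
      using NB[of t] power_mono[OF NB[of t], of 2] by simp
  qed
  have cV: "continuous_on {s0..s3} V"
    unfolding V_def using e by (intro continuous_intros continuous_supp[OF z(1) a0] continuous_supp[OF T a0]) auto
  have V2: "(\<lambda>t. (V t)\<^sup>2) integrable_on {s0..s3}"
    by (intro integrable_continuous_real continuous_intros cV)
  have sum: "dens lam z t + dens lam z' t - 2 * dens lam x t = (lam * e\<^sup>2) * ((V t)\<^sup>2 - (N t)\<^sup>2)"
    if t: "t \<in> {s0..s3}" for t
  proof -
    have eqs: "supp z t = supp x t + e * V t" "supp z' t = supp x t - e * V t"
      "tco z t = tco x t + e * N t" "tco z' t = tco x t - e * N t"
      using z(2)[of t] z'(2)[of t] VW[of t] NW[of t] t by (auto simp: inner_add_left inner_diff_left)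
    show ?thesis unfolding dens_def eqs by (simp add: power2_eq_square algebra_simps)
  qed
  have "0 \<le> integral {s0..s3} (dens lam z) + integral {s0..s3} (dens lam z') - 2 * integral {s0..s3} (dens lam x)"
    using z(3) z'(3) by simp
  also have "\<dots> = integral {s0..s3} (\<lambda>t. dens lam z t + dens lam z' t - 2 * dens lam x t)"
    by (rule integral_unique[symmetric])
       (intro has_integral_add has_integral_diff has_integral_mult_right integrable_integral
         integrable_dens[OF T a0] integrable_dens[OF z(1) a0] integrable_dens[OF z'(1) a0])
  also have "\<dots> = integral {s0..s3} (\<lambda>t. (lam * e\<^sup>2) * ((V t)\<^sup>2 - (N t)\<^sup>2))"
    by (rule Henstock_Kurzweil_Integration.integral_cong) (rule sum)
  also have "\<dots> = (lam * e\<^sup>2) * (integral {s0..s3} (\<lambda>t. (V t)\<^sup>2) - integral {s0..s3} (\<lambda>t. (N t)\<^sup>2))"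
    by (rule integral_unique) (intro has_integral_mult_right has_integral_diff integrable_integral V2 N2)
  finally have "0 \<le> (lam * e\<^sup>2) * (integral {s0..s3} (\<lambda>t. (V t)\<^sup>2) - integral {s0..s3} (\<lambda>t. (N t)\<^sup>2))" .
  moreover have "0 < lam * e\<^sup>2" using lam e by simp
  ultimately have "integral {s0..s3} (\<lambda>t. (N t)\<^sup>2) \<le> integral {s0..s3} (\<lambda>t. (V t)\<^sup>2)"
    by (metis diff_ge_0_iff_ge mult_pos_neg not_le)
  then have V0: "V t = 0" if "s0 \<le> t" "t \<le> s3" for t
    using poincare[OF s03(1) s(4) N1 N2 Vint cV] that by blast
  have W0: "W t \<bullet> nrm t = 0" if "s0 \<le> t" "t \<le> s3" for t using V0[OF that] VW[OF that] by simp
  have "c1 = 0"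
  proof -
    have "c1 * (supp x r1 - x s0 \<bullet> nrm r1) = 0"
      using W0[of r1] W1[of r1] r1 s by (simp add: k1_def inner_add_left algebra_simps)
    then show ?thesis using r1(3) by simp
  qed
  moreover have "c2 = 0"
  proof -
    have "c2 * (supp x r2 - x s1 \<bullet> nrm r2) = 0"
      using W0[of r2] W2[of r2] r2 s \<open>c1 = 0\<close> by (simp add: k2_def inner_add_left inner_diff_left algebra_simps)
    then show ?thesis using r2(3) by simp
  qed
  moreover have "c3 = 0"
  proof -
    have "c3 * (supp x r3 - x s2 \<bullet> nrm r3) = 0"
      using W0[of r3] W3[of r3] r3 s \<open>c1 = 0\<close> \<open>c2 = 0\<close> by (simp add: k3_def inner_add_left inner_diff_left algebra_simps)
    then show ?thesis using r3(3) by simp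
  qed
  ultimately show False using c by blast
qed

end

section \<open>Optimal sets are polygons\<close>

text \<open>The difference \<open>v - x s\<close> has a nonnegative product with all normals near \<open>s\<close> and vanishing product with \<open>nrm s\<close>, so
  its tangential component vanishes as well.\<close>

lemma vertex_of_supp:
  assumes T: "turning a b x" and s: "l < s" "s < r" and eq: "\<And>t. l < t \<Longrightarrow> t < r \<Longrightarrow> supp x t = v \<bullet> nrm t"
  shows "x s = v"
proof -
  define d where "d = v - x s"
  define e where "e = min 1 (min (s - l) (r - s) / 2)"
  have "0 < e" and e_le: "e \<le> 1" "e \<le> (s - l) / 2" "e \<le> (r - s) / 2"
    using s by (auto simp: e_def min_def)
  moreover have "e < pi" using e_le(1) pi_gt3 by linarith
  moreover have "l < s - e" using e_le(2) s by (simp add: field_simps)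
  moreover have "s + e < r" using e_le(3) s by (simp add: field_simps)
  ultimately have e: "0 < e" "e < pi" "l < s - e" "s + e < r" by blast+
  have d0: "d \<bullet> nrm s = 0" using eq[of s] s by (simp add: d_def inner_diff_left)
  have d1: "0 \<le> d \<bullet> nrm t" if "l < t" "t < r" for t
    using turningD(2)[OF T, of s t] eq[OF that] by (simp add: d_def inner_diff_left)
  have sp: "0 < sin e" using e by (intro sin_gt_zero) auto
  have "0 \<le> (d \<bullet> tng s) * sin e"
    using d1[of "s + e"] e s inner_nrm_rotate[of d "s + e" s] d0 by simp
  moreover have "0 \<le> - (d \<bullet> tng s) * sin e"
    using d1[of "s - e"] e s inner_nrm_rotate[of d "s - e" s] d0 sin_minus[of e] by simp
  ultimately have "d \<bullet> tng s = 0" using sp by (simp add: zero_le_mult_iff mult_le_0_iff)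
  then have "d = 0" using frame_decomp[of d s] d0 by simp
  then show ?thesis by (simp add: d_def)
qed

lemma vertex_or_arc:
  assumes T: "turning a b x" and lr: "l < r"
    and arc: "\<And>s t. l < s \<Longrightarrow> s < t \<Longrightarrow> t < r \<Longrightarrow> \<not> x s \<bullet> nrm t < supp x t"
  shows "\<exists>v. \<forall>t. l < t \<and> t < r \<longrightarrow> supp x t = v \<bullet> nrm t"
proof -
  have eq: "supp x t = x s \<bullet> nrm t" if "l < s" "s \<le> t" "t < r" for s t
    using arc[of s t] turningD(2)[OF T, of s t] that by (cases "s = t") auto
  define m where "m = (l + r) / 2"
  have m: "l < m" "m < r" using lr by (auto simp: m_def)
  have "supp x t = x m \<bullet> nrm t" if t: "l < t" "t < r" for t
  proof (cases "t < m")
    case True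
    then have "x m = x t"
      using eq t m by (intro vertex_of_supp[OF T, of t m r "x t"]) auto
    then show ?thesis by simp
  next
    case False
    then show ?thesis using eq[of m t] m t by simp
  qed
  then show ?thesis by blast
qed

text \<open>A point outside the hull of \<open>V\<close> is separated from \<open>V\<close> by a line, whose normal would contradict the formula for the support
  function.\<close>

lemma polygon_of_finite_vertices:
  assumes T: "turning a b x" and a0: "0 < a" and V: "finite V" "V \<subseteq> body x"
    and max: "\<And>t. \<exists>v\<in>V. supp x t = v \<bullet> nrm t"
  shows "convex_polygon (body x)"
proof -
  have ne: "V \<noteq> {}" using max by blast
  have "body x = convex hull V"
  proof
    show "convex hull V \<subseteq> body x" using V(2) body_convex[OF T a0] by (intro hull_minimal)
    show "body x \<subseteq> convex hull V"
    proof
      fix y assume y: "y \<in> body x"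
      show "y \<in> convex hull V"
      proof (rule ccontr)
        assume "y \<notin> convex hull V"
        moreover have "compact (convex hull V)" using V(1) by (intro compact_convex_hull finite_imp_compact)
        ultimately obtain t c where c: "c < y \<bullet> nrm t" "\<And>z. z \<in> convex hull V \<Longrightarrow> z \<bullet> nrm t < c"
          using separating_nrm[of "convex hull V" y] ne compact_imp_closed convex_convex_hull by (metis convex_hull_eq_empty)
        obtain v where "v \<in> V" "supp x t = v \<bullet> nrm t" using max by blast
        moreover have "y \<bullet> nrm t \<le> supp x t" using y by (simp add: body_def)
        ultimately show False using c(1) c(2)[of v] hull_inc[of v V] by fastforce
      qed
    qed
  qed
  then have "polytope (body x)" using V(1) unfolding polytope_def by blast
  moreover have "aff_dim (body x) = 2"
  proof -
    have "cball 0 a \<subseteq> body x" using body_in_convex_class[OF T] by (simp add: convex_class_def)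
    then have "ball 0 a \<subseteq> interior (body x)" by (meson ball_subset_cball interior_maximal open_ball order_trans)
    then have "interior (body x) \<noteq> {}" using a0 by (metis centre_in_ball empty_iff subsetD)
    then show ?thesis using aff_dim_nonempty_interior[of "body x"] by simp
  qed
  ultimately show ?thesis by (simp add: convex_polygon_def)
qed

lemma cos_ge_near_0:
  assumes "q < 1"
  obtains h0 :: real where "0 < h0" "h0 < pi / 2" "\<And>h. 0 \<le> h \<Longrightarrow> h \<le> h0 \<Longrightarrow> q \<le> cos h"
proof
  define h0 where "h0 = min 1 (1 - q)"
  have "h0 \<le> 1" by (simp add: h0_def)
  then show "h0 < pi / 2" using pi_gt3 by linarith
  show "0 < h0" using assms by (simp add: h0_def)
  fix h assume h: "0 \<le> h" "h \<le> h0"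
  have "h\<^sup>2 \<le> h" using h mult_left_le[of h h] by (simp add: h0_def power2_eq_square)
  then show "q \<le> cos h" using one_minus_cos_le[of h] h by (simp add: h0_def)
qed

context
  fixes a b lam :: real and x :: "real \<Rightarrow> real^2"
  assumes T: "turning a b x" and a0: "0 < a" and ab: "a < b"
    and minimal: "\<And>y. turning a b y \<Longrightarrow> J lam (body x) \<le> J lam (body y)"
    and lam: "1 / (2 * b) < lam" "lam < 2 / a"
begin

lemma lam_pos: "0 < lam"
  using lam b_pos[OF T a0] by (meson less_trans zero_less_divide_1_iff zero_less_mult_pos mult_pos_pos zero_less_numeral)

text \<open>Angles this close are covered by both replacement arguments.\<close>

lemma contact_gap:
  obtains \<delta> where "0 < \<delta>" "\<And>\<alpha> \<beta>. \<alpha> < \<beta> \<Longrightarrow> \<beta> \<le> \<alpha> + \<delta> \<Longrightarrow>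
     \<beta> - \<alpha> < pi \<and> a \<le> b * cos ((\<beta> - \<alpha>) / 2) \<and> 1 < 2 * lam * b * cos ((\<beta> - \<alpha>) / 2)"
proof -
  have b: "0 < b" by (rule b_pos[OF T a0])
  define p where "p = max (a / b) (1 / (2 * lam * b))"
  have l1: "1 < 2 * lam * b" using lam b by (simp add: field_simps)
  have "1 / (2 * lam * b) < 1" by (subst divide_less_eq_1_pos) (use l1 in linarith)+
  then have p: "0 < p" "p < 1" using a0 ab b by (auto simp: p_def less_max_iff_disj)
  obtain h0 where h0: "0 < h0" "h0 < pi / 2" "\<And>h. 0 \<le> h \<Longrightarrow> h \<le> h0 \<Longrightarrow> (1 + p) / 2 \<le> cos h"
    using cos_ge_near_0[of "(1 + p) / 2"] p by auto
  have "\<beta> - \<alpha> < pi \<and> a \<le> b * cos ((\<beta> - \<alpha>) / 2) \<and> 1 < 2 * lam * b * cos ((\<beta> - \<alpha>) / 2)"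
    if "\<alpha> < \<beta>" "\<beta> \<le> \<alpha> + 2 * h0" for \<alpha> \<beta>
  proof -
    \<comment> \<open>The last bound of the claim is strict, so \<open>cos\<close> has to stay above a number larger than \<open>p\<close>.\<close>
    have "p < (1 + p) / 2" using p by simp
    also have "(1 + p) / 2 \<le> cos ((\<beta> - \<alpha>) / 2)" using that by (intro h0(3)) auto
    finally have "p < cos ((\<beta> - \<alpha>) / 2)" .
    then have "a / b < cos ((\<beta> - \<alpha>) / 2)" "1 / (2 * lam * b) < cos ((\<beta> - \<alpha>) / 2)" by (auto simp: p_def)
    then show ?thesis using b l1 that h0 by (simp add: field_simps)
  qed
  then show ?thesis using that[of "2 * h0"] h0(1) by simp
qed

lemma supp_near:
  assumes "supp x \<theta> \<noteq> q"
  obtains \<rho> where "0 < \<rho>" "\<And>t. \<bar>t - \<theta>\<bar> < \<rho> \<Longrightarrow> supp x t \<noteq> q"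
proof -
  have b: "0 < b" by (rule b_pos[OF T a0])
  show ?thesis
  proof (rule that[of "\<bar>supp x \<theta> - q\<bar> / b"])
    show "0 < \<bar>supp x \<theta> - q\<bar> / b" using assms b by simp
    fix t assume "\<bar>t - \<theta>\<bar> < \<bar>supp x \<theta> - q\<bar> / b"
    then have "b * \<bar>t - \<theta>\<bar> < \<bar>supp x \<theta> - q\<bar>" using b by (simp add: field_simps)
    then show "supp x t \<noteq> q" using supp_lipschitz[OF T a0, of t \<theta>] by auto
  qed
qed

lemma free_arc:
  assumes ne: "\<And>t. l < t \<Longrightarrow> t < r \<Longrightarrow> supp x t \<noteq> a \<and> supp x t \<noteq> b" and t: "l < t" "t < r"
  shows "a < supp x t \<and> supp x t < b"
  using ne[OF t] turningD(3,4)[OF T, of t] by linarith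

text \<open>Otherwise nondegenerate arcs accumulate at \<open>\<theta>\<close>, and three of them fit into an interval of length at most \<open>1/2\<close>.\<close>

lemma free_vertex_right:
  assumes \<rho>: "0 < \<rho>" and ne: "\<And>t. \<theta> < t \<Longrightarrow> t < \<theta> + \<rho> \<Longrightarrow> supp x t \<noteq> a \<and> supp x t \<noteq> b"
  shows "\<exists>\<epsilon>>0. \<exists>v. \<forall>t. \<theta> < t \<and> t < \<theta> + \<epsilon> \<longrightarrow> supp x t = v \<bullet> nrm t"
proof (rule ccontr)
  assume no: "\<not> ?thesis"
  have ex: "\<exists>s t. \<theta> < s \<and> s < t \<and> t < \<theta> + \<epsilon> \<and> x s \<bullet> nrm t < supp x t" if "0 < \<epsilon>" for \<epsilon>
  proof (rule ccontr)
    assume "\<not> (\<exists>s t. \<theta> < s \<and> s < t \<and> t < \<theta> + \<epsilon> \<and> x s \<bullet> nrm t < supp x t)"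
    then have "\<exists>v. \<forall>t. \<theta> < t \<and> t < \<theta> + \<epsilon> \<longrightarrow> supp x t = v \<bullet> nrm t"
      using that by (intro vertex_or_arc[OF T]) auto
    then show False using no that by blast
  qed
  define \<rho>' where "\<rho>' = min \<rho> (1 / 2)"
  obtain s3 t3 where 3: "\<theta> < s3" "s3 < t3" "t3 < \<theta> + \<rho>'" "x s3 \<bullet> nrm t3 < supp x t3"
    using ex[of \<rho>'] \<rho> by (auto simp: \<rho>'_def)
  obtain s2 t2 where 2: "\<theta> < s2" "s2 < t2" "t2 < s3" "x s2 \<bullet> nrm t2 < supp x t2"
    using ex[of "s3 - \<theta>"] 3 by auto
  obtain s1 t1 where 1: "\<theta> < s1" "s1 < t1" "t1 < s2" "x s1 \<bullet> nrm t1 < supp x t1"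
    using ex[of "s2 - \<theta>"] 2 by auto
  show False
  proof (rule no_three_arcs[OF T a0 minimal, of s1 s2 s3 t3 t1 t2 t3])
    show "a < supp x t \<and> supp x t < b" if "s1 \<le> t" "t \<le> t3" for t
      using that 1 3 by (intro free_arc[of \<theta> "\<theta> + \<rho>"] ne) (auto simp: \<rho>'_def)
  qed (use 1 2 3 lam_pos in \<open>auto simp: \<rho>'_def\<close>)
qed

lemma free_vertex_left:
  assumes \<rho>: "0 < \<rho>" and ne: "\<And>t. \<theta> - \<rho> < t \<Longrightarrow> t < \<theta> \<Longrightarrow> supp x t \<noteq> a \<and> supp x t \<noteq> b"
  shows "\<exists>\<epsilon>>0. \<exists>v. \<forall>t. \<theta> - \<epsilon> < t \<and> t < \<theta> \<longrightarrow> supp x t = v \<bullet> nrm t"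
proof (rule ccontr)
  assume no: "\<not> ?thesis"
  have ex: "\<exists>s t. \<theta> - \<epsilon> < s \<and> s < t \<and> t < \<theta> \<and> x s \<bullet> nrm t < supp x t" if "0 < \<epsilon>" for \<epsilon>
  proof (rule ccontr)
    assume "\<not> (\<exists>s t. \<theta> - \<epsilon> < s \<and> s < t \<and> t < \<theta> \<and> x s \<bullet> nrm t < supp x t)"
    then have "\<exists>v. \<forall>t. \<theta> - \<epsilon> < t \<and> t < \<theta> \<longrightarrow> supp x t = v \<bullet> nrm t"
      using that by (intro vertex_or_arc[OF T]) auto
    then show False using no that by blast
  qed
  define \<rho>' where "\<rho>' = min \<rho> (1 / 2)"
  obtain s1 t1 where 1: "\<theta> - \<rho>' < s1" "s1 < t1" "t1 < \<theta>" "x s1 \<bullet> nrm t1 < supp x t1"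
    using ex[of \<rho>'] \<rho> by (auto simp: \<rho>'_def)
  obtain s2 t2 where 2: "t1 < s2" "s2 < t2" "t2 < \<theta>" "x s2 \<bullet> nrm t2 < supp x t2"
    using ex[of "\<theta> - t1"] 1 by auto
  obtain s3 t3 where 3: "t2 < s3" "s3 < t3" "t3 < \<theta>" "x s3 \<bullet> nrm t3 < supp x t3"
    using ex[of "\<theta> - t2"] 2 by auto
  show False
  proof (rule no_three_arcs[OF T a0 minimal, of s1 s2 s3 t3 t1 t2 t3])
    show "a < supp x t \<and> supp x t < b" if "s1 \<le> t" "t \<le> t3" for t
      using that 1 3 by (intro free_arc[of "\<theta> - \<rho>" \<theta>] ne) (auto simp: \<rho>'_def)
  qed (use 1 2 3 lam_pos in \<open>auto simp: \<rho>'_def\<close>)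
qed

text \<open>If the supporting lines at \<open>\<theta>\<close> and at some nearby larger angle touch the same circle, the arc between them is a chord or a
  corner; otherwise a free arc starts at \<open>\<theta>\<close>.  The left-hand version is the mirror image.\<close>

lemma vertex_right: "\<exists>\<epsilon>>0. \<exists>v. \<forall>t. \<theta> < t \<and> t < \<theta> + \<epsilon> \<longrightarrow> supp x t = v \<bullet> nrm t"
proof -
  obtain \<delta> where \<delta>: "0 < \<delta>" "\<And>\<alpha> \<beta>. \<alpha> < \<beta> \<Longrightarrow> \<beta> \<le> \<alpha> + \<delta> \<Longrightarrow>
     \<beta> - \<alpha> < pi \<and> a \<le> b * cos ((\<beta> - \<alpha>) / 2) \<and> 1 < 2 * lam * b * cos ((\<beta> - \<alpha>) / 2)"
    by (rule contact_gap) blast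
  consider (outer) \<beta> where "supp x \<theta> = b" "\<theta> < \<beta>" "\<beta> \<le> \<theta> + \<delta>" "supp x \<beta> = b"
    | (inner) \<beta> where "supp x \<theta> = a" "\<theta> < \<beta>" "\<beta> \<le> \<theta> + \<delta>" "supp x \<beta> = a"
    | (free) "supp x \<theta> = b \<Longrightarrow> \<forall>t. \<theta> < t \<and> t \<le> \<theta> + \<delta> \<longrightarrow> supp x t \<noteq> b"
      "supp x \<theta> = a \<Longrightarrow> \<forall>t. \<theta> < t \<and> t \<le> \<theta> + \<delta> \<longrightarrow> supp x t \<noteq> a" by blast
  then show ?thesis
  proof cases
    case outer
    have "supp x t = x \<theta> \<bullet> nrm t" if "\<theta> < t" "t < \<theta> + (\<beta> - \<theta>) / 2" for t
      using contact_outer(1)[OF T a0 minimal outer(2,1,4) lam_pos, of t] \<delta>(2)[OF outer(2,3)] that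
      by (simp add: field_simps)
    then show ?thesis using outer(2) by (intro exI[of _ "(\<beta> - \<theta>) / 2"]) auto
  next
    case inner
    obtain v where "\<And>t. \<theta> \<le> t \<and> t \<le> \<beta> \<Longrightarrow> supp x t = v \<bullet> nrm t"
      using contact_inner[OF T a0 minimal inner(2,1,4) lam_pos lam(2)] \<delta>(2)[OF inner(2,3)] by blast
    then show ?thesis using inner(2) by (intro exI[of _ "\<beta> - \<theta>"]) auto
  next
    case free
    have ex: "\<exists>\<rho>>0. \<forall>t. \<theta> < t \<and> t < \<theta> + \<rho> \<longrightarrow> supp x t \<noteq> q"
      if "supp x \<theta> = q \<Longrightarrow> \<forall>t. \<theta> < t \<and> t \<le> \<theta> + \<delta> \<longrightarrow> supp x t \<noteq> q" for q
    proof (cases "supp x \<theta> = q")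
      case True
      then show ?thesis using that \<delta>(1) by (intro exI[of _ \<delta>]) auto
    next
      case False
      then obtain \<rho> where "0 < \<rho>" "\<And>t. \<bar>t - \<theta>\<bar> < \<rho> \<Longrightarrow> supp x t \<noteq> q" using supp_near by blast
      then show ?thesis by (intro exI[of _ \<rho>]) auto
    qed
    obtain \<rho>1 where "0 < \<rho>1" "\<And>t. \<theta> < t \<Longrightarrow> t < \<theta> + \<rho>1 \<Longrightarrow> supp x t \<noteq> a" using ex[OF free(2)] by blast
    moreover obtain \<rho>2 where "0 < \<rho>2" "\<And>t. \<theta> < t \<Longrightarrow> t < \<theta> + \<rho>2 \<Longrightarrow> supp x t \<noteq> b" using ex[OF free(1)] by blast
    ultimately show ?thesis by (intro free_vertex_right[of "min \<rho>1 \<rho>2"]) auto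
  qed
qed

lemma vertex_left: "\<exists>\<epsilon>>0. \<exists>v. \<forall>t. \<theta> - \<epsilon> < t \<and> t < \<theta> \<longrightarrow> supp x t = v \<bullet> nrm t"
proof -
  obtain \<delta> where \<delta>: "0 < \<delta>" "\<And>\<alpha> \<beta>. \<alpha> < \<beta> \<Longrightarrow> \<beta> \<le> \<alpha> + \<delta> \<Longrightarrow>
     \<beta> - \<alpha> < pi \<and> a \<le> b * cos ((\<beta> - \<alpha>) / 2) \<and> 1 < 2 * lam * b * cos ((\<beta> - \<alpha>) / 2)"
    by (rule contact_gap) blast
  consider (outer) \<alpha> where "supp x \<theta> = b" "\<alpha> < \<theta>" "\<theta> \<le> \<alpha> + \<delta>" "supp x \<alpha> = b"
    | (inner) \<alpha> where "supp x \<theta> = a" "\<alpha> < \<theta>" "\<theta> \<le> \<alpha> + \<delta>" "supp x \<alpha> = a"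
    | (free) "supp x \<theta> = b \<Longrightarrow> \<forall>t. t < \<theta> \<and> \<theta> \<le> t + \<delta> \<longrightarrow> supp x t \<noteq> b"
      "supp x \<theta> = a \<Longrightarrow> \<forall>t. t < \<theta> \<and> \<theta> \<le> t + \<delta> \<longrightarrow> supp x t \<noteq> a" by blast
  then show ?thesis
  proof cases
    case outer
    have "supp x t = x \<theta> \<bullet> nrm t" if "\<theta> - (\<theta> - \<alpha>) / 2 < t" "t < \<theta>" for t
      using contact_outer(2)[OF T a0 minimal outer(2,4,1) lam_pos, of t] \<delta>(2)[OF outer(2,3)] that
      by (simp add: field_simps)
    then show ?thesis using outer(2) by (intro exI[of _ "(\<theta> - \<alpha>) / 2"]) auto
  next
    case inner
    obtain v where "\<And>t. \<alpha> \<le> t \<and> t \<le> \<theta> \<Longrightarrow> supp x t = v \<bullet> nrm t"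
      using contact_inner[OF T a0 minimal inner(2,4,1) lam_pos lam(2)] \<delta>(2)[OF inner(2,3)] by blast
    then show ?thesis using inner(2) by (intro exI[of _ "\<theta> - \<alpha>"]) auto
  next
    case free
    have ex: "\<exists>\<rho>>0. \<forall>t. \<theta> - \<rho> < t \<and> t < \<theta> \<longrightarrow> supp x t \<noteq> q"
      if "supp x \<theta> = q \<Longrightarrow> \<forall>t. t < \<theta> \<and> \<theta> \<le> t + \<delta> \<longrightarrow> supp x t \<noteq> q" for q
    proof (cases "supp x \<theta> = q")
      case True
      then show ?thesis using that \<delta>(1) by (intro exI[of _ \<delta>]) auto
    next
      case False
      then obtain \<rho> where "0 < \<rho>" "\<And>t. \<bar>t - \<theta>\<bar> < \<rho> \<Longrightarrow> supp x t \<noteq> q" using supp_near by blast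
      then show ?thesis by (intro exI[of _ \<rho>]) auto
    qed
    obtain \<rho>1 where "0 < \<rho>1" "\<And>t. \<theta> - \<rho>1 < t \<Longrightarrow> t < \<theta> \<Longrightarrow> supp x t \<noteq> a" using ex[OF free(2)] by blast
    moreover obtain \<rho>2 where "0 < \<rho>2" "\<And>t. \<theta> - \<rho>2 < t \<Longrightarrow> t < \<theta> \<Longrightarrow> supp x t \<noteq> b" using ex[OF free(1)] by blast
    ultimately show ?thesis by (intro free_vertex_left[of "min \<rho>1 \<rho>2"]) auto
  qed
qed

lemma minimizer_polygon: "convex_polygon (body x)"
proof -
  have "\<exists>\<epsilon>>0. \<exists>V. finite V \<and> V \<subseteq> body x \<and> (\<forall>t. \<bar>t - \<theta>\<bar> < \<epsilon> \<longrightarrow> (\<exists>v\<in>V. supp x t = v \<bullet> nrm t))" for \<theta>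
  proof -
    obtain e1 v1 where 1: "0 < e1" "\<And>t. \<theta> < t \<Longrightarrow> t < \<theta> + e1 \<Longrightarrow> supp x t = v1 \<bullet> nrm t"
      using vertex_right[of \<theta>] by blast
    obtain e2 v2 where 2: "0 < e2" "\<And>t. \<theta> - e2 < t \<Longrightarrow> t < \<theta> \<Longrightarrow> supp x t = v2 \<bullet> nrm t"
      using vertex_left[of \<theta>] by blast
    have "x (\<theta> + e1 / 2) = v1" using 1 by (intro vertex_of_supp[OF T, of \<theta> _ "\<theta> + e1"]) auto
    moreover have "x (\<theta> - e2 / 2) = v2" using 2 by (intro vertex_of_supp[OF T, of "\<theta> - e2" _ \<theta>]) auto
    ultimately have V: "{v1, v2, x \<theta>} \<subseteq> body x" using turning_mem_body[OF T] by blast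
    have "\<exists>v\<in>{v1, v2, x \<theta>}. supp x t = v \<bullet> nrm t" if "\<bar>t - \<theta>\<bar> < min e1 e2" for t
      using 1(2)[of t] 2(2)[of t] that by (cases t \<theta> rule: linorder_cases) auto
    then show ?thesis using V 1(1) 2(1)
      by (intro exI[of _ "min e1 e2"] conjI exI[of _ "{v1, v2, x \<theta>}"]) auto
  qed
  then obtain \<epsilon> V where \<epsilon>: "\<And>\<theta>. 0 < \<epsilon> \<theta>" and V: "\<And>\<theta>. finite (V \<theta>)" "\<And>\<theta>. V \<theta> \<subseteq> body x"
    "\<And>\<theta> t. \<bar>t - \<theta>\<bar> < \<epsilon> \<theta> \<Longrightarrow> \<exists>v\<in>V \<theta>. supp x t = v \<bullet> nrm t" by metis
  have "{0..2 * pi} \<subseteq> (\<Union>\<theta>\<in>UNIV. ball \<theta> (\<epsilon> \<theta>))" using centre_in_ball \<epsilon> by blast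
  then obtain D where D: "finite D" "{0..2 * pi} \<subseteq> (\<Union>\<theta>\<in>D. ball \<theta> (\<epsilon> \<theta>))"
    using compactE_image[of "{0..2 * pi}" UNIV "\<lambda>\<theta>. ball \<theta> (\<epsilon> \<theta>)"] by (metis compact_Icc open_ball)
  show ?thesis
  proof (rule polygon_of_finite_vertices[OF T a0])
    show "finite (\<Union>\<theta>\<in>D. V \<theta>)" "(\<Union>\<theta>\<in>D. V \<theta>) \<subseteq> body x" using D V by auto
    fix t
    obtain k where k: "0 \<le> t - 2 * pi * of_int k" "t - 2 * pi * of_int k < 0 + 2 * pi"
      by (rule exists_shift_into_period)
    define s where "s = t - 2 * pi * of_int k"
    have s: "s \<in> {0..2 * pi}" using k by (auto simp: s_def)
    then obtain \<theta> where \<theta>: "\<theta> \<in> D" "\<bar>s - \<theta>\<bar> < \<epsilon> \<theta>"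
      using D(2) by (auto simp: dist_real_def abs_minus_commute)
    obtain v where v: "v \<in> V \<theta>" "supp x s = v \<bullet> nrm s" using V(3)[OF \<theta>(2)] by blast
    have per: "x (s + 2 * pi * of_int k) = x s" "nrm (s + 2 * pi * of_int k) = nrm s"
      by (rule periodic_shift_int, simp add: turningD(1)[OF T])+
    have "supp x t = v \<bullet> nrm t" using v(2) per by (simp add: s_def)
    then show "\<exists>v\<in>(\<Union>\<theta>\<in>D. V \<theta>). supp x t = v \<bullet> nrm t" using v(1) \<theta>(1) by blast
  qed
qed

end

theorem theorem1p1:
  fixes a b :: real
  assumes "0 < a" and "a < b"
  shows "\<forall>lam\<ge>0. (\<exists>\<Omega>. optimal a b lam \<Omega>) \<and>
    (\<forall>\<Omega>. optimal a b lam \<Omega> \<longrightarrow>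
       (lam \<le> 1 / (2 * b) \<longrightarrow> \<Omega> = cball 0 b) \<and>
       (1 / (2 * b) < lam \<and> lam < 2 / a \<longrightarrow> convex_polygon \<Omega>) \<and>
       (2 / a < lam \<longrightarrow> \<Omega> = cball 0 a))"
proof (intro allI impI conjI)
  fix lam :: real assume "0 \<le> lam"
  then show "\<exists>\<Omega>. optimal a b lam \<Omega>" by (rule optimal_exists[OF assms])
next
  fix lam :: real and \<Omega> assume lam: "0 \<le> lam" and opt: "optimal a b lam \<Omega>"
  obtain x where x: "turning a b x" and \<Omega>: "\<Omega> = body x"
    by (rule convex_class_imp_body[OF assms(1) optimalD(1)[OF opt]])
  have minimal: "J lam (body x) \<le> J lam K" if "K \<in> convex_class a b" for K
    using optimalD(2)[OF opt that] \<Omega> by simp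
  show "\<Omega> = cball 0 b" if "lam \<le> 1 / (2 * b)"
    unfolding \<Omega> using assms
    by (intro small_lambda_disc[OF x assms(1) lam that] minimal disc_in_class) auto
  show "\<Omega> = cball 0 a" if "2 / a < lam"
    unfolding \<Omega> using assms
    by (intro large_lambda_disc[OF x assms(1) that] minimal disc_in_class) auto
  show "convex_polygon \<Omega>" if "1 / (2 * b) < lam \<and> lam < 2 / a"
    unfolding \<Omega> using that
    by (intro minimizer_polygon[OF x assms minimal] body_in_convex_class) auto
qed

end
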